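(* For every $n\ge1$, every $\alpha>0$ and every $0<p<\infty$, both constants $1$ and $2^{\max\{1,p\}}$ in the estimates $$\|T_\mu\|_{\mathcal S_p}^p\le\|T_\mu^{\mathrm{ph}}\|_{\mathcal S_p}^p\le2^{\max\{1,p\}}\|T_\mu\|_{\mathcal S_p}^p$$ (valid for all positive Borel measures $\mu$ on $\mathbb C^n$ whose Toeplitz form is bounded on $F^2_\alpha$ and $\mathrm{PH}^2_\alpha$ with $T_\mu,T_\mu^{\mathrm{ph}}\in\mathcal S_p$) are optimal: neither of the two inequalities holds for all such $\mu$ with a better constant.
   Context: $dV$ is Lebesgue measure on $\mathbb C^n$ and $d\mu_\alpha(z)=(\pi\alpha)^{-n}e^{-|z|^2/\alpha}\,dV(z)$. $F^2_\alpha$ is the closed subspace of $L^2(\mathbb C^n,d\mu_\alpha)$ of entire functions; $\mathrm{PH}^2_\alpha$ is the closed subspace of $L^2(\mathbb C^n,d\mu_\alpha)$ of pluriharmonic functions, i.e. complex-valued $C^2$ functions $f$ with $\partial^2 f/\partial z_j\partial\overline z_k=0$ for all $1\le j,k\le n$. Inner products are linear in the first variable. For a positive Borel measure $\mu$ the Toeplitz form is $q_\mu(f,g)=\int_{\mathbb C^n}f\,\overline{g}\,e^{-|z|^2/\alpha}\,d\mu(z)$. It is bounded on a Hilbert space $H$ of functions if the integral converges absolutely for all $f,g\in H$ and $|q_\mu(f,g)|\le C\|f\|_H\|g\|_H$ for some $C$; it is then represented by a unique bounded positive operator $T$ on $H$, $\langle Tf,g\rangle=q_\mu(f,g)$, denoted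 $T_\mu$ for $H=F^2_\alpha$ and $T_\mu^{\mathrm{ph}}$ for $H=\mathrm{PH}^2_\alpha$. For compact $T$ with singular values $s_k(T)$, $\|T\|_{\mathcal S_p}^p=\sum_ks_k(T)^p$, and $T\in\mathcal S_p$ means this is finite. *)

theory Defs
  imports "HOL-Analysis.Analysis" "HOL-Library.Function_Algebras"
begin

section \<open>The spaces\<close>

text \<open>
  \<open>\<complex>\<^sup>n\<close> is \<^typ>\<open>complex ^ 'n\<close>, with \<open>n = CARD('n) \<ge> 1\<close>. Its library norm is the Euclidean norm
  and \<^term>\<open>lborel\<close> on it is \<open>2n\<close>-dimensional Lebesgue measure.
\<close>

definition gauss :: "real \<Rightarrow> (complex ^ 'n) measure" where
  "gauss \<alpha> = density lborel
     (\<lambda>z. ennreal (1 / (pi * \<alpha>) ^ CARD('n) * exp (- (norm z)\<^sup>2 / \<alpha>)))"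

text \<open>
  All functions considered are continuous, and an \<open>L\<^sup>2\<close>-class contains at most one continuous
  function because \<^term>\<open>gauss \<alpha>\<close> has a positive density. Hence the elements of the Hilbert spaces
  are represented by actual functions.
\<close>

definition sq_integrable :: "real \<Rightarrow> (complex ^ 'n \<Rightarrow> complex) \<Rightarrow> bool" where
  "sq_integrable \<alpha> f \<longleftrightarrow>
     f \<in> borel_measurable borel \<and> integrable (gauss \<alpha>) (\<lambda>z. (norm (f z))\<^sup>2)"

definition ip :: "real \<Rightarrow> (complex ^ 'n \<Rightarrow> complex) \<Rightarrow> (complex ^ 'n \<Rightarrow> complex) \<Rightarrow> complex" where
  "ip \<alpha> f g = (\<integral>z. f z * cnj (g z) \<partial>(gauss \<alpha>))"

definition L2norm :: "real \<Rightarrow> (complex ^ 'n \<Rightarrow> complex) \<Rightarrow> real" where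
  "L2norm \<alpha> f = sqrt (\<integral>z. (norm (f z))\<^sup>2 \<partial>(gauss \<alpha>))"

definition entire :: "(complex ^ 'n \<Rightarrow> complex) \<Rightarrow> bool" where
  "entire f \<longleftrightarrow>
     (\<forall>z. \<exists>f'. (f has_derivative f') (at z) \<and> (\<forall>c v. f' (c *s v) = c * f' v))"

definition C1 :: "(complex ^ 'n \<Rightarrow> complex) \<Rightarrow> bool" where
  "C1 f \<longleftrightarrow> (\<forall>z. f differentiable (at z)) \<and>
     (\<forall>v. continuous_on UNIV (\<lambda>z. frechet_derivative f (at z) v))"

definition C2 :: "(complex ^ 'n \<Rightarrow> complex) \<Rightarrow> bool" where
  "C2 f \<longleftrightarrow> C1 f \<and> (\<forall>v. C1 (\<lambda>z. frechet_derivative f (at z) v))"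

text \<open>
  The Wirtinger derivatives \<open>\<partial>/\<partial>z\<^sub>j = (\<partial>/\<partial>x\<^sub>j - \<i> \<partial>/\<partial>y\<^sub>j) / 2\<close> and
  \<open>\<partial>/\<partial>\<bar>z\<^sub>j = (\<partial>/\<partial>x\<^sub>j + \<i> \<partial>/\<partial>y\<^sub>j) / 2\<close>; the directions of \<open>x\<^sub>j\<close> and \<open>y\<^sub>j\<close> are
  \<^term>\<open>axis j 1\<close> and \<^term>\<open>axis j \<i>\<close>.
\<close>

definition d_z :: "'n \<Rightarrow> (complex ^ 'n \<Rightarrow> complex) \<Rightarrow> complex ^ 'n \<Rightarrow> complex" where
  "d_z j f z =
     (frechet_derivative f (at z) (axis j 1) - \<i> * frechet_derivative f (at z) (axis j \<i>)) / 2"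

definition d_zbar :: "'n \<Rightarrow> (complex ^ 'n \<Rightarrow> complex) \<Rightarrow> complex ^ 'n \<Rightarrow> complex" where
  "d_zbar j f z =
     (frechet_derivative f (at z) (axis j 1) + \<i> * frechet_derivative f (at z) (axis j \<i>)) / 2"

definition pluriharmonic :: "(complex ^ 'n \<Rightarrow> complex) \<Rightarrow> bool" where
  "pluriharmonic f \<longleftrightarrow> C2 f \<and> (\<forall>j k z. d_z j (d_zbar k f) z = 0)"

definition Fock :: "real \<Rightarrow> (complex ^ 'n \<Rightarrow> complex) set" where
  "Fock \<alpha> = {f. entire f \<and> sq_integrable \<alpha> f}"

definition PH :: "real \<Rightarrow> (complex ^ 'n \<Rightarrow> complex) set" where
  "PH \<alpha> = {f. pluriharmonic f \<and> sq_integrable \<alpha> f}"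


section \<open>Operators on a Hilbert space of functions\<close>

text \<open>
  In this section \<open>H\<close> is a closed subspace of \<open>L\<^sup>2(gauss \<alpha>)\<close>. An operator on \<open>H\<close> is a total HOL
  function of which only the values on \<open>H\<close> matter.
\<close>

global_interpretation cfun: vector_space "\<lambda>(c::complex) (f::'a \<Rightarrow> complex) x. c * f x"
  by unfold_locales (auto simp: fun_eq_iff algebra_simps)

definition bounded_op ::
  "real \<Rightarrow> (complex ^ 'n \<Rightarrow> complex) set
     \<Rightarrow> ((complex ^ 'n \<Rightarrow> complex) \<Rightarrow> (complex ^ 'n \<Rightarrow> complex)) \<Rightarrow> bool" where
  "bounded_op \<alpha> H T \<longleftrightarrow>
     (\<forall>f\<in>H. T f \<in> H) \<and>
     (\<forall>f\<in>H. \<forall>g\<in>H. T (f + g) = T f + T g) \<and>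
     (\<forall>c. \<forall>f\<in>H. T (\<lambda>z. c * f z) = (\<lambda>z. c * T f z)) \<and>
     (\<exists>C. \<forall>f\<in>H. L2norm \<alpha> (T f) \<le> C * L2norm \<alpha> f)"

definition compact_op ::
  "real \<Rightarrow> (complex ^ 'n \<Rightarrow> complex) set
     \<Rightarrow> ((complex ^ 'n \<Rightarrow> complex) \<Rightarrow> (complex ^ 'n \<Rightarrow> complex)) \<Rightarrow> bool" where
  "compact_op \<alpha> H T \<longleftrightarrow> bounded_op \<alpha> H T \<and>
     (\<forall>f :: nat \<Rightarrow> complex ^ 'n \<Rightarrow> complex. \<forall>B.
        (\<forall>k. f k \<in> H \<and> L2norm \<alpha> (f k) \<le> B) \<longrightarrow>
        (\<exists>g\<in>H. \<exists>r. strict_mono r \<and> (\<lambda>k. L2norm \<alpha> (T (f (r k)) - g)) \<longlonglongrightarrow> 0))"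

definition adjoint_op ::
  "real \<Rightarrow> (complex ^ 'n \<Rightarrow> complex) set
     \<Rightarrow> ((complex ^ 'n \<Rightarrow> complex) \<Rightarrow> (complex ^ 'n \<Rightarrow> complex))
     \<Rightarrow> ((complex ^ 'n \<Rightarrow> complex) \<Rightarrow> (complex ^ 'n \<Rightarrow> complex))" where
  "adjoint_op \<alpha> H T =
     (SOME S. bounded_op \<alpha> H S \<and> (\<forall>f\<in>H. \<forall>g\<in>H. ip \<alpha> (T f) g = ip \<alpha> f (S g)))"

text \<open>
  The multiplicity of \<open>t > 0\<close> as a singular value of \<open>T\<close>, that is, as an eigenvalue of
  \<open>|T| = (T\<^sup>* T)\<^bsup>1/2\<^esup>\<close>, is the complex dimension of the eigenspace of \<open>T\<^sup>* T\<close> for \<open>t\<^sup>2\<close>.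
  For compact \<open>T\<close> this eigenspace is finite-dimensional.
\<close>

definition sv_multiplicity ::
  "real \<Rightarrow> (complex ^ 'n \<Rightarrow> complex) set
     \<Rightarrow> ((complex ^ 'n \<Rightarrow> complex) \<Rightarrow> (complex ^ 'n \<Rightarrow> complex)) \<Rightarrow> real \<Rightarrow> nat" where
  "sv_multiplicity \<alpha> H T t =
     cfun.dim {f \<in> H. adjoint_op \<alpha> H T (T f) = (\<lambda>z. complex_of_real (t\<^sup>2) * f z)}"

text \<open>
  The singular values of a compact \<open>T\<close>: the positive eigenvalues of \<open>|T|\<close> in nonincreasing order,
  repeated according to multiplicity, followed by zeros if there are only finitely many. These
  conditions determine the sequence.
\<close>

definition singular_values ::
  "real \<Rightarrow> (complex ^ 'n \<Rightarrow> complex) set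
     \<Rightarrow> ((complex ^ 'n \<Rightarrow> complex) \<Rightarrow> (complex ^ 'n \<Rightarrow> complex)) \<Rightarrow> nat \<Rightarrow> real" where
  "singular_values \<alpha> H T =
     (THE s. decseq s \<and> (\<forall>k. 0 \<le> s k) \<and>
        (\<forall>t>0. finite {k. s k = t} \<and> card {k. s k = t} = sv_multiplicity \<alpha> H T t))"

definition in_schatten ::
  "real \<Rightarrow> (complex ^ 'n \<Rightarrow> complex) set \<Rightarrow> real
     \<Rightarrow> ((complex ^ 'n \<Rightarrow> complex) \<Rightarrow> (complex ^ 'n \<Rightarrow> complex)) \<Rightarrow> bool" where
  "in_schatten \<alpha> H p T \<longleftrightarrow>
     compact_op \<alpha> H T \<and> summable (\<lambda>k. singular_values \<alpha> H T k powr p)"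

text \<open>The \<open>p\<close>-th power of the Schatten (quasi-)norm of an operator in the class \<open>S\<^sub>p\<close>.\<close>

definition schatten_pow ::
  "real \<Rightarrow> (complex ^ 'n \<Rightarrow> complex) set \<Rightarrow> real
     \<Rightarrow> ((complex ^ 'n \<Rightarrow> complex) \<Rightarrow> (complex ^ 'n \<Rightarrow> complex)) \<Rightarrow> real" where
  "schatten_pow \<alpha> H p T = (\<Sum>k. singular_values \<alpha> H T k powr p)"


section \<open>Toeplitz forms and operators\<close>

definition toeplitz_integrand ::
  "real \<Rightarrow> (complex ^ 'n \<Rightarrow> complex) \<Rightarrow> (complex ^ 'n \<Rightarrow> complex) \<Rightarrow> complex ^ 'n \<Rightarrow> complex" where
  "toeplitz_integrand \<alpha> f g z = f z * cnj (g z) * complex_of_real (exp (- (norm z)\<^sup>2 / \<alpha>))"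

definition toeplitz_form ::
  "real \<Rightarrow> (complex ^ 'n) measure
     \<Rightarrow> (complex ^ 'n \<Rightarrow> complex) \<Rightarrow> (complex ^ 'n \<Rightarrow> complex) \<Rightarrow> complex" where
  "toeplitz_form \<alpha> \<mu> f g = (\<integral>z. toeplitz_integrand \<alpha> f g z \<partial>\<mu>)"

definition toeplitz_form_bounded ::
  "real \<Rightarrow> (complex ^ 'n \<Rightarrow> complex) set \<Rightarrow> (complex ^ 'n) measure \<Rightarrow> bool" where
  "toeplitz_form_bounded \<alpha> H \<mu> \<longleftrightarrow>
     (\<forall>f\<in>H. \<forall>g\<in>H. integrable \<mu> (toeplitz_integrand \<alpha> f g)) \<and>
     (\<exists>C. \<forall>f\<in>H. \<forall>g\<in>H. norm (toeplitz_form \<alpha> \<mu> f g) \<le> C * L2norm \<alpha> f * L2norm \<alpha> g)"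

text \<open>
  If the form is bounded on \<open>H\<close>, the representing operator exists and is unique on \<open>H\<close>; it is
  positive because the form is.
\<close>

definition toeplitz_op ::
  "real \<Rightarrow> (complex ^ 'n \<Rightarrow> complex) set \<Rightarrow> (complex ^ 'n) measure
     \<Rightarrow> ((complex ^ 'n \<Rightarrow> complex) \<Rightarrow> (complex ^ 'n \<Rightarrow> complex))" where
  "toeplitz_op \<alpha> H \<mu> =
     (SOME T. bounded_op \<alpha> H T \<and> (\<forall>f\<in>H. \<forall>g\<in>H. ip \<alpha> (T f) g = toeplitz_form \<alpha> \<mu> f g))"

definition admissible :: "real \<Rightarrow> real \<Rightarrow> (complex ^ 'n) measure \<Rightarrow> bool" where
  "admissible \<alpha> p \<mu> \<longleftrightarrow>
     sets \<mu> = sets borel \<and>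
     toeplitz_form_bounded \<alpha> (Fock \<alpha>) \<mu> \<and>
     toeplitz_form_bounded \<alpha> (PH \<alpha>) \<mu> \<and>
     in_schatten \<alpha> (Fock \<alpha>) p (toeplitz_op \<alpha> (Fock \<alpha>) \<mu>) \<and>
     in_schatten \<alpha> (PH \<alpha>) p (toeplitz_op \<alpha> (PH \<alpha>) \<mu>)"

end

theory Submission
  imports Defs "HOL-Complex_Analysis.Complex_Analysis" "HOL-Probability.Probability"
begin

text \<open>
  On the \<open>z\<^sub>i\<close>-axis a pluriharmonic function is a sum of a holomorphic and an antiholomorphic
  power series, whose coefficients are its inner products with the normalized monomials \<open>e\<^sub>k\<close> in
  \<open>z\<^sub>i\<close> and their conjugates. So for a measure on this axis only these functions matter.
  For a unit mass at the point with \<open>z\<^sub>i = \<zeta>\<close> both Toeplitz operators have rank one, with eigenvalues \<open>1\<close>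
  and \<open>2 - exp (- |\<zeta>|\<^sup>2 / \<alpha>)\<close>: taking \<open>\<zeta> = 0\<close> shows that \<open>1\<close> is optimal, and
  \<open>|\<zeta>| \<rightarrow> \<infinity>\<close> gives \<open>2\<^sup>p\<close>.
  If \<open>p < 1\<close>, a Gaussian measure on the axis turns the Toeplitz operator into the dilation
  \<open>f(z) \<mapsto> f(0, \<dots>, r z\<^sub>i, \<dots>, 0)\<close>. Its eigenvalues are \<open>r\<^sup>k\<close>, simple on the Fock space and,
  for \<open>k > 0\<close>, double on the pluriharmonic space. With \<open>y = r\<^sup>p\<close> the quotient of the two sums
  is \<open>1 + y\<close>, which tends to \<open>2\<close> as \<open>r \<rightarrow> 1\<close>.
\<close>

text \<open>For n > 1 the functions \<open>E k\<close> span only a small part of either space. This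
  suffices because the form of a measure on the axis sees only values there and
  \<open>expand\<close> recovers these from the coefficients \<open>ip \<alpha> f (E k)\<close>; so
  the Toeplitz operator vanishes on the orthogonal complement of the \<open>E k\<close>. Singular
  values are defined by a description that involves a chosen adjoint, so each spectrum is exhibited
  by explicit orthonormal eigenvectors together with this vanishing. The term subtracted from 2 in
  the rank-one eigenvalue is due to the constants, which are both holomorphic and antiholomorphic
  and count only once; far from the origin they carry negligible weight. For point masses the
  quotient of the two sums stays below 2^p, hence below 2 if p < 1; there the doubling has to come
  from multiplicities instead of the size of one eigenvalue, and a slowly decaying spectrum makes
  the one simple eigenvalue negligible. Both spaces are instances of \<open>axis_space\<close>, in
  which \<open>d k\<close> is the degree of \<open>E k\<close>: \<open>k\<close> for the Fock space,
  \<open>(k + 1) div 2\<close> for the pluriharmonic space, where holomorphic and antiholomorphic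
  monomials alternate.\<close>

unbundle no fps_syntax

section \<open>Gaussian measures on \<open>\<complex>\<^sup>n\<close>\<close>

text \<open>Double counting: integrate 1_A(R x) 1_B(R x + y) over x and y, with B the unit ball,
  which R preserves. Integrating over y first gives |R^-1 A| |B|; integrating over x first and
  translating x turns the integrand into 1_A(R x - y) 1_B(R x), whose integral is |A| |B|. Since |B|
  is positive and finite, it cancels.\<close>

lemma distr_lborel_isometry:
  fixes R :: "'a::euclidean_space \<Rightarrow> 'a"
  assumes lin: "linear R" and nrm: "\<And>x. norm (R x) = norm x"
  shows "distr lborel borel R = lborel"
proof (rule measure_eqI)
  have [measurable]: "R \<in> borel_measurable borel"
    by (intro borel_measurable_continuous_onI linear_continuous_on lin[THEN linear_conv_bounded_linear[THEN iffD1]])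
  have inj: "inj R"
    using lin nrm by (metis linear_injective_0 norm_eq_zero)
  then have surj: "surj R"
    using linear_injective_imp_surjective[OF lin] by simp
  have trans: "(\<integral>\<^sup>+x. g (c + x) \<partial>lborel) = (\<integral>\<^sup>+x. g x \<partial>lborel)"
    if [measurable]: "g \<in> borel_measurable borel" for g and c :: 'a
    by (subst (2) lborel_distr_plus[symmetric, of c]) (simp add: nn_integral_distr)
  have refl: "(\<integral>\<^sup>+x. g (c - x) \<partial>lborel) = (\<integral>\<^sup>+x. g x \<partial>lborel)"
    if [measurable]: "g \<in> borel_measurable borel" for g and c :: 'a
    by (subst (2) lborel_affine[of "-1" c]) (simp_all add: nn_integral_distr density_1)
  fix A assume "A \<in> sets (distr lborel borel R)"
  then have [measurable]: "A \<in> sets borel" by simp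
  define B where "B = ball (0::'a) 1"
  have [measurable]: "B \<in> sets borel" by (simp add: B_def)
  have RB: "R -` B = B" by (auto simp: B_def nrm)
  have B: "emeasure lborel B \<noteq> 0" "emeasure lborel B \<noteq> \<infinity>"
    using content_ball_pos[of 1 "0::'a"] emeasure_lborel_ball_finite[of "0::'a" 1]
    by (auto simp: B_def measure_def)
  let ?L = "lborel :: 'a measure"
  have *: "(\<integral>\<^sup>+x. indicator A (R x) \<partial>?L) = emeasure ?L (R -` A)" if "A \<in> sets borel" for A
    using measurable_sets_borel[OF \<open>R \<in> borel_measurable borel\<close> that]
    by (simp add: nn_integral_indicator[symmetric] indicator_vimage[unfolded comp_def] del: nn_integral_indicator)
  have "emeasure ?L (R -` A) * emeasure ?L B
      = (\<integral>\<^sup>+x. \<integral>\<^sup>+y. indicator A (R x) * indicator B (R x + y) \<partial>?L \<partial>?L)"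
    using trans[of "indicator B"] by (simp add: nn_integral_cmult nn_integral_multc *)
  also have "\<dots> = (\<integral>\<^sup>+y. \<integral>\<^sup>+x. indicator A (R x) * indicator B (R x + y) \<partial>?L \<partial>?L)"
    by (rule lborel_pair.Fubini') measurable
  also have "\<dots> = (\<integral>\<^sup>+y. \<integral>\<^sup>+x. indicator A (R x - y) * indicator B (R x) \<partial>?L \<partial>?L)"
  proof (rule nn_integral_cong)
    fix y
    \<comment> \<open>Linearity turns the shift of \<open>R x\<close> by \<open>y\<close> into a
      shift of \<open>x\<close> by \<open>v\<close>, to which translation invariance
      applies.\<close>
    obtain v where v: "y = R v" using surj by (metis surjD)
    show "(\<integral>\<^sup>+x. indicator A (R x) * indicator B (R x + y) \<partial>?L)
        = (\<integral>\<^sup>+x. indicator A (R x - y) * indicator B (R x) \<partial>?L)"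
      using trans[of "\<lambda>x. indicator A (R x) * indicator B (R x + y)" "-v"]
      by (simp add: v linear_add[OF lin] linear_diff[OF lin] linear_neg[OF lin])
  qed
  also have "\<dots> = (\<integral>\<^sup>+x. \<integral>\<^sup>+y. indicator A (R x - y) * indicator B (R x) \<partial>?L \<partial>?L)"
    by (rule lborel_pair.Fubini'[symmetric]) measurable
  also have "\<dots> = emeasure ?L A * emeasure ?L B"
    using refl[of "indicator A"] by (simp add: nn_integral_cmult nn_integral_multc * RB)
  finally have "emeasure ?L B * emeasure ?L (R -` A) = emeasure ?L B * emeasure ?L A"
    by (simp only: mult.commute)
  then have "emeasure ?L (R -` A) = emeasure ?L A"
    unfolding ennreal_mult_cancel_left using B by auto
  then show "emeasure (distr lborel borel R) A = emeasure lborel A"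
    by (simp add: emeasure_distr)
qed simp

section \<open>The Gaussian density: normalization, invariance, integrability\<close>

definition gauss_dens :: "real \<Rightarrow> complex ^ 'n \<Rightarrow> real" where
  "gauss_dens \<alpha> z = 1 / (pi * \<alpha>) ^ CARD('n) * exp (- (norm z)\<^sup>2 / \<alpha>)"

lemma gauss_dens_measurable[measurable]: "gauss_dens \<alpha> \<in> borel_measurable borel"
  unfolding gauss_dens_def[abs_def] by measurable

lemma gauss_dens_pos: "\<alpha> > 0 \<Longrightarrow> gauss_dens \<alpha> z > 0"
  by (simp add: gauss_dens_def)

lemma gauss_eq: "gauss \<alpha> = density lborel (gauss_dens \<alpha>)"
  by (simp add: gauss_def gauss_dens_def[abs_def])

lemma sets_gauss[simp, measurable_cong]: "sets (gauss \<alpha>) = sets borel"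
  by (simp add: gauss_def)

lemma space_gauss[simp]: "space (gauss \<alpha>) = UNIV"
  by (simp add: gauss_def)

lemma measurable_gauss[simp]: "measurable (gauss \<alpha>) M = measurable borel M"
  by (rule measurable_cong_sets) auto

lemma DIM_cvec: "DIM(complex ^ 'n) = 2 * CARD('n)"
  by simp

lemma norm_sq_eq_sum_inner: "(norm (z::'a::euclidean_space))\<^sup>2 = (\<Sum>b\<in>Basis. (z \<bullet> b)\<^sup>2)"
  by (subst power2_norm_eq_inner, subst euclidean_inner) (simp add: power2_eq_square)

lemma prob_space_gauss:
  assumes "\<alpha> > 0"
  shows "prob_space (gauss \<alpha> :: (complex ^ 'n) measure)"
proof
  \<comment> \<open>With variance \<alpha>/2 in each of the 2n real coordinates, the product of the
    normal densities has exponent -|z|^2/\<alpha> and normalization (pi \<alpha>)^-n.\<close>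
  let ?\<sigma> = "sqrt (\<alpha> / 2)"
  have \<sigma>: "?\<sigma> > 0" using assms by simp
  have nd: "(\<integral>\<^sup>+x. normal_density 0 ?\<sigma> x \<partial>lborel) = 1"
    using prob_space.emeasure_space_1[OF prob_space_normal_density[OF \<sigma>, of 0]]
    by (simp add: emeasure_density)
  have eq: "ennreal (gauss_dens \<alpha> z) = (\<Prod>b\<in>Basis. ennreal (normal_density 0 ?\<sigma> (z \<bullet> b)))"
    for z :: "complex ^ 'n"
  proof -
    have "(\<Prod>b\<in>Basis. normal_density 0 ?\<sigma> (z \<bullet> b))
        = (1 / sqrt (pi * \<alpha>)) ^ DIM(complex ^ 'n) * exp (\<Sum>b\<in>Basis. - (z \<bullet> b)\<^sup>2 / \<alpha>)"
      using assms by (simp add: normal_density_def prod_dividef exp_sum power_one_over)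
    also have "(1 / sqrt (pi * \<alpha>)) ^ DIM(complex ^ 'n) = 1 / (pi * \<alpha>) ^ CARD('n)"
      using assms unfolding DIM_cvec power_mult by (simp add: power_one_over power_divide)
    also have "(\<Sum>b\<in>Basis. - (z \<bullet> b)\<^sup>2 / \<alpha>) = - (norm z)\<^sup>2 / \<alpha>"
      unfolding norm_sq_eq_sum_inner by (simp add: sum_negf sum_divide_distrib)
    finally show ?thesis
      by (simp add: gauss_dens_def prod_ennreal)
  qed
  show "emeasure (gauss \<alpha>) (space (gauss \<alpha> :: (complex ^ 'n) measure)) = 1"
    unfolding gauss_eq using nn_integral_lborel_prod[of "\<lambda>_::complex ^ 'n. normal_density 0 ?\<sigma>"]
    by (simp add: emeasure_density eq nn_integral_lborel_prod[of "\<lambda>_ x. ennreal (normal_density 0 ?\<sigma> x)"] nd)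
qed

lemma AE_gauss_iff: "\<alpha> > 0 \<Longrightarrow> (AE z in gauss \<alpha>. P z) \<longleftrightarrow> (AE z in lborel. P z)"
  unfolding gauss_eq by (subst AE_density) (auto simp: gauss_dens_pos)

lemma integral_gauss:
  fixes f :: "complex ^ 'n \<Rightarrow> 'b::{banach, second_countable_topology}"
  assumes "f \<in> borel_measurable borel" "\<alpha> > 0"
  shows "integral\<^sup>L (gauss \<alpha>) f = (\<integral>z. gauss_dens \<alpha> z *\<^sub>R f z \<partial>lborel)"
  unfolding gauss_eq using assms
  by (subst integral_density) (auto simp: gauss_dens_pos less_imp_le)

lemma integrable_gauss:
  fixes f :: "complex ^ 'n \<Rightarrow> 'b::{banach, second_countable_topology}"
  assumes "f \<in> borel_measurable borel" "\<alpha> > 0"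
  shows "integrable (gauss \<alpha>) f \<longleftrightarrow> integrable lborel (\<lambda>z. gauss_dens \<alpha> z *\<^sub>R f z)"
  unfolding gauss_eq using assms
  by (subst integrable_density) (auto simp: gauss_dens_pos less_imp_le)

lemma distr_gauss_isometry:
  fixes R :: "complex ^ 'n \<Rightarrow> complex ^ 'n"
  assumes "linear R" and nrm: "\<And>z. norm (R z) = norm z"
  shows "distr (gauss \<alpha>) borel R = gauss \<alpha>"
proof -
  have [measurable]: "R \<in> borel_measurable borel"
    by (intro borel_measurable_continuous_onI linear_continuous_on assms(1)[THEN linear_conv_bounded_linear[THEN iffD1]])
  have "gauss \<alpha> = density (distr lborel borel R) (gauss_dens \<alpha>)"
    by (simp add: gauss_eq distr_lborel_isometry[OF assms])
  also have "\<dots> = distr (density lborel (\<lambda>z. gauss_dens \<alpha> (R z))) borel R"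
    by (subst density_distr) auto
  also have "(\<lambda>z. gauss_dens \<alpha> (R z)) = gauss_dens \<alpha>"
    by (simp add: gauss_dens_def fun_eq_iff nrm)
  finally show ?thesis by (simp add: gauss_eq)
qed

text \<open>Half of the Gaussian exponent absorbs the growth exp(c |z|). What remains is a multiple
  of the Gaussian density with parameter 2\<alpha>, which has total mass one; the factor 2^n is the
  quotient of the two normalizations.\<close>

lemma integrable_gauss_exp_bound:
  fixes f :: "complex ^ 'n \<Rightarrow> 'b::{banach, second_countable_topology}"
  assumes [measurable]: "f \<in> borel_measurable borel" and \<alpha>: "\<alpha> > 0"
    and bd: "\<And>z. norm (f z) \<le> C * exp (c * norm z)"
  shows "integrable (gauss \<alpha>) f"
proof -
  interpret g2: prob_space "gauss (2 * \<alpha>) :: (complex ^ 'n) measure"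
    using \<alpha> by (intro prob_space_gauss) simp
  have "integrable (gauss (2 * \<alpha>) :: (complex ^ 'n) measure) (\<lambda>z. 1::real)"
    by simp
  then have int2: "integrable lborel (gauss_dens (2 * \<alpha>) :: complex ^ 'n \<Rightarrow> real)"
    using \<alpha> by (subst (asm) integrable_gauss) auto
  have "C \<ge> 0" using order_trans[OF norm_ge_zero bd[of 0]] by simp
  show ?thesis
  proof (subst integrable_gauss)
    show "integrable lborel (\<lambda>z. gauss_dens \<alpha> z *\<^sub>R f z)"
    proof (rule Bochner_Integration.integrable_bound)
      show "integrable lborel (\<lambda>z. C * exp (\<alpha> * c\<^sup>2 / 2) * 2 ^ CARD('n) * gauss_dens (2 * \<alpha>) (z :: complex ^ 'n))"
        using int2 by simp
      show "AE z in lborel. norm (gauss_dens \<alpha> z *\<^sub>R f z) \<le> norm (C * exp (\<alpha> * c\<^sup>2 / 2) * 2 ^ CARD('n) * gauss_dens (2 * \<alpha>) (z :: complex ^ 'n))"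
      proof (rule AE_I2)
        fix z :: "complex ^ 'n"
        \<comment> \<open>Completing the square bounds c |z| - |z|^2/\<alpha> by \<alpha> c^2/2 -
          |z|^2/(2\<alpha>).\<close>
        have "0 \<le> (norm z - \<alpha> * c)\<^sup>2 / (2 * \<alpha>)" using \<alpha> by simp
        also have "\<dots> = \<alpha> * c\<^sup>2 / 2 - (norm z)\<^sup>2 / (2 * \<alpha>) - (c * norm z - (norm z)\<^sup>2 / \<alpha>)"
          using \<alpha> by (simp add: power2_eq_square field_simps)
        finally have "exp (- (norm z)\<^sup>2 / \<alpha>) * exp (c * norm z) \<le> exp (\<alpha> * c\<^sup>2 / 2) * exp (- (norm z)\<^sup>2 / (2 * \<alpha>))"
          unfolding exp_add[symmetric] by simp
        then have "C * (exp (- (norm z)\<^sup>2 / \<alpha>) * exp (c * norm z)) \<le> C * (exp (\<alpha> * c\<^sup>2 / 2) * exp (- (norm z)\<^sup>2 / (2 * \<alpha>)))"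
          using \<open>C \<ge> 0\<close> by (rule mult_left_mono)
        moreover have "exp (- (norm z)\<^sup>2 / \<alpha>) * norm (f z) \<le> exp (- (norm z)\<^sup>2 / \<alpha>) * (C * exp (c * norm z))"
          by (intro mult_left_mono bd) simp
        moreover have "exp (- (norm z)\<^sup>2 / \<alpha>) * (C * exp (c * norm z)) = C * (exp (- (norm z)\<^sup>2 / \<alpha>) * exp (c * norm z))"
          by (rule mult.left_commute)
        ultimately have *: "exp (- (norm z)\<^sup>2 / \<alpha>) * norm (f z) \<le> C * (exp (\<alpha> * c\<^sup>2 / 2) * exp (- (norm z)\<^sup>2 / (2 * \<alpha>)))"
          by linarith
        have "norm (gauss_dens \<alpha> z *\<^sub>R f z) = (exp (- (norm z)\<^sup>2 / \<alpha>) * norm (f z)) / (pi * \<alpha>) ^ CARD('n)"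
          using \<alpha> by (simp add: gauss_dens_def)
        also have "\<dots> \<le> C * (exp (\<alpha> * c\<^sup>2 / 2) * exp (- (norm z)\<^sup>2 / (2 * \<alpha>))) / (pi * \<alpha>) ^ CARD('n)"
          using \<alpha> by (intro divide_right_mono *) simp
        also have "\<dots> = C * exp (\<alpha> * c\<^sup>2 / 2) * 2 ^ CARD('n) * gauss_dens (2 * \<alpha>) z"
          by (simp add: gauss_dens_def power_mult_distrib)
        also have "\<dots> \<le> norm \<dots>" by simp
        finally show "norm (gauss_dens \<alpha> z *\<^sub>R f z) \<le> norm (C * exp (\<alpha> * c\<^sup>2 / 2) * 2 ^ CARD('n) * gauss_dens (2 * \<alpha>) z)" .
      qed
    qed measurable
  qed (use \<alpha> in auto)
qed

text \<open>Translation invariance of Lebesgue measure; the exponential factor is the quotient of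
  the densities at \<open>a + z\<close> and \<open>z\<close> (the Cameron-Martin formula).\<close>

lemma gauss_translate:
  fixes f :: "complex ^ 'n \<Rightarrow> 'b::{banach, second_countable_topology}"
  assumes [measurable]: "f \<in> borel_measurable borel" and \<alpha>: "\<alpha> > 0"
  shows "(\<integral>z. f z \<partial>gauss \<alpha>) = (\<integral>z. exp (((norm z)\<^sup>2 - (norm (a + z))\<^sup>2) / \<alpha>) *\<^sub>R f (a + z) \<partial>gauss \<alpha>)"
proof -
  have "(\<integral>z. f z \<partial>gauss \<alpha>) = (\<integral>z. gauss_dens \<alpha> z *\<^sub>R f z \<partial>distr lborel borel ((+) a))"
    by (simp add: integral_gauss \<alpha> lborel_distr_plus)
  also have "\<dots> = (\<integral>z. gauss_dens \<alpha> (a + z) *\<^sub>R f (a + z) \<partial>lborel)"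
    by (subst integral_distr) auto
  also have "\<dots> = (\<integral>z. gauss_dens \<alpha> z *\<^sub>R exp (((norm z)\<^sup>2 - (norm (a + z))\<^sup>2) / \<alpha>) *\<^sub>R f (a + z) \<partial>lborel)"
    by (intro Bochner_Integration.integral_cong refl)
      (simp add: gauss_dens_def exp_add[symmetric] diff_divide_distrib)
  also have "\<dots> = (\<integral>z. exp (((norm z)\<^sup>2 - (norm (a + z))\<^sup>2) / \<alpha>) *\<^sub>R f (a + z) \<partial>gauss \<alpha>)"
    by (subst integral_gauss) (auto simp: \<alpha>)
  finally show ?thesis .
qed

text \<open>Every \<open>R t\<close> preserves the Gaussian measure, so the integral of
  \<open>f (R t z)\<close> over z is independent of t. Averaging over t and exchanging the integrals
  replaces f by its mean along the orbits of R.\<close>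

lemma gauss_average:
  fixes f :: "complex ^ 'n \<Rightarrow> complex" and R :: "real \<Rightarrow> complex ^ 'n \<Rightarrow> complex ^ 'n"
  assumes \<alpha>: "\<alpha> > 0" and contf: "continuous_on UNIV f" and intf: "integrable (gauss \<alpha>) f"
    and contR: "continuous_on UNIV (\<lambda>(t, z). R t z)"
    and linR: "\<And>t. linear (R t)" and normR: "\<And>t z. norm (R t z) = norm z"
    and I: "\<And>z. ((\<lambda>t. f (R t z)) has_integral I z) {0..1}"
  shows "integral\<^sup>L (gauss \<alpha>) f = integral\<^sup>L (gauss \<alpha>) I" "integrable (gauss \<alpha>) I"
proof -
  \<comment> \<open>The uniform distribution on [0,1]; as a probability measure it makes the average
    over t an iterated integral.\<close>
  define U where "U = density lborel (\<lambda>t. ennreal (indicator {0..1::real} t))"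
  interpret g: prob_space "gauss \<alpha> :: (complex ^ 'n) measure"
    using \<alpha> by (rule prob_space_gauss)
  have U1: "emeasure U (space U) = 1"
    by (simp add: U_def emeasure_density nn_integral_indicator ennreal_indicator)
  interpret U: prob_space U
    by standard (rule U1)
  interpret pair_sigma_finite "gauss \<alpha> :: (complex ^ 'n) measure" U ..
  interpret P: pair_sigma_finite U "gauss \<alpha> :: (complex ^ 'n) measure" ..
  have sU[measurable_cong]: "sets U = sets borel" by (simp add: U_def)
  have [measurable]: "f \<in> borel_measurable borel"
    by (rule borel_measurable_continuous_onI) (rule contf)
  have [measurable]: "(\<lambda>(t, z). R t z) \<in> borel_measurable (borel \<Otimes>\<^sub>M borel)"
    unfolding borel_prod by (rule borel_measurable_continuous_onI) (rule contR)
  have [measurable]: "R t \<in> borel_measurable borel" for t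
    by (intro borel_measurable_continuous_onI linear_continuous_on linR[THEN linear_conv_bounded_linear[THEN iffD1]])
  have contRt: "continuous_on UNIV (\<lambda>t. R t z)" for z
    using continuous_on_compose2[OF contR, of UNIV "\<lambda>t. (t, z)"] by (simp add: continuous_on_Pair)
  have inv: "integrable (gauss \<alpha>) (\<lambda>z. h (R t z))" "(\<integral>z. h (R t z) \<partial>gauss \<alpha>) = integral\<^sup>L (gauss \<alpha>) h"
    if "integrable (gauss \<alpha>) h" for h :: "complex ^ 'n \<Rightarrow> 'b::{banach, second_countable_topology}" and t
  proof -
    have [measurable]: "h \<in> borel_measurable borel" using that by auto
    have "distr (gauss \<alpha>) borel (R t) = gauss \<alpha>"
      by (rule distr_gauss_isometry[OF linR normR])
    then show "integrable (gauss \<alpha>) (\<lambda>z. h (R t z))" "(\<integral>z. h (R t z) \<partial>gauss \<alpha>) = integral\<^sup>L (gauss \<alpha>) h"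
      using that integrable_distr_eq[of "R t" "gauss \<alpha>" borel h] integral_distr[of "R t" "gauss \<alpha>" borel h] by auto
  qed
  have int: "integrable (U \<Otimes>\<^sub>M gauss \<alpha>) (\<lambda>(t, z). f (R t z))"
  proof (rule P.Fubini_integrable)
    show "(\<lambda>(t, z). f (R t z)) \<in> borel_measurable (U \<Otimes>\<^sub>M gauss \<alpha>)"
      by measurable
    show "integrable U (\<lambda>t. \<integral>z. norm (case (t, z) of (t, z) \<Rightarrow> f (R t z)) \<partial>gauss \<alpha>)"
      using inv(2)[OF integrable_norm[OF intf]] by simp
    show "AE t in U. integrable (gauss \<alpha>) (\<lambda>z. case (t, z) of (t, z) \<Rightarrow> f (R t z))"
      using inv(1)[OF intf] by simp
  qed
  have I_eq: "(\<integral>t. f (R t z) \<partial>U) = I z" for z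
  proof -
    have c: "continuous_on {0..1} (\<lambda>t. f (R t z))"
      by (rule continuous_on_subset[OF continuous_on_compose2[OF contf contRt]]) auto
    have "(\<integral>t. f (R t z) \<partial>U) = (LINT t:{0..1}|lborel. f (R t z))"
      unfolding U_def set_lebesgue_integral_def
      by (subst integral_density)
         (auto intro!: borel_measurable_continuous_onI continuous_on_compose2[OF contf contRt])
    also have "\<dots> = integral {0..1} (\<lambda>t. f (R t z))"
      by (intro set_borel_integral_eq_integral borel_integrable_atLeastAtMost' c)
    also have "\<dots> = I z" using I by (rule integral_unique)
    finally show ?thesis .
  qed
  then have "integral\<^sup>L (gauss \<alpha>) I = (\<integral>z. (\<integral>t. f (R t z) \<partial>U) \<partial>gauss \<alpha>)" by simp
  also have "\<dots> = (\<integral>t. (\<integral>z. f (R t z) \<partial>gauss \<alpha>) \<partial>U)"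
    by (rule P.Fubini_integral[OF int])
  also have "\<dots> = integral\<^sup>L (gauss \<alpha>) f"
    using inv(2)[OF intf] U.prob_space by simp
  finally show "integral\<^sup>L (gauss \<alpha>) f = integral\<^sup>L (gauss \<alpha>) I" by simp
  show "integrable (gauss \<alpha>) I"
    using P.integrable_snd[OF int] by (simp add: I_eq)
qed

section \<open>Hilbert spaces of continuous functions\<close>

lemma sq_integrable_int: "sq_integrable \<alpha> f \<Longrightarrow> integrable (gauss \<alpha>) (\<lambda>z. (norm (f z))\<^sup>2)"
  by (simp add: sq_integrable_def)

lemma borel_measurable_cnj[measurable (raw)]:
  "f \<in> borel_measurable M \<Longrightarrow> (\<lambda>x. cnj (f x)) \<in> borel_measurable M"
  by (rule measurable_compose[of f M borel cnj])
    (auto intro!: borel_measurable_continuous_onI continuous_intros)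

lemma sq_integrable_mult:
  assumes "sq_integrable \<alpha> f" "sq_integrable \<alpha> g"
  shows "integrable (gauss \<alpha>) (\<lambda>z. f z * cnj (g z))"
proof (rule Bochner_Integration.integrable_bound)
  have [measurable]: "f \<in> borel_measurable borel" "g \<in> borel_measurable borel"
    using assms by (auto simp: sq_integrable_def)
  show "integrable (gauss \<alpha>) (\<lambda>z. (norm (f z))\<^sup>2 + (norm (g z))\<^sup>2)"
    using assms by (auto simp: sq_integrable_def)
  show "AE z in gauss \<alpha>. norm (f z * cnj (g z)) \<le> norm ((norm (f z))\<^sup>2 + (norm (g z))\<^sup>2)"
  proof (rule AE_I2)
    fix z
    have "2 * (norm (f z) * norm (g z)) \<le> (norm (f z))\<^sup>2 + (norm (g z))\<^sup>2"
      using zero_le_power2[of "norm (f z) - norm (g z)"] by (simp add: power2_diff)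
    moreover have "0 \<le> norm (f z) * norm (g z)" by simp
    ultimately show "norm (f z * cnj (g z)) \<le> norm ((norm (f z))\<^sup>2 + (norm (g z))\<^sup>2)"
      unfolding norm_mult complex_mod_cnj real_norm_def by linarith
  qed
  show "(\<lambda>z. f z * cnj (g z)) \<in> borel_measurable (gauss \<alpha>)"
    by measurable
qed

lemma sq_integrable_scale: "sq_integrable \<alpha> f \<Longrightarrow> sq_integrable \<alpha> (\<lambda>z. c * f z)"
  by (auto simp: sq_integrable_def norm_mult power_mult_distrib)

lemma sq_integrable_add:
  assumes "sq_integrable \<alpha> f" "sq_integrable \<alpha> g"
  shows "sq_integrable \<alpha> (\<lambda>z. f z + g z)"
  unfolding sq_integrable_def
proof
  show m[measurable]: "(\<lambda>z. f z + g z) \<in> borel_measurable borel"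
    using assms by (auto simp: sq_integrable_def)
  show "integrable (gauss \<alpha>) (\<lambda>z. (norm (f z + g z))\<^sup>2)"
  proof (rule Bochner_Integration.integrable_bound)
    show "integrable (gauss \<alpha>) (\<lambda>z. 2 * ((norm (f z))\<^sup>2 + (norm (g z))\<^sup>2))"
      using assms by (auto simp: sq_integrable_def)
    show "AE z in gauss \<alpha>. norm ((norm (f z + g z))\<^sup>2) \<le> norm (2 * ((norm (f z))\<^sup>2 + (norm (g z))\<^sup>2))"
    proof (rule AE_I2)
      fix z
      have "(norm (f z + g z))\<^sup>2 \<le> (norm (f z) + norm (g z))\<^sup>2"
        by (intro power_mono norm_triangle_ineq) simp
      also have "\<dots> \<le> 2 * ((norm (f z))\<^sup>2 + (norm (g z))\<^sup>2)"
        using zero_le_power2[of "norm (f z) - norm (g z)"] unfolding power2_sum power2_diff by argo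
      finally show "norm ((norm (f z + g z))\<^sup>2) \<le> norm (2 * ((norm (f z))\<^sup>2 + (norm (g z))\<^sup>2))"
        by simp
    qed
    show "(\<lambda>z. (norm (f z + g z))\<^sup>2) \<in> borel_measurable (gauss \<alpha>)"
      by simp
  qed
qed

lemma ip_commute: "ip \<alpha> g f = cnj (ip \<alpha> f g)"
  unfolding ip_def by (subst Bochner_Integration.integral_cnj[symmetric]) (rule Bochner_Integration.integral_cong, simp_all)

lemma L2norm_sq: "(L2norm \<alpha> f)\<^sup>2 = (\<integral>z. (norm (f z))\<^sup>2 \<partial>gauss \<alpha>)"
  unfolding L2norm_def by (simp add: integral_nonneg_AE)

lemma L2norm_nonneg[simp]: "L2norm \<alpha> f \<ge> 0"
  unfolding L2norm_def by (simp add: integral_nonneg_AE)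

lemma ip_self: "ip \<alpha> f f = of_real ((L2norm \<alpha> f)\<^sup>2)"
  unfolding ip_def L2norm_sq complex_norm_square[symmetric] by (rule integral_complex_of_real)

lemma ip_scale_left: "ip \<alpha> (\<lambda>z. c * f z) g = c * ip \<alpha> f g"
  unfolding ip_def by (simp add: mult.assoc)

lemma ip_scale_right: "ip \<alpha> f (\<lambda>z. c * g z) = cnj c * ip \<alpha> f g"
  by (subst (1 2) ip_commute) (simp add: ip_scale_left)

lemma ip_zero_left[simp]: "ip \<alpha> (\<lambda>z. 0) g = 0"
  unfolding ip_def by simp

lemma ip_diff_left:
  assumes "sq_integrable \<alpha> f" "sq_integrable \<alpha> g" "sq_integrable \<alpha> h"
  shows "ip \<alpha> (\<lambda>z. f z - g z) h = ip \<alpha> f h - ip \<alpha> g h"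
  unfolding ip_def
  by (simp add: left_diff_distrib Bochner_Integration.integral_diff sq_integrable_mult assms)

lemma ip_sum_left:
  assumes "\<And>k. k \<in> A \<Longrightarrow> sq_integrable \<alpha> (f k)" "sq_integrable \<alpha> h"
  shows "ip \<alpha> (\<lambda>z. \<Sum>k\<in>A. f k z) h = (\<Sum>k\<in>A. ip \<alpha> (f k) h)"
  unfolding ip_def sum_distrib_right
  by (intro Bochner_Integration.integral_sum sq_integrable_mult assms)

lemma L2norm_scale: "L2norm \<alpha> (\<lambda>z. c * f z) = norm c * L2norm \<alpha> f"
  unfolding L2norm_def by (simp add: norm_mult power_mult_distrib real_sqrt_mult)

lemma integral_norm_mult_le:
  assumes "sq_integrable \<alpha> f" "sq_integrable \<alpha> g"
  shows "(\<integral>z. norm (f z) * norm (g z) \<partial>gauss \<alpha>) \<le> L2norm \<alpha> f * L2norm \<alpha> g"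
proof -
  have [measurable]: "f \<in> borel_measurable borel" "g \<in> borel_measurable borel"
    and int: "integrable (gauss \<alpha>) (\<lambda>z. (norm (f z))\<^sup>2)" "integrable (gauss \<alpha>) (\<lambda>z. (norm (g z))\<^sup>2)"
    using assms by (auto simp: sq_integrable_def)
  let ?c = "\<integral>z. norm (f z) * norm (g z) \<partial>gauss \<alpha>"
  have c: "integrable (gauss \<alpha>) (\<lambda>z. norm (f z) * norm (g z))"
    using integrable_norm[OF sq_integrable_mult[OF assms]] by (simp add: norm_mult)
  have "(\<integral>\<^sup>+z. ennreal (norm (f z)) * ennreal (norm (g z)) \<partial>gauss \<alpha>)\<^sup>2
      \<le> (\<integral>\<^sup>+z. (ennreal (norm (f z)))\<^sup>2 \<partial>gauss \<alpha>) * (\<integral>\<^sup>+z. (ennreal (norm (g z)))\<^sup>2 \<partial>gauss \<alpha>)"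
    by (rule Cauchy_Schwarz_nn_integral) auto
  also have "(\<integral>\<^sup>+z. ennreal (norm (f z)) * ennreal (norm (g z)) \<partial>gauss \<alpha>) = ennreal ?c"
    by (subst nn_integral_eq_integral[symmetric, OF c]) (auto simp: ennreal_mult)
  also have "(\<integral>\<^sup>+z. (ennreal (norm (f z)))\<^sup>2 \<partial>gauss \<alpha>) = ennreal ((L2norm \<alpha> f)\<^sup>2)"
    unfolding L2norm_sq by (subst nn_integral_eq_integral[symmetric, OF int(1)]) (auto simp: ennreal_power)
  also have "(\<integral>\<^sup>+z. (ennreal (norm (g z)))\<^sup>2 \<partial>gauss \<alpha>) = ennreal ((L2norm \<alpha> g)\<^sup>2)"
    unfolding L2norm_sq by (subst nn_integral_eq_integral[symmetric, OF int(2)]) (auto simp: ennreal_power)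
  finally have "?c\<^sup>2 \<le> (L2norm \<alpha> f * L2norm \<alpha> g)\<^sup>2"
    by (simp add: ennreal_power integral_nonneg_AE ennreal_mult[symmetric] power_mult_distrib)
  then show ?thesis
    by (rule power2_le_imp_le) simp
qed

lemma ip_Cauchy_Schwarz:
  assumes "sq_integrable \<alpha> f" "sq_integrable \<alpha> g"
  shows "norm (ip \<alpha> f g) \<le> L2norm \<alpha> f * L2norm \<alpha> g"
proof -
  have "norm (ip \<alpha> f g) \<le> (\<integral>z. norm (f z) * norm (g z) \<partial>gauss \<alpha>)"
    unfolding ip_def using integral_norm_bound[of "gauss \<alpha>" "\<lambda>z. f z * cnj (g z)"] by (simp add: norm_mult)
  then show ?thesis using integral_norm_mult_le[OF assms] by linarith
qed

text \<open>Otherwise f would be nonzero on a whole ball, which is not a null set because the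
  Gaussian density is positive. This makes the inner product definite on actual functions.\<close>

lemma L2norm_eq_0_continuous:
  assumes \<alpha>: "\<alpha> > 0" and "continuous_on UNIV f" "sq_integrable \<alpha> f" "L2norm \<alpha> f = 0"
  shows "f = (\<lambda>z. 0)"
proof (rule ccontr)
  assume "f \<noteq> (\<lambda>z. 0)"
  then obtain z where "f z \<noteq> 0" by auto
  have op: "open {z. f z \<noteq> 0}"
    using assms(2) by (intro open_Collect_neq) auto
  then obtain e where "e > 0" and e: "ball z e \<subseteq> {z. f z \<noteq> 0}"
    using \<open>f z \<noteq> 0\<close> open_contains_ball by blast
  have "(\<integral>z. (norm (f z))\<^sup>2 \<partial>gauss \<alpha>) = 0"
    using assms(4) L2norm_sq[of \<alpha> f] by simp
  then have "AE z in gauss \<alpha>. (norm (f z))\<^sup>2 = 0"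
    using assms(3) by (subst (asm) integral_nonneg_eq_0_iff_AE) (auto simp: sq_integrable_def)
  then have "AE z in lborel. f z = 0"
    using \<alpha> by (simp add: AE_gauss_iff)
  then have "emeasure lborel {z. f z \<noteq> 0} = 0"
    using op by (subst (asm) AE_iff_measurable[OF _ refl]) auto
  then have "emeasure lborel (ball z e) = 0"
    using e op by (metis borel_open emeasure_mono le_zero_eq sets_lborel)
  then show False
    using content_ball_pos[OF \<open>e > 0\<close>, of z] by (simp add: measure_def)
qed

section \<open>Singular values and Toeplitz operators on a space of continuous functions\<close>

lemma sum_fun_apply: "(sum F A) z = (\<Sum>k\<in>A. F k z)"
  by (induction A rule: infinite_finite_induct) auto

text \<open>Look at the first index k where the sequences differ, say \<open>s' k < s k\<close>. By
  monotonicity \<open>s'\<close> takes the value \<open>s k\<close> only before k, where it agrees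
  with \<open>s\<close>; so \<open>s\<close> takes that positive value at least once more, against
  the cardinalities. This is the uniqueness behind \<open>singular_values\<close>.\<close>

lemma decseq_eqI_card:
  fixes s s' :: "nat \<Rightarrow> real"
  assumes "decseq s" "decseq s'" "\<And>k. 0 \<le> s k" "\<And>k. 0 \<le> s' k"
    and fin: "\<And>t. t > 0 \<Longrightarrow> finite {k. s k = t}" "\<And>t. t > 0 \<Longrightarrow> finite {k. s' k = t}"
    and card: "\<And>t. t > 0 \<Longrightarrow> card {k. s k = t} = card {k. s' k = t}"
  shows "s = s'"
proof -
  have no: False
    if s: "decseq s" "decseq s'" "0 \<le> s' k" "\<And>j. j < k \<Longrightarrow> s j = s' j" "s' k < s k"
      and fin: "finite {j. s j = s k}" and card: "card {j. s j = s k} = card {j. s' j = s k}"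
    for s s' :: "nat \<Rightarrow> real" and k
  proof -
    have "{j. s' j = s k} \<subseteq> {j. s j = s k} - {k}"
    proof
      fix j assume j: "j \<in> {j. s' j = s k}"
      then have "j < k"
        using decseqD[OF s(2), of k j] s(5) by (cases "j < k") auto
      then show "j \<in> {j. s j = s k} - {k}"
        using j s(4)[of j] by auto
    qed
    then have "card {j. s' j = s k} < card {j. s j = s k}"
      using fin by (intro psubset_card_mono) auto
    then show False using card by simp
  qed
  have "s k = s' k" for k
  proof (induction k rule: less_induct)
    case (less k)
    show ?case
    proof (rule linorder_cases[of "s k" "s' k"])
      assume "s k < s' k"
      then show ?thesis
        using no[of s' s k] less.IH assms(3)[of k] assms(1,2) fin(2)[of "s' k"] card[of "s' k"] by force
    next
      assume "s' k < s k"
      then show ?thesis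
        using no[of s s' k] less.IH assms(4)[of k] assms(1,2) fin(1)[of "s k"] card[of "s k"] by force
    qed
  qed
  then show ?thesis by auto
qed

locale function_space =
  fixes \<alpha> :: real and H :: "(complex ^ 'n \<Rightarrow> complex) set"
  assumes \<alpha>: "\<alpha> > 0"
    and H_cont: "f \<in> H \<Longrightarrow> continuous_on UNIV f"
    and H_sq: "f \<in> H \<Longrightarrow> sq_integrable \<alpha> f"
    and H_zero: "(\<lambda>z. 0) \<in> H"
    and H_scale: "f \<in> H \<Longrightarrow> (\<lambda>z. c * f z) \<in> H"
    and H_add: "f \<in> H \<Longrightarrow> g \<in> H \<Longrightarrow> (\<lambda>z. f z + g z) \<in> H"
begin

lemma H_diff: "f \<in> H \<Longrightarrow> g \<in> H \<Longrightarrow> (\<lambda>z. f z - g z) \<in> H"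
  using H_add[of f "\<lambda>z. (-1) * g z"] H_scale[of g "-1"] by simp

lemma H_sum: "(\<And>k. k \<in> A \<Longrightarrow> f k \<in> H) \<Longrightarrow> (\<lambda>z. \<Sum>k\<in>A. f k z) \<in> H"
  by (induction A rule: infinite_finite_induct) (auto intro: H_zero H_add)

lemma ip_self_eq_0: "f \<in> H \<Longrightarrow> ip \<alpha> f f = 0 \<Longrightarrow> f = (\<lambda>z. 0)"
  by (rule L2norm_eq_0_continuous[OF \<alpha> H_cont H_sq]) (auto simp: ip_self)

text \<open>Identifies operators with the ones that \<open>adjoint_op\<close> and
  \<open>toeplitz_op\<close> choose: on H these are determined by their inner products.\<close>

lemma eqI_ip:
  assumes "f \<in> H" "g \<in> H" "\<And>h. h \<in> H \<Longrightarrow> ip \<alpha> f h = ip \<alpha> g h"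
  shows "f = g"
proof -
  have d: "(\<lambda>z. f z - g z) \<in> H" using assms H_diff by auto
  then have "ip \<alpha> (\<lambda>z. f z - g z) (\<lambda>z. f z - g z) = 0"
    using assms by (subst ip_diff_left) (auto intro: H_sq)
  from ip_self_eq_0[OF d this] show ?thesis by (auto simp: fun_eq_iff)
qed

lemma bounded_opD:
  assumes "bounded_op \<alpha> H T"
  shows "f \<in> H \<Longrightarrow> T f \<in> H" "f \<in> H \<Longrightarrow> g \<in> H \<Longrightarrow> T (\<lambda>z. f z + g z) = (\<lambda>z. T f z + T g z)"
    "f \<in> H \<Longrightarrow> T (\<lambda>z. c * f z) = (\<lambda>z. c * T f z)"
  using assms by (auto simp: bounded_op_def plus_fun_def)

lemma bounded_op_diff:
  assumes "bounded_op \<alpha> H T" "f \<in> H" "g \<in> H"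
  shows "T (\<lambda>z. f z - g z) = (\<lambda>z. T f z - T g z)"
  using bounded_opD(2)[OF assms(1,2) H_scale[OF assms(3)], of "-1"]
    bounded_opD(3)[OF assms(1,3), of "-1"] by simp

text \<open>T is diagonal on the \<open>E k\<close> and, by \<open>ker\<close>, zero on their
  orthogonal complement. Hence the eigenspace of T* T for t^2 has the \<open>E k\<close> with
  \<open>s k = t\<close> as a basis, and the multiplicities determine the sequence by
  \<open>decseq_eqI_card\<close>. Where \<open>s k = 0\<close>, nothing is demanded of
  \<open>E k\<close>.\<close>

lemma singular_values_eqI:
  assumes T: "bounded_op \<alpha> H T"
    and sa: "\<And>f g. f \<in> H \<Longrightarrow> g \<in> H \<Longrightarrow> ip \<alpha> (T f) g = ip \<alpha> f (T g)"
    and s: "decseq s" "\<And>k. 0 \<le> s k" "\<And>t. t > 0 \<Longrightarrow> finite {k. s k = t}"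
    and EH: "\<And>k. s k > 0 \<Longrightarrow> E k \<in> H"
    and TE: "\<And>k. s k > 0 \<Longrightarrow> T (E k) = (\<lambda>z. complex_of_real (s k) * E k z)"
    and orth: "\<And>j k. s j > 0 \<Longrightarrow> s k > 0 \<Longrightarrow> ip \<alpha> (E j) (E k) = (if j = k then 1 else 0)"
    and ker: "\<And>f. f \<in> H \<Longrightarrow> (\<And>k. s k > 0 \<Longrightarrow> ip \<alpha> f (E k) = 0) \<Longrightarrow> T f = (\<lambda>z. 0)"
  shows "singular_values \<alpha> H T = s"
proof -
  note TH = bounded_opD(1)[OF T] and Tsc = bounded_opD(3)[OF T]
  have T_sum: "T (\<lambda>z. \<Sum>k\<in>A. c k * F k z) = (\<lambda>z. \<Sum>k\<in>A. c k * T (F k) z)"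
    if "finite A" "\<And>k. k \<in> A \<Longrightarrow> F k \<in> H" for A c and F :: "nat \<Rightarrow> _"
    using that
  proof (induction A rule: finite_induct)
    case empty
    then show ?case using Tsc[OF H_zero, of 0] by simp
  next
    case (insert k A)
    then show ?case
      using bounded_opD(2)[OF T H_scale[of "F k" "c k"] H_sum[of A "\<lambda>k z. c k * F k z"]]
      by (simp add: Tsc H_scale)
  qed
  define S where "S = adjoint_op \<alpha> H T"
  \<comment> \<open>By self-adjointness T itself is a possible adjoint, so the choice is legitimate;
    by \<open>eqI_ip\<close> the chosen one agrees with T on H.\<close>
  have "\<exists>S. bounded_op \<alpha> H S \<and> (\<forall>f\<in>H. \<forall>g\<in>H. ip \<alpha> (T f) g = ip \<alpha> f (S g))"
    using T sa by blast
  from someI_ex[OF this] have S: "bounded_op \<alpha> H S" "\<And>f g. f \<in> H \<Longrightarrow> g \<in> H \<Longrightarrow> ip \<alpha> (T f) g = ip \<alpha> f (S g)"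
    unfolding S_def adjoint_op_def by auto
  have ST: "S g = T g" if "g \<in> H" for g
  proof (rule eqI_ip)
    fix f assume "f \<in> H"
    then have "ip \<alpha> f (S g) = ip \<alpha> f (T g)" using S(2) sa that by metis
    then show "ip \<alpha> (S g) f = ip \<alpha> (T g) f" by (subst (1 2) ip_commute) simp
  qed (use that TH bounded_opD(1)[OF S(1)] in auto)
  have mult: "sv_multiplicity \<alpha> H T t = card {k. s k = t}" if t: "t > 0" for t
  proof -
    define K where "K = {k. s k = t}"
    define V where "V = {f \<in> H. T (T f) = (\<lambda>z. complex_of_real (t\<^sup>2) * f z)}"
    have K: "finite K" "\<And>k. k \<in> K \<Longrightarrow> s k = t" using s(3)[OF t] by (auto simp: K_def)
    have inj: "inj_on E K"
    proof (rule inj_onI)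
      fix j k assume "j \<in> K" "k \<in> K" "E j = E k"
      then show "j = k"
        using orth[of j k] orth[of j j] K t by (auto split: if_splits)
    qed
    have BV: "E ` K \<subseteq> V"
    proof clarify
      fix k assume "k \<in> K"
      then have k: "s k = t" "E k \<in> H" "T (E k) = (\<lambda>z. complex_of_real t * E k z)"
        using K(2)[of k] EH[of k] TE[of k] t by auto
      then have "T (T (E k)) = (\<lambda>z. complex_of_real t * T (E k) z)"
        by (metis Tsc)
      then have "T (T (E k)) = (\<lambda>z. complex_of_real (t\<^sup>2) * E k z)"
        unfolding k(3) by (simp only: power2_eq_square mult.assoc of_real_mult)
      with k(2) show "E k \<in> V" by (simp only: V_def mem_Collect_eq)
    qed
    have VB: "V \<subseteq> cfun.span (E ` K)"
    proof
      fix f assume "f \<in> V"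
      then have f: "f \<in> H" "T (T f) = (\<lambda>z. complex_of_real (t\<^sup>2) * f z)" by (auto simp: V_def)
      \<comment> \<open>The orthogonal projection of f to the span of the \<open>E k\<close> with
        \<open>s k = t\<close>; the aim is f = P.\<close>
      define P where "P = (\<lambda>z. \<Sum>k\<in>K. ip \<alpha> f (E k) * E k z)"
      define h where "h = (\<lambda>z. f z - P z)"
      have EK: "E k \<in> H" if "k \<in> K" for k using EH[of k] K(2)[OF that] t by auto
      have PH: "P \<in> H" unfolding P_def by (intro H_sum H_scale EK)
      have hH: "h \<in> H" unfolding h_def by (intro H_diff f PH)
      have ipP: "ip \<alpha> P (E j) = (\<Sum>k\<in>K. ip \<alpha> f (E k) * ip \<alpha> (E k) (E j))" if "E j \<in> H" for j
        unfolding P_def by (subst ip_sum_left) (auto intro!: H_sq that H_scale EK simp: ip_scale_left)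
      have "T h = (\<lambda>z. 0)"
      proof (rule ker[OF hH])
        fix j assume j: "s j > 0"
        note Ej = EH[OF j]
        \<comment> \<open>Comparing eigenvalues: the coefficient of f at \<open>E j\<close> vanishes
          unless \<open>s j\<close> squared is t^2, that is \<open>s j = t\<close> as both are
          positive. The remaining coefficients are removed by P, so h is orthogonal to every
          \<open>E j\<close>.\<close>
        have "complex_of_real (t\<^sup>2) * ip \<alpha> f (E j) = ip \<alpha> (T (T f)) (E j)"
          by (simp only: f ip_scale_left)
        also have "\<dots> = ip \<alpha> f (T (T (E j)))"
          by (simp add: sa TH f(1) Ej)
        also have "T (T (E j)) = (\<lambda>z. complex_of_real ((s j)\<^sup>2) * E j z)"
          by (simp only: TE[OF j] Tsc[OF Ej] power2_eq_square mult.assoc of_real_mult)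
        finally have "complex_of_real (t\<^sup>2 - (s j)\<^sup>2) * ip \<alpha> f (E j) = 0"
          unfolding ip_scale_right by (simp add: algebra_simps)
        then have disj: "s j = t \<or> ip \<alpha> f (E j) = 0"
          using t j by (auto simp: power2_eq_iff simp flip: of_real_diff of_real_power)
        have "ip \<alpha> h (E j) = ip \<alpha> f (E j) - (\<Sum>k\<in>K. ip \<alpha> f (E k) * ip \<alpha> (E k) (E j))"
          unfolding h_def using ipP[OF Ej] by (subst ip_diff_left) (auto intro: H_sq f PH Ej)
        also have "(\<Sum>k\<in>K. ip \<alpha> f (E k) * ip \<alpha> (E k) (E j)) = (\<Sum>k\<in>K. if k = j then ip \<alpha> f (E k) else 0)"
          using K(2) t j by (intro sum.cong refl) (auto simp: orth)
        also have "\<dots> = (if j \<in> K then ip \<alpha> f (E j) else 0)"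
          using K by (simp add: sum.delta)
        finally show "ip \<alpha> h (E j) = 0"
          using disj by (auto simp: K_def)
      qed
      \<comment> \<open>Now T f = T P = t P, so applying T again yields t^2 f = t^2 P, and t is
        nonzero.\<close>
      then have "T f = T P"
        using bounded_op_diff[OF T f(1) PH] by (auto simp: h_def fun_eq_iff)
      also have TP: "T P = (\<lambda>z. complex_of_real t * P z)"
      proof -
        have "T P = (\<lambda>z. \<Sum>k\<in>K. ip \<alpha> f (E k) * T (E k) z)"
          unfolding P_def by (rule T_sum[OF K(1) EK])
        also have "\<dots> = (\<lambda>z. \<Sum>k\<in>K. complex_of_real t * (ip \<alpha> f (E k) * E k z))"
        proof (intro ext sum.cong refl)
          fix z k assume "k \<in> K"
          then have "T (E k) z = complex_of_real t * E k z"
            using TE[of k] K(2)[of k] t by simp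
          then show "ip \<alpha> f (E k) * T (E k) z = complex_of_real t * (ip \<alpha> f (E k) * E k z)"
            by (simp only: mult.left_commute)
        qed
        finally show ?thesis by (simp only: P_def sum_distrib_left)
      qed
      finally have "T (T f) = (\<lambda>z. complex_of_real t * T P z)"
        using Tsc[OF PH] by simp
      then have "(\<lambda>z. complex_of_real (t\<^sup>2) * f z) = (\<lambda>z. complex_of_real (t\<^sup>2) * P z)"
        by (simp only: f(2) TP power2_eq_square mult.assoc of_real_mult)
      then have "f z = P z" for z
        using t by (auto simp: fun_eq_iff)
      then have fP: "f = (\<Sum>k\<in>K. (\<lambda>z. ip \<alpha> f (E k) * E k z))"
        by (auto simp: P_def sum_fun_apply)
      show "f \<in> cfun.span (E ` K)"
        by (subst fP) (intro cfun.span_sum cfun.span_scale cfun.span_base imageI)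
    qed
    have ind: "cfun.independent (E ` K)"
    proof (rule cfun.independent_if_scalars_zero)
      fix c x assume 0: "(\<Sum>x\<in>E ` K. (\<lambda>z. c x * x z)) = 0" and "x \<in> E ` K"
      then obtain j where j: "j \<in> K" "x = E j" by auto
      have H: "E k \<in> H" if "k \<in> K" for k using EH[of k] K(2)[OF that] t by auto
      have "0 = ip \<alpha> (\<lambda>z. \<Sum>k\<in>K. c (E k) * E k z) (E j)"
        using 0 unfolding sum.reindex[OF inj] by (simp add: fun_eq_iff sum_fun_apply)
      also have "\<dots> = (\<Sum>k\<in>K. c (E k) * ip \<alpha> (E k) (E j))"
        by (subst ip_sum_left) (auto intro!: H_sq H_scale H j simp: ip_scale_left)
      also have "\<dots> = (\<Sum>k\<in>K. if k = j then c (E k) else 0)"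
        using K(2) j t by (intro sum.cong refl) (auto simp: orth)
      also have "\<dots> = c x" using K j by (simp add: sum.delta)
      finally show "c x = 0" by simp
    qed (use K in auto)
    have "cfun.dim V = card (E ` K)"
      using BV VB ind by (metis cfun.basis_card_eq_dim)
    moreover have "{f \<in> H. S (T f) = (\<lambda>z. complex_of_real (t\<^sup>2) * f z)} = V"
      unfolding V_def using ST TH by auto
    ultimately show ?thesis
      unfolding sv_multiplicity_def S_def[symmetric] using card_image[OF inj] by (simp add: K_def)
  qed
  show ?thesis
    unfolding singular_values_def
  proof (rule the_equality)
    show "decseq s \<and> (\<forall>k. 0 \<le> s k) \<and> (\<forall>t>0. finite {k. s k = t} \<and> card {k. s k = t} = sv_multiplicity \<alpha> H T t)"
      using s mult by auto
  next
    fix s' assume s': "decseq s' \<and> (\<forall>k. 0 \<le> s' k) \<and> (\<forall>t>0. finite {k. s' k = t} \<and> card {k. s' k = t} = sv_multiplicity \<alpha> H T t)"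
    show "s' = s"
      by (rule decseq_eqI_card) (use s s' mult in auto)
  qed
qed

lemma compact_op_cong:
  assumes T: "compact_op \<alpha> H T" and T': "bounded_op \<alpha> H T'" "\<And>f. f \<in> H \<Longrightarrow> T' f = T f"
  shows "compact_op \<alpha> H T'"
  using T unfolding compact_op_def by (auto simp: T')

lemma toeplitz_form_commute: "toeplitz_form \<alpha> \<mu> g f = cnj (toeplitz_form \<alpha> \<mu> f g)"
  unfolding toeplitz_form_def toeplitz_integrand_def
  by (subst Bochner_Integration.integral_cnj[symmetric]) (rule Bochner_Integration.integral_cong, simp_all)

lemma toeplitz_op_eq:
  assumes "bounded_op \<alpha> H T" "\<And>f g. f \<in> H \<Longrightarrow> g \<in> H \<Longrightarrow> ip \<alpha> (T f) g = toeplitz_form \<alpha> \<mu> f g"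
  shows "bounded_op \<alpha> H (toeplitz_op \<alpha> H \<mu>)" "\<And>f. f \<in> H \<Longrightarrow> toeplitz_op \<alpha> H \<mu> f = T f"
proof -
  define T' where "T' = toeplitz_op \<alpha> H \<mu>"
  have "\<exists>T. bounded_op \<alpha> H T \<and> (\<forall>f\<in>H. \<forall>g\<in>H. ip \<alpha> (T f) g = toeplitz_form \<alpha> \<mu> f g)"
    using assms by blast
  from someI_ex[OF this] have T': "bounded_op \<alpha> H T'" "\<And>f g. f \<in> H \<Longrightarrow> g \<in> H \<Longrightarrow> ip \<alpha> (T' f) g = toeplitz_form \<alpha> \<mu> f g"
    unfolding T'_def toeplitz_op_def by auto
  then show "bounded_op \<alpha> H (toeplitz_op \<alpha> H \<mu>)" by (simp add: T'_def)
  fix f assume "f \<in> H"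
  then show "toeplitz_op \<alpha> H \<mu> f = T f"
    unfolding T'_def[symmetric]
    by (intro eqI_ip) (use T' assms bounded_opD(1)[OF T'(1)] bounded_opD(1)[OF assms(1)] in auto)
qed

text \<open>Passes from an explicit operator T that represents the form to the chosen operator
  \<open>toeplitz_op\<close>, which agrees with T on H. Self-adjointness is the Hermitian symmetry
  of the form.\<close>

lemma toeplitz_schatten:
  assumes T: "compact_op \<alpha> H T"
    and form: "\<And>f g. f \<in> H \<Longrightarrow> g \<in> H \<Longrightarrow> ip \<alpha> (T f) g = toeplitz_form \<alpha> \<mu> f g"
    and s: "decseq s" "\<And>k. 0 \<le> s k" "\<And>t. t > 0 \<Longrightarrow> finite {k. s k = t}"
    and EH: "\<And>k. s k > 0 \<Longrightarrow> E k \<in> H"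
    and TE: "\<And>k. s k > 0 \<Longrightarrow> T (E k) = (\<lambda>z. complex_of_real (s k) * E k z)"
    and orth: "\<And>j k. s j > 0 \<Longrightarrow> s k > 0 \<Longrightarrow> ip \<alpha> (E j) (E k) = (if j = k then 1 else 0)"
    and ker: "\<And>f. f \<in> H \<Longrightarrow> (\<And>k. s k > 0 \<Longrightarrow> ip \<alpha> f (E k) = 0) \<Longrightarrow> T f = (\<lambda>z. 0)"
    and p: "summable (\<lambda>k. s k powr p)"
  shows "in_schatten \<alpha> H p (toeplitz_op \<alpha> H \<mu>)"
    and "schatten_pow \<alpha> H p (toeplitz_op \<alpha> H \<mu>) = (\<Sum>k. s k powr p)"
proof -
  have T': "bounded_op \<alpha> H T" using T by (simp add: compact_op_def)
  note B = toeplitz_op_eq[OF T' form]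
  have "singular_values \<alpha> H (toeplitz_op \<alpha> H \<mu>) = s"
  proof (rule singular_values_eqI[OF B(1) _ s, of E])
    fix f g assume fg: "f \<in> H" "g \<in> H"
    have "ip \<alpha> (T f) g = cnj (ip \<alpha> (T g) f)"
      using fg form toeplitz_form_commute by metis
    then show "ip \<alpha> (toeplitz_op \<alpha> H \<mu> f) g = ip \<alpha> f (toeplitz_op \<alpha> H \<mu> g)"
      using fg B(2) ip_commute by metis
  qed (use EH TE orth ker B(2) in auto)
  then show "in_schatten \<alpha> H p (toeplitz_op \<alpha> H \<mu>)"
    and "schatten_pow \<alpha> H p (toeplitz_op \<alpha> H \<mu>) = (\<Sum>k. s k powr p)"
    using compact_op_cong[OF T B] p by (auto simp: in_schatten_def schatten_pow_def)
qed

end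

section \<open>Harmonic functions and Gaussian moments\<close>

lemma power_le_fact_exp: "0 \<le> (x::real) \<Longrightarrow> x ^ k \<le> fact k * exp x"
proof -
  assume "0 \<le> x"
  have "(\<Sum>n\<in>{k}. x ^ n /\<^sub>R fact n) \<le> (\<Sum>n. x ^ n /\<^sub>R fact n)"
    by (rule sum_le_suminf[OF summable_exp_generic]) (use \<open>0 \<le> x\<close> in auto)
  then have "x ^ k / fact k \<le> exp x" by (simp add: exp_def divide_inverse mult.commute)
  then show ?thesis by (simp add: field_simps)
qed

section \<open>Means of harmonic functions over circles\<close>

definition ee :: "real \<Rightarrow> complex" where
  "ee t = exp (2 * of_real pi * \<i> * of_real t)"

lemma norm_ee[simp]: "norm (ee t) = 1"
  by (simp add: ee_def norm_exp_eq_Re)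

lemma continuous_on_ee[continuous_intros]: "continuous_on A f \<Longrightarrow> continuous_on A (\<lambda>x. ee (f x))"
  unfolding ee_def by (intro continuous_intros)

lemma cnj_ee_power: "cnj (ee t) ^ k = 1 / ee t ^ k"
proof -
  have "ee t * cnj (ee t) = 1" by (simp add: complex_norm_square[symmetric])
  then have "ee t ^ k * cnj (ee t) ^ k = 1" by (metis power_mult_distrib power_one)
  then show ?thesis by (metis mult_zero_left nonzero_eq_divide_eq mult.commute zero_neq_one)
qed

text \<open>Cauchy's formula for the k-th derivative at 0 of w |-> g(\<zeta> w) on the unit circle,
  where 1/w is the conjugate of w. Scaling the variable puts \<zeta>^k into the result and covers
  \<zeta> = 0 as well.\<close>

lemma circle_mean_cnj_power:
  assumes g: "g holomorphic_on UNIV"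
  shows "((\<lambda>t. g (\<zeta> * ee t) * cnj (ee t) ^ k) has_integral ((deriv ^^ k) g 0 / fact k * \<zeta> ^ k)) {0..1}"
proof -
  let ?G = "\<lambda>w. g (\<zeta> * w)"
  have G: "?G holomorphic_on UNIV"
    using holomorphic_on_compose_gen[of "\<lambda>w. \<zeta> * w" UNIV g UNIV] g
    by (auto simp: o_def intro!: holomorphic_intros)
  have d: "(deriv ^^ k) ?G 0 = \<zeta> ^ k * (deriv ^^ k) g 0"
    using higher_deriv_compose_linear[OF g, of UNIV 0 \<zeta> k] by simp
  have "((\<lambda>u. ?G u / (u - 0) ^ Suc k) has_contour_integral (2 * pi * \<i>) / fact k * (deriv ^^ k) ?G 0) (circlepath 0 1)"
    by (rule Cauchy_has_contour_integral_higher_derivative_circlepath)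
      (use G in \<open>auto intro: holomorphic_on_subset holomorphic_on_imp_continuous_on\<close>)
  then have "((\<lambda>t. 1 / (2 * pi * \<i>) * (?G (ee t) / (ee t) ^ Suc k * (2 * pi * \<i> * ee t)))
      has_integral 1 / (2 * pi * \<i>) * ((2 * pi * \<i>) / fact k * (deriv ^^ k) ?G 0)) {0..1}"
    unfolding has_contour_integral_def
  proof (intro has_integral_mult_right, elim has_integral_eq[rotated])
    fix t :: real assume "t \<in> {0..1}"
    moreover have "circlepath 0 1 t = ee t" by (simp add: circlepath ee_def)
    ultimately show "?G (circlepath 0 1 t) / (circlepath 0 1 t - 0) ^ Suc k * vector_derivative (circlepath 0 1) (at t within {0..1})
      = ?G (ee t) / ee t ^ Suc k * (2 * pi * \<i> * ee t)"
      by (simp only: vector_derivative_circlepath01 atLeastAtMost_iff ee_def[symmetric] diff_zero of_real_1 mult_1_right)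
  qed
  also have "1 / (2 * pi * \<i>) * ((2 * pi * \<i>) / fact k * (deriv ^^ k) ?G 0) = (deriv ^^ k) g 0 / fact k * \<zeta> ^ k"
    by (simp add: d)
  also have "(\<lambda>t. 1 / (2 * pi * \<i>) * (?G (ee t) / (ee t) ^ Suc k * (2 * pi * \<i> * ee t)))
    = (\<lambda>t. ?G (ee t) * cnj (ee t) ^ k)"
  proof
    fix t
    have "ee t \<noteq> 0" using norm_ee[of t] by fastforce
    then show "1 / (2 * pi * \<i>) * (?G (ee t) / (ee t) ^ Suc k * (2 * pi * \<i> * ee t)) = ?G (ee t) * cnj (ee t) ^ k"
      by (simp add: cnj_ee_power field_simps)
  qed
  finally show ?thesis .
qed

lemma circle_mean_power:
  assumes g: "g holomorphic_on UNIV"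
  shows "((\<lambda>t. g (\<zeta> * ee t) * ee t ^ k) has_integral (if k = 0 then g 0 else 0)) {0..1}"
proof -
  let ?G = "\<lambda>w. g (\<zeta> * w) * w ^ k"
  have "?G holomorphic_on UNIV"
    using holomorphic_on_compose_gen[of "\<lambda>w. \<zeta> * w" UNIV g UNIV] g
    by (auto simp: o_def intro!: holomorphic_intros)
  \<comment> \<open>Exponent 0 is the mean value property for w |-> g(\<zeta> w) w^k, whose value at
    0 vanishes unless k = 0.\<close>
  from circle_mean_cnj_power[OF this, of 1 0] show ?thesis
    by (auto simp: power_0_left)
qed

text \<open>The antiholomorphic part contributes only its constant term, at k = 0, and
  \<open>h 0 = 0\<close> assigns all constants to g. In the mirrored lemma below, k > 0 removes the
  contribution of g.\<close>

lemma circle_mean_harmonic_cnj_power: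
  assumes "g holomorphic_on UNIV" "h holomorphic_on UNIV" "h 0 = 0"
  shows "((\<lambda>t. (g (\<zeta> * ee t) + cnj (h (\<zeta> * ee t))) * cnj (ee t) ^ k)
    has_integral ((deriv ^^ k) g 0 / fact k * \<zeta> ^ k)) {0..1}"
proof -
  have "(cnj \<circ> (\<lambda>t. h (\<zeta> * ee t) * ee t ^ k) has_integral cnj (if k = 0 then h 0 else 0)) {0..1}"
    unfolding has_integral_cnj by (rule circle_mean_power) (rule assms)
  then have "((\<lambda>t. cnj (h (\<zeta> * ee t)) * cnj (ee t) ^ k) has_integral 0) {0..1}"
    using assms(3) by (simp add: o_def split: if_splits)
  from has_integral_add[OF circle_mean_cnj_power[OF assms(1)] this] show ?thesis
    by (simp add: distrib_right)
qed

lemma circle_mean_harmonic_power: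
  assumes "g holomorphic_on UNIV" "h holomorphic_on UNIV" "k > 0"
  shows "((\<lambda>t. (g (\<zeta> * ee t) + cnj (h (\<zeta> * ee t))) * ee t ^ k)
    has_integral (cnj ((deriv ^^ k) h 0 / fact k) * cnj \<zeta> ^ k)) {0..1}"
proof -
  have "(cnj \<circ> (\<lambda>t. h (\<zeta> * ee t) * cnj (ee t) ^ k) has_integral cnj ((deriv ^^ k) h 0 / fact k * \<zeta> ^ k)) {0..1}"
    unfolding has_integral_cnj by (rule circle_mean_cnj_power) (rule assms)
  then have "((\<lambda>t. cnj (h (\<zeta> * ee t)) * ee t ^ k) has_integral (cnj ((deriv ^^ k) h 0 / fact k) * cnj \<zeta> ^ k)) {0..1}"
    by (simp add: o_def)
  from has_integral_add[OF circle_mean_power[OF assms(1), of \<zeta> k] this] assms(3) show ?thesis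
    by (simp add: distrib_right)
qed

section \<open>Entire and pluriharmonic functions on complex lines\<close>

text \<open>The form in which both holomorphy and pluriharmonicity enter the integral formulas: a
  splitting on every complex line, with parts that may depend on the line.\<close>

definition line_harmonic :: "(complex ^ 'n \<Rightarrow> complex) \<Rightarrow> bool" where
  "line_harmonic f \<longleftrightarrow> (\<forall>a b. \<exists>g h. g holomorphic_on UNIV \<and> h holomorphic_on UNIV \<and>
     (\<forall>\<zeta>. f (a + \<zeta> *s b) = g \<zeta> + cnj (h \<zeta>)))"

lemma bounded_linear_smult_vec: "bounded_linear (\<lambda>c. c *s (b :: complex ^ 'n))"
  by (intro linear_conv_bounded_linear[THEN iffD1] linearI) (auto simp: vec_eq_iff algebra_simps)

lemma line_has_derivative: "((\<lambda>\<zeta>. a + \<zeta> *s (b :: complex ^ 'n)) has_derivative (\<lambda>c. c *s b)) (at \<zeta>)"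
  by (rule derivative_eq_intros bounded_linear.has_derivative[OF bounded_linear_smult_vec] refl | simp)+

lemma has_derivative_line:
  assumes "(f has_derivative f') (at (a + \<zeta> *s (b :: complex ^ 'n)))"
  shows "((\<lambda>\<zeta>. f (a + \<zeta> *s b)) has_derivative (\<lambda>c. f' (c *s b))) (at \<zeta>)"
  using diff_chain_at[OF line_has_derivative assms] by (simp add: o_def)

lemma entire_line_holomorphic:
  assumes "entire f"
  shows "(\<lambda>\<zeta>. f (a + \<zeta> *s b)) holomorphic_on UNIV"
proof (rule holomorphic_on_open[THEN iffD2, OF open_UNIV], intro ballI)
  fix \<zeta>
  obtain f' where f': "(f has_derivative f') (at (a + \<zeta> *s b))" "\<And>c v. f' (c *s v) = c * f' v"
    using assms unfolding entire_def by blast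
  have "((\<lambda>\<zeta>. f (a + \<zeta> *s b)) has_field_derivative f' b) (at \<zeta>)"
    using has_derivative_line[OF f'(1)]
    by (simp add: has_field_derivative_def f'(2) mult.commute[of _ "f' b"])
  then show "\<exists>f'. ((\<lambda>\<zeta>. f (a + \<zeta> *s b)) has_field_derivative f') (at \<zeta>)" by blast
qed

lemma entire_imp_line_harmonic:
  assumes "entire f"
  shows "line_harmonic f"
  unfolding line_harmonic_def
  using entire_line_holomorphic[OF assms]
  by (intro allI exI[of _ "\<lambda>\<zeta>. f (_ + \<zeta> *s _)"] exI[of _ "\<lambda>_. 0"]) auto

text \<open>A real linear map splits into a complex linear and an antilinear part. For a derivative,
  the coefficients are the Wirtinger derivatives.\<close>

lemma linear_wirtinger:
  assumes "linear (L :: complex ^ 'n \<Rightarrow> complex)"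
  shows "L v = (\<Sum>j\<in>UNIV. v $ j * ((L (axis j 1) - \<i> * L (axis j \<i>)) / 2)
                      + cnj (v $ j) * ((L (axis j 1) + \<i> * L (axis j \<i>)) / 2))"
proof -
  have "v = (\<Sum>j\<in>UNIV. Re (v $ j) *\<^sub>R axis j 1 + Im (v $ j) *\<^sub>R axis j \<i>)"
  proof (subst vec_eq_iff, rule allI)
    fix k
    have "(\<Sum>j\<in>UNIV. Re (v $ j) *\<^sub>R axis j 1 + Im (v $ j) *\<^sub>R axis j \<i>) $ k
        = (\<Sum>j\<in>UNIV. if j = k then v $ j else 0)"
      unfolding sum_component
      by (intro sum.cong refl) (auto simp: axis_def complex_eq_iff)
    then show "v $ k = (\<Sum>j\<in>UNIV. Re (v $ j) *\<^sub>R axis j 1 + Im (v $ j) *\<^sub>R axis j \<i>) $ k"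
      by simp
  qed
  then have "L v = L (\<Sum>j\<in>UNIV. Re (v $ j) *\<^sub>R axis j 1 + Im (v $ j) *\<^sub>R axis j \<i>)"
    by simp
  also have "\<dots> = (\<Sum>j\<in>UNIV. Re (v $ j) *\<^sub>R L (axis j 1) + Im (v $ j) *\<^sub>R L (axis j \<i>))"
    using assms by (simp add: linear_sum linear_add linear_scale)
  also have "\<dots> = (\<Sum>j\<in>UNIV. v $ j * ((L (axis j 1) - \<i> * L (axis j \<i>)) / 2)
                      + cnj (v $ j) * ((L (axis j 1) + \<i> * L (axis j \<i>)) / 2))"
  proof (intro sum.cong refl)
    fix j
    have "x * ((p - \<i> * q) / 2) + cnj x * ((p + \<i> * q) / 2) = Re x *\<^sub>R p + Im x *\<^sub>R q" for x p q
      by (simp add: complex_eq_iff field_simps)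
    then show "Re (v $ j) *\<^sub>R L (axis j 1) + Im (v $ j) *\<^sub>R L (axis j \<i>)
        = v $ j * ((L (axis j 1) - \<i> * L (axis j \<i>)) / 2)
                      + cnj (v $ j) * ((L (axis j 1) + \<i> * L (axis j \<i>)) / 2)"
      by simp
  qed
  finally show ?thesis .
qed

lemma frechet_derivative_wirtinger:
  assumes "f differentiable at z"
  shows "frechet_derivative f (at z) v = (\<Sum>j\<in>UNIV. v $ j * d_z j f z + cnj (v $ j) * d_zbar j f z)"
  unfolding d_z_def d_zbar_def
  by (rule linear_wirtinger) (rule linear_frechet_derivative[OF assms])

text \<open>The conjugate of \<open>\<partial>f/\<partial>\<bar>\<zeta>\<close> along a line is holomorphic; a primitive of it is the
  antiholomorphic part of \<open>f\<close> on the line.\<close>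

lemma pluriharmonic_imp_line_harmonic:
  fixes f :: "complex ^ 'n \<Rightarrow> complex"
  assumes f: "pluriharmonic f"
  shows "line_harmonic f"
  unfolding line_harmonic_def
proof (intro allI)
  fix a b :: "complex ^ 'n"
  have df: "f differentiable at z" for z
    using f by (auto simp: pluriharmonic_def C2_def C1_def)
  have d2: "(\<lambda>z. frechet_derivative f (at z) v) differentiable at z" for v z
    using f by (auto simp: pluriharmonic_def C2_def C1_def)
  have dw: "d_zbar k f differentiable at z" for k z
    unfolding d_zbar_def[abs_def]
    by (intro differentiable_divide differentiable_add differentiable_mult differentiable_const d2) auto
  have zero: "d_z j (d_zbar k f) z = 0" for j k z
    using f by (auto simp: pluriharmonic_def)
  \<comment> \<open>By the chain rule \<open>v\<close> is the derivative of f in the conjugate of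
    \<zeta> along the line, and \<open>M\<close> is its further derivative of the same kind. The
    mixed derivatives are zero, so the derivative of \<open>v\<close> is purely antilinear.\<close>
  define v where "v \<zeta> = (\<Sum>k\<in>UNIV. cnj (b $ k) * d_zbar k f (a + \<zeta> *s b))" for \<zeta>
  define M where "M \<zeta> = (\<Sum>k\<in>UNIV. cnj (b $ k) * (\<Sum>j\<in>UNIV. cnj (b $ j) * d_zbar j (d_zbar k f) (a + \<zeta> *s b)))" for \<zeta>
  have v: "(v has_derivative (\<lambda>c. cnj c * M \<zeta>)) (at \<zeta>)" for \<zeta>
  proof -
    have "((\<lambda>\<zeta>. d_zbar k f (a + \<zeta> *s b)) has_derivative
        (\<lambda>c. cnj c * (\<Sum>j\<in>UNIV. cnj (b $ j) * d_zbar j (d_zbar k f) (a + \<zeta> *s b)))) (at \<zeta>)" for k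
    proof -
      have "((\<lambda>\<zeta>. d_zbar k f (a + \<zeta> *s b)) has_derivative
        (\<lambda>c. frechet_derivative (d_zbar k f) (at (a + \<zeta> *s b)) (c *s b))) (at \<zeta>)"
        by (intro has_derivative_line) (use dw frechet_derivative_works in blast)
      then show ?thesis
        by (simp add: frechet_derivative_wirtinger[OF dw] zero sum_distrib_left mult.assoc)
    qed
    then have "(v has_derivative (\<lambda>c. \<Sum>k\<in>UNIV. cnj (b $ k) *
        (cnj c * (\<Sum>j\<in>UNIV. cnj (b $ j) * d_zbar j (d_zbar k f) (a + \<zeta> *s b))))) (at \<zeta>)"
      unfolding v_def by (intro has_derivative_sum has_derivative_mult_right)
    then show ?thesis
      by (simp add: M_def sum_distrib_left mult.left_commute)
  qed
  have "((\<lambda>\<zeta>. cnj (v \<zeta>)) has_field_derivative cnj (M \<zeta>)) (at \<zeta>)" for \<zeta>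
    using bounded_linear.has_derivative[OF bounded_linear_cnj v[of \<zeta>]]
    by (simp add: has_field_derivative_def mult.commute[of _ "cnj (M \<zeta>)"])
  then have "(\<lambda>\<zeta>. cnj (v \<zeta>)) holomorphic_on UNIV"
    by (subst holomorphic_on_open) auto
  then obtain h where h: "\<And>\<zeta>. (h has_field_derivative cnj (v \<zeta>)) (at \<zeta>)"
    using holomorphic_convex_primitive'[of UNIV "\<lambda>\<zeta>. cnj (v \<zeta>)"] by auto
  \<comment> \<open>The derivative of f along the line is c A + conj(c) v. Subtracting the conjugate
    of h cancels the antilinear term, which leaves a holomorphic function with derivative A.\<close>
  define A where "A \<zeta> = (\<Sum>k\<in>UNIV. b $ k * d_z k f (a + \<zeta> *s b))" for \<zeta>
  have "((\<lambda>\<zeta>. f (a + \<zeta> *s b) - cnj (h \<zeta>)) has_field_derivative A \<zeta>) (at \<zeta>)" for \<zeta>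
  proof -
    have "((\<lambda>\<zeta>. f (a + \<zeta> *s b)) has_derivative
        (\<lambda>c. frechet_derivative f (at (a + \<zeta> *s b)) (c *s b))) (at \<zeta>)"
      by (intro has_derivative_line) (use df frechet_derivative_works in blast)
    moreover have "frechet_derivative f (at (a + \<zeta> *s b)) (c *s b) = c * A \<zeta> + cnj c * v \<zeta>" for c
      unfolding frechet_derivative_wirtinger[OF df] A_def v_def
      by (simp add: sum_distrib_left sum.distrib mult.assoc)
    moreover have "((\<lambda>\<zeta>. cnj (h \<zeta>)) has_derivative (\<lambda>c. v \<zeta> * cnj c)) (at \<zeta>)"
      using bounded_linear.has_derivative[OF bounded_linear_cnj h[of \<zeta>, unfolded has_field_derivative_def]]
      by simp
    ultimately have "((\<lambda>\<zeta>. f (a + \<zeta> *s b) - cnj (h \<zeta>)) has_derivative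
        (\<lambda>c. (c * A \<zeta> + cnj c * v \<zeta>) - v \<zeta> * cnj c)) (at \<zeta>)"
      by (simp only: has_derivative_diff)
    moreover have "(\<lambda>c. (c * A \<zeta> + cnj c * v \<zeta>) - v \<zeta> * cnj c) = (*) (A \<zeta>)"
      by (auto simp: mult.commute)
    ultimately show ?thesis by (simp add: has_field_derivative_def)
  qed
  then have "(\<lambda>\<zeta>. f (a + \<zeta> *s b) - cnj (h \<zeta>)) holomorphic_on UNIV"
    by (subst holomorphic_on_open) auto
  moreover have "h holomorphic_on UNIV"
    using h by (subst holomorphic_on_open) auto
  ultimately show "\<exists>g h. g holomorphic_on UNIV \<and> h holomorphic_on UNIV \<and> (\<forall>\<zeta>. f (a + \<zeta> *s b) = g \<zeta> + cnj (h \<zeta>))"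
    by (intro exI[of _ "\<lambda>\<zeta>. f (a + \<zeta> *s b) - cnj (h \<zeta>)"] exI[of _ h]) auto
qed

text \<open>The constant conj(h(0)) is moved to g, which makes the splitting on a parametrized line
  unique.\<close>

lemma line_harmonic_decomp:
  assumes "line_harmonic f"
  obtains g h where "g holomorphic_on UNIV" "h holomorphic_on UNIV" "h 0 = 0"
    "\<And>\<zeta>. f (a + \<zeta> *s b) = g \<zeta> + cnj (h \<zeta>)"
proof -
  obtain g h where "g holomorphic_on UNIV" "h holomorphic_on UNIV"
    "\<And>\<zeta>. f (a + \<zeta> *s b) = g \<zeta> + cnj (h \<zeta>)"
    using assms unfolding line_harmonic_def by metis
  then show ?thesis
    by (intro that[of "\<lambda>\<zeta>. g \<zeta> + cnj (h 0)" "\<lambda>\<zeta>. h \<zeta> - h 0"]) (auto intro!: holomorphic_intros)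
qed

section \<open>Gaussian integrals against functions of one coordinate\<close>

lemma axis_eq_smult: "axis i c = c *s (axis i 1 :: complex ^ 'n)"
  by (simp add: vec_eq_iff axis_def)

lemma continuous_on_smult_vec[continuous_intros]:
  "continuous_on A f \<Longrightarrow> continuous_on A g \<Longrightarrow> continuous_on A (\<lambda>x. f x *s (g x :: complex ^ 'n))"
  unfolding vector_scalar_mult_def by (intro continuous_on_vec_lambda continuous_on_mult continuous_on_component)

lemma continuous_on_axis[continuous_intros]:
  "continuous_on A f \<Longrightarrow> continuous_on A (\<lambda>x. axis i (f x) :: complex ^ 'n)"
  by (subst axis_eq_smult) (intro continuous_on_smult_vec continuous_intros)

lemma norm_vec_sq: "(norm (z :: complex ^ 'n))\<^sup>2 = (\<Sum>j\<in>UNIV. (norm (z $ j))\<^sup>2)"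
  unfolding norm_vec_def L2_set_def by (simp add: sum_nonneg)

lemma norm_smult_unit: "norm c = 1 \<Longrightarrow> norm (c *s (z :: complex ^ 'n)) = norm z"
  by (simp add: norm_vec_def norm_mult)

text \<open>Rotate all coordinates other than \<open>z $ i\<close> by a common phase. This is an
  isometry that keeps the second factor fixed and moves z on a circle in a complex line, centred at
  the point \<open>axis i (z $ i)\<close>; the mean value property replaces f by its value at the
  centre.\<close>

lemma gauss_restrict_axis:
  fixes f :: "complex ^ 'n \<Rightarrow> complex"
  assumes \<alpha>: "\<alpha> > 0" and f: "line_harmonic f" "continuous_on UNIV f"
    and \<phi>: "continuous_on UNIV \<phi>" and int: "integrable (gauss \<alpha>) (\<lambda>z. f z * \<phi> (z $ i))"
  shows "(\<integral>z. f z * \<phi> (z $ i) \<partial>gauss \<alpha>) = (\<integral>z. f (axis i (z $ i)) * \<phi> (z $ i) \<partial>gauss \<alpha>)"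
    "integrable (gauss \<alpha>) (\<lambda>z. f (axis i (z $ i)) * \<phi> (z $ i))"
proof -
  define R where "R t z = axis i (z $ i) + ee t *s (z - axis i (z $ i))" for t and z :: "complex ^ 'n"
  have Rc: "R t z $ j = (if j = i then z $ i else ee t * z $ j)" for t z j
    by (auto simp: R_def axis_def)
  have norm: "norm (R t z) = norm z" for t z
  proof -
    have "norm (R t z $ j) = norm (z $ j)" for j by (simp add: Rc norm_mult)
    then show ?thesis by (simp add: norm_vec_def)
  qed
  have lin: "linear (R t)" for t
    by (rule linearI) (auto simp: vec_eq_iff Rc algebra_simps)
  have contR: "continuous_on UNIV (\<lambda>(t, z). R t z)"
    unfolding R_def case_prod_beta by (intro continuous_intros)
  have contf: "continuous_on UNIV (\<lambda>z. f z * \<phi> (z $ i))"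
    by (intro continuous_intros continuous_on_compose2[OF \<phi>] f) auto
  have I: "((\<lambda>t. f (R t z) * \<phi> (R t z $ i)) has_integral f (axis i (z $ i)) * \<phi> (z $ i)) {0..1}" for z
  proof -
    obtain g h where gh: "g holomorphic_on UNIV" "h holomorphic_on UNIV" "h 0 = 0"
      "\<And>\<zeta>. f (axis i (z $ i) + \<zeta> *s (z - axis i (z $ i))) = g \<zeta> + cnj (h \<zeta>)"
      using line_harmonic_decomp[OF f(1)] by metis
    have "((\<lambda>t. f (R t z)) has_integral g 0) {0..1}"
      using circle_mean_harmonic_cnj_power[OF gh(1-3), of 1 0] unfolding R_def gh(4) by simp
    moreover have "g 0 = f (axis i (z $ i))"
      using gh(4)[of 0] gh(3) by simp
    ultimately show ?thesis
      by (simp add: Rc has_integral_mult_left)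
  qed
  show "(\<integral>z. f z * \<phi> (z $ i) \<partial>gauss \<alpha>) = (\<integral>z. f (axis i (z $ i)) * \<phi> (z $ i) \<partial>gauss \<alpha>)"
    by (rule gauss_average(1)[OF \<alpha> contf int contR lin norm I])
  show "integrable (gauss \<alpha>) (\<lambda>z. f (axis i (z $ i)) * \<phi> (z $ i))"
    by (rule gauss_average(2)[OF \<alpha> contf int contR lin norm I])
qed

text \<open>Here all coordinates are rotated by the same phase, so a function of one coordinate is
  averaged over circles about 0.\<close>

lemma gauss_rotate:
  fixes i :: "'n::finite" and F :: "complex \<Rightarrow> complex"
  assumes \<alpha>: "\<alpha> > 0" and F: "continuous_on UNIV F" and int: "integrable (gauss \<alpha>) (\<lambda>z :: complex ^ 'n. F (z $ i))"
    and I: "\<And>\<zeta>. ((\<lambda>t. F (\<zeta> * ee t)) has_integral I \<zeta>) {0..1}"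
  shows "(\<integral>(z::complex ^ 'n). F (z $ i) \<partial>gauss \<alpha>) = (\<integral>(z::complex ^ 'n). I (z $ i) \<partial>gauss \<alpha>)"
proof (rule gauss_average(1)[OF \<alpha> _ int, of "\<lambda>t z. ee t *s z"])
  show "continuous_on UNIV (\<lambda>z :: complex ^ 'n. F (z $ i))"
    by (intro continuous_on_compose2[OF F] continuous_intros) auto
  show "continuous_on UNIV (\<lambda>(t, z :: complex ^ 'n). ee t *s z)"
    unfolding case_prod_beta by (intro continuous_intros)
  show "linear (\<lambda>z :: complex ^ 'n. ee t *s z)" for t
    by (rule linearI) (auto simp: vec_eq_iff algebra_simps)
  show "((\<lambda>t. F ((ee t *s z) $ i)) has_integral I (z $ i)) {0..1}" for z :: "complex ^ 'n"
    using I[of "z $ i"] by (simp add: mult.commute)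
qed (simp add: norm_smult_unit)

text \<open>Orthogonality of monomials: the angular mean retains only the k-th Taylor coefficient of
  g, times |\<open>z $ i\<close>|^(2k).\<close>

lemma gauss_rotate_cnj_power:
  fixes i :: "'n::finite"
  assumes \<alpha>: "\<alpha> > 0" and gh: "g holomorphic_on UNIV" "h holomorphic_on UNIV" "h 0 = 0"
    and int: "integrable (gauss \<alpha>) (\<lambda>z :: complex ^ 'n. (g (z $ i) + cnj (h (z $ i))) * cnj (z $ i) ^ k)"
  shows "(\<integral>(z::complex ^ 'n). (g (z $ i) + cnj (h (z $ i))) * cnj (z $ i) ^ k \<partial>gauss \<alpha>)
    = (deriv ^^ k) g 0 / fact k * of_real (\<integral>(z::complex ^ 'n). norm (z $ i) ^ (2 * k) \<partial>gauss \<alpha>)"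
proof -
  have "(\<integral>(z::complex ^ 'n). (g (z $ i) + cnj (h (z $ i))) * cnj (z $ i) ^ k \<partial>gauss \<alpha>)
    = (\<integral>(z::complex ^ 'n). (deriv ^^ k) g 0 / fact k * of_real (norm (z $ i) ^ (2 * k)) \<partial>gauss \<alpha>)"
  proof (rule gauss_rotate[OF \<alpha> _ int])
    show "continuous_on UNIV (\<lambda>w. (g w + cnj (h w)) * cnj w ^ k)"
      by (intro continuous_intros holomorphic_on_imp_continuous_on gh)
    fix \<zeta>
    have "of_real (norm \<zeta> ^ (2 * k)) = \<zeta> ^ k * cnj \<zeta> ^ k"
      by (simp only: power_mult complex_norm_square[symmetric] of_real_power power_mult_distrib[symmetric])
    then show "((\<lambda>t. (g (\<zeta> * ee t) + cnj (h (\<zeta> * ee t))) * cnj (\<zeta> * ee t) ^ k) has_integral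
      (deriv ^^ k) g 0 / fact k * of_real (norm \<zeta> ^ (2 * k))) {0..1}"
      using has_integral_mult_right[OF circle_mean_harmonic_cnj_power[OF gh, of \<zeta> k], of "cnj \<zeta> ^ k"]
      by (simp add: power_mult_distrib mult_ac)
  qed
  then show ?thesis by (simp del: of_real_power)
qed

lemma gauss_rotate_power:
  fixes i :: "'n::finite"
  assumes \<alpha>: "\<alpha> > 0" and gh: "g holomorphic_on UNIV" "h holomorphic_on UNIV" and k: "k > 0"
    and int: "integrable (gauss \<alpha>) (\<lambda>z :: complex ^ 'n. (g (z $ i) + cnj (h (z $ i))) * (z $ i) ^ k)"
  shows "(\<integral>(z::complex ^ 'n). (g (z $ i) + cnj (h (z $ i))) * (z $ i) ^ k \<partial>gauss \<alpha>)
    = cnj ((deriv ^^ k) h 0 / fact k) * of_real (\<integral>(z::complex ^ 'n). norm (z $ i) ^ (2 * k) \<partial>gauss \<alpha>)"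
proof -
  have "(\<integral>(z::complex ^ 'n). (g (z $ i) + cnj (h (z $ i))) * (z $ i) ^ k \<partial>gauss \<alpha>)
    = (\<integral>(z::complex ^ 'n). cnj ((deriv ^^ k) h 0 / fact k) * of_real (norm (z $ i) ^ (2 * k)) \<partial>gauss \<alpha>)"
  proof (rule gauss_rotate[OF \<alpha> _ int])
    show "continuous_on UNIV (\<lambda>w. (g w + cnj (h w)) * w ^ k)"
      by (intro continuous_intros holomorphic_on_imp_continuous_on gh)
    fix \<zeta>
    have "of_real (norm \<zeta> ^ (2 * k)) = \<zeta> ^ k * cnj \<zeta> ^ k"
      by (simp only: power_mult complex_norm_square[symmetric] of_real_power power_mult_distrib[symmetric])
    then show "((\<lambda>t. (g (\<zeta> * ee t) + cnj (h (\<zeta> * ee t))) * (\<zeta> * ee t) ^ k) has_integral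
      cnj ((deriv ^^ k) h 0 / fact k) * of_real (norm \<zeta> ^ (2 * k))) {0..1}"
      using has_integral_mult_right[OF circle_mean_harmonic_power[OF gh k, of \<zeta>], of "\<zeta> ^ k"]
      by (simp add: power_mult_distrib mult_ac)
  qed
  then show ?thesis by (simp del: of_real_power)
qed

text \<open>Integrate \<open>e\<^bsup>z\<^sub>i\<^esup> \<bar>z\<^sub>i\<^sup>k\<close> twice: by rotation invariance, and after a translation
  by \<open>\<alpha>\<close>, which turns the integrand into an antiholomorphic function.\<close>

lemma gauss_moment:
  fixes i :: "'n::finite"
  assumes \<alpha>: "\<alpha> > 0"
  shows "(\<integral>(z::complex ^ 'n). norm (z $ i) ^ (2 * k) \<partial>gauss \<alpha>) = fact k * \<alpha> ^ k"
proof -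
  interpret prob_space "gauss \<alpha> :: (complex ^ 'n) measure" by (rule prob_space_gauss[OF \<alpha>])
  let ?m = "\<integral>(z::complex ^ 'n). norm (z $ i) ^ (2 * k) \<partial>gauss \<alpha>"
  \<comment> \<open>All derivatives of exp at 0 are 1, so averaging over rotations gives the k-th
    moment divided by k!.\<close>
  define \<psi> where "\<psi> z = exp (z $ i) * cnj (z $ i) ^ k" for z :: "complex ^ 'n"
  define \<theta> where "\<theta> w = exp (- w) * (w + of_real \<alpha>) ^ k" for w :: complex
  have \<theta>: "\<theta> holomorphic_on UNIV" unfolding \<theta>_def by (intro holomorphic_intros)
  have ex: "exp holomorphic_on UNIV" by (intro holomorphic_intros)
  have [measurable]: "\<psi> \<in> borel_measurable borel"
    unfolding \<psi>_def by (intro borel_measurable_continuous_onI continuous_intros)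
  have int\<psi>: "integrable (gauss \<alpha>) \<psi>"
  proof (rule integrable_gauss_exp_bound[OF _ \<alpha>, of _ "fact k" 2])
    fix z :: "complex ^ 'n"
    have "norm (\<psi> z) \<le> exp (norm (z $ i)) * (fact k * exp (norm (z $ i)))"
      unfolding \<psi>_def norm_mult
      by (intro mult_mono norm_exp) (auto simp: norm_power intro: power_le_fact_exp)
    also have "\<dots> = fact k * exp (2 * norm (z $ i))"
      by (simp add: exp_double power2_eq_square)
    also have "\<dots> \<le> fact k * exp (2 * norm z)"
      using Finite_Cartesian_Product.norm_nth_le[of z i] by simp
    finally show "norm (\<psi> z) \<le> fact k * exp (2 * norm z)" .
  qed simp
  have "integral\<^sup>L (gauss \<alpha>) \<psi> = (deriv ^^ k) exp 0 / fact k * of_real ?m"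
    unfolding \<psi>_def using gauss_rotate_cnj_power[OF \<alpha> ex, of "\<lambda>_. 0" i k] int\<psi>[unfolded \<psi>_def]
    by simp
  moreover have "(deriv ^^ k) exp = (exp :: complex \<Rightarrow> complex)"
  proof (induction k)
    case (Suc k)
    have "deriv exp = (exp :: complex \<Rightarrow> complex)"
      by (rule ext) (rule DERIV_imp_deriv[OF DERIV_exp])
    with Suc show ?case by simp
  qed simp
  ultimately have 1: "integral\<^sup>L (gauss \<alpha>) \<psi> = of_real ?m / fact k" by simp
  \<comment> \<open>Translation by \<alpha> multiplies the density by exp(-\<alpha> - 2 Re w), w =
    \<open>z $ i\<close>. Together with exp(\<alpha> + w) this is exp(-conj(w)): the holomorphic
    factor is gone and the integrand is the conjugate of \<open>\<theta>\<close>.\<close>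
  define a :: "complex ^ 'n" where "a = axis i (of_real \<alpha>)"
  have a: "exp (((norm z)\<^sup>2 - (norm (a + z))\<^sup>2) / \<alpha>) *\<^sub>R \<psi> (a + z) = cnj (\<theta> (z $ i))" for z
  proof -
    have "(norm (a + z))\<^sup>2 - (norm z)\<^sup>2 = (\<Sum>j\<in>UNIV. (norm ((a + z) $ j))\<^sup>2 - (norm (z $ j))\<^sup>2)"
      by (simp add: norm_vec_sq sum_subtractf)
    also have "\<dots> = (\<Sum>j\<in>UNIV. if j = i then (norm (of_real \<alpha> + z $ i))\<^sup>2 - (norm (z $ i))\<^sup>2 else 0)"
      by (intro sum.cong refl) (auto simp: a_def axis_def)
    also have "\<dots> = \<alpha>\<^sup>2 + 2 * \<alpha> * Re (z $ i)"
      by (simp add: cmod_power2) (simp add: power2_eq_square algebra_simps)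
    finally have "((norm z)\<^sup>2 - (norm (a + z))\<^sup>2) / \<alpha> = - \<alpha> - 2 * Re (z $ i)"
      using \<alpha> by (simp add: field_simps power2_eq_square)
    then have "exp (((norm z)\<^sup>2 - (norm (a + z))\<^sup>2) / \<alpha>) *\<^sub>R \<psi> (a + z)
       = exp (of_real (- \<alpha> - 2 * Re (z $ i))) * \<psi> (a + z)"
      by (simp only: scaleR_conv_of_real exp_of_real)
    also have "\<dots> = exp (of_real (- \<alpha> - 2 * Re (z $ i))) * (exp (of_real \<alpha> + z $ i) * cnj (of_real \<alpha> + z $ i) ^ k)"
      by (simp add: \<psi>_def a_def axis_def)
    also have "\<dots> = exp (- cnj (z $ i)) * cnj (z $ i + of_real \<alpha>) ^ k"
    proof -
      have "of_real (- \<alpha> - 2 * Re (z $ i)) + (of_real \<alpha> + z $ i) = - cnj (z $ i)"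
        by (simp add: complex_eq_iff)
      then have "exp (of_real (- \<alpha> - 2 * Re (z $ i))) * exp (of_real \<alpha> + z $ i) = exp (- cnj (z $ i))"
        by (metis exp_add)
      then show ?thesis by (simp add: mult.assoc[symmetric] add.commute)
    qed
    also have "\<dots> = cnj (\<theta> (z $ i))"
      by (simp add: \<theta>_def exp_cnj)
    finally show ?thesis .
  qed
  have "integral\<^sup>L (gauss \<alpha>) \<psi> = (\<integral>(z::complex ^ 'n). cnj (\<theta> (z $ i)) \<partial>gauss \<alpha>)"
    using gauss_translate[OF _ \<alpha>, of \<psi> a] by (simp add: a)
  \<comment> \<open>The mean value property leaves \<open>\<theta> 0\<close>, which is
    \<alpha>^k.\<close>
  also have "\<dots> = (\<integral>(z::complex ^ 'n). cnj (\<theta> 0) \<partial>gauss \<alpha>)"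
  proof (rule gauss_rotate[OF \<alpha>])
    show "continuous_on UNIV (\<lambda>z. cnj (\<theta> z))"
      by (intro continuous_intros holomorphic_on_imp_continuous_on \<theta>)
    show "integrable (gauss \<alpha>) (\<lambda>z :: complex ^ 'n. cnj (\<theta> (z $ i)))"
    proof (rule integrable_gauss_exp_bound[OF _ \<alpha>, of _ "fact k * exp \<alpha>" 2])
      show "(\<lambda>z :: complex ^ 'n. cnj (\<theta> (z $ i))) \<in> borel_measurable borel"
        unfolding \<theta>_def by (intro borel_measurable_continuous_onI continuous_intros)
      fix z :: "complex ^ 'n"
      have "norm (cnj (\<theta> (z $ i))) \<le> exp (norm (z $ i)) * (norm (z $ i) + \<alpha>) ^ k"
        unfolding \<theta>_def complex_mod_cnj norm_mult norm_power
        using norm_exp[of "- (z $ i)"] norm_triangle_ineq[of "z $ i" "of_real \<alpha>"] \<alpha>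
        by (intro mult_mono power_mono) auto
      also have "\<dots> \<le> exp (norm (z $ i)) * (fact k * exp (norm (z $ i) + \<alpha>))"
        using \<alpha> by (intro mult_left_mono power_le_fact_exp) auto
      also have "\<dots> = fact k * exp \<alpha> * exp (2 * norm (z $ i))"
        by (simp add: exp_double power2_eq_square exp_add)
      also have "\<dots> \<le> fact k * exp \<alpha> * exp (2 * norm z)"
        using Finite_Cartesian_Product.norm_nth_le[of z i] by simp
      finally show "norm (cnj (\<theta> (z $ i))) \<le> fact k * exp \<alpha> * exp (2 * norm z)" .
    qed
    show "((\<lambda>t. cnj (\<theta> (\<zeta> * ee t))) has_integral cnj (\<theta> 0)) {0..1}" for \<zeta>
      using circle_mean_cnj_power[OF \<theta>, of \<zeta> 0] has_integral_cnj[of "\<lambda>t. \<theta> (\<zeta> * ee t)"]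
      by (simp add: o_def)
  qed
  also have "\<dots> = of_real \<alpha> ^ k" using prob_space by (simp add: \<theta>_def)
  finally have "of_real ?m / fact k = (of_real (\<alpha> ^ k) :: complex)"
    using 1 by simp
  then have "(of_real ?m :: complex) = of_real (fact k * \<alpha> ^ k)"
    by (simp add: field_simps)
  then show ?thesis by (simp only: of_real_eq_iff)
qed

section \<open>Toeplitz operators of measures on a coordinate axis\<close>

lemma series_Cauchy_Schwarz:
  fixes a b :: "nat \<Rightarrow> real"
  assumes a: "summable (\<lambda>k. (a k)\<^sup>2)" and b: "summable (\<lambda>k. (b k)\<^sup>2)"
    and nn: "\<And>k. 0 \<le> a k" "\<And>k. 0 \<le> b k"
  shows "summable (\<lambda>k. a k * b k)"
    and "(\<Sum>k. a k * b k)\<^sup>2 \<le> (\<Sum>k. (a k)\<^sup>2) * (\<Sum>k. (b k)\<^sup>2)"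
proof -
  show s: "summable (\<lambda>k. a k * b k)"
  proof (rule summable_comparison_test')
    show "summable (\<lambda>k. (a k)\<^sup>2 + (b k)\<^sup>2)"
      by (intro summable_add a b)
    show "norm (a k * b k) \<le> (a k)\<^sup>2 + (b k)\<^sup>2" for k
      using sum_squares_bound[of "a k" "b k"] mult_nonneg_nonneg[OF nn[of k]]
      unfolding real_norm_def mult.assoc by linarith
  qed
  let ?A = "\<Sum>k. (a k)\<^sup>2" and ?B = "\<Sum>k. (b k)\<^sup>2"
  have "(\<Sum>k. a k * b k) \<le> sqrt (?A * ?B)"
  proof (rule suminf_le_const[OF s])
    fix n
    have "(\<Sum>k<n. a k * b k)\<^sup>2 \<le> (\<Sum>k<n. (a k)\<^sup>2) * (\<Sum>k<n. (b k)\<^sup>2)"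
      by (rule Cauchy_Schwarz_ineq_sum)
    also have "\<dots> \<le> ?A * ?B"
      by (intro mult_mono sum_le_suminf a b suminf_nonneg sum_nonneg) auto
    finally show "(\<Sum>k<n. a k * b k) \<le> sqrt (?A * ?B)"
      by (rule real_le_rsqrt)
  qed
  moreover have "0 \<le> (\<Sum>k. a k * b k)"
    by (intro suminf_nonneg s mult_nonneg_nonneg nn)
  ultimately have "(\<Sum>k. a k * b k)\<^sup>2 \<le> (sqrt (?A * ?B))\<^sup>2"
    by (intro power_mono)
  also have "\<dots> = ?A * ?B"
    by (intro real_sqrt_pow2 mult_nonneg_nonneg suminf_nonneg a b) auto
  finally show "(\<Sum>k. a k * b k)\<^sup>2 \<le> ?A * ?B" .
qed

lemma axis_of_real_mult: "axis i (of_real c * w) = c *\<^sub>R (axis i w :: complex ^ 'n)"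
  by (auto simp: vec_eq_iff axis_def complex_eq_iff)

lemma norm_axis_complex: "norm (axis i w :: complex ^ 'n) = norm w"
proof -
  have "(norm (axis i w :: complex ^ 'n))\<^sup>2 = (\<Sum>j\<in>UNIV. if j = i then (norm w)\<^sup>2 else 0)"
    unfolding norm_vec_sq by (intro sum.cong) (auto simp: axis_def)
  then show ?thesis by simp
qed

text \<open>The weight \<open>e\<^bsup>|z|\<^sup>2/\<alpha>\<^esup>\<close> cancels the one in the Toeplitz form.\<close>

definition axis_gauss :: "real \<Rightarrow> 'n \<Rightarrow> real \<Rightarrow> (complex ^ 'n) measure" where
  "axis_gauss \<alpha> i q = density (distr (gauss \<alpha>) borel (\<lambda>z. axis i (of_real q * z $ i)))
     (\<lambda>z. ennreal (exp ((norm z)\<^sup>2 / \<alpha>)))"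

text \<open>What the Fock space and the pluriharmonic space have in common; \<open>expand\<close> is the Taylor
  expansion along the \<open>z\<^sub>i\<close>-axis.\<close>

locale axis_space = function_space \<alpha> H
  for \<alpha> :: real and H :: "(complex ^ 'n \<Rightarrow> complex) set" +
  fixes i :: 'n and E :: "nat \<Rightarrow> complex ^ 'n \<Rightarrow> complex" and d :: "nat \<Rightarrow> nat"
  assumes E_H: "E k \<in> H"
    and E_scale: "E k (t *\<^sub>R z) = of_real t ^ d k * E k z"
    and E_axis: "E k (axis i (z $ i)) = E k z"
    and E_orth: "ip \<alpha> (E j) (E k) = (if j = k then 1 else 0)"
    and E_summable: "summable (\<lambda>k. (norm (E k z))\<^sup>2)"
    and d_summable: "0 < x \<Longrightarrow> x < 1 \<Longrightarrow> summable (\<lambda>k. x ^ d k :: real)"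
    and d_mono: "mono d"
    and expand: "f \<in> H \<Longrightarrow> (\<lambda>k. ip \<alpha> f (E k) * E k (axis i \<zeta>)) sums f (axis i \<zeta>)"
    and closed: "(\<And>z. summable (\<lambda>k. norm (c k * E k z))) \<Longrightarrow>
      sq_integrable \<alpha> (\<lambda>z. \<Sum>k. c k * E k z) \<Longrightarrow> (\<lambda>z. \<Sum>k. c k * E k z) \<in> H"
begin

section \<open>Convergent series in the orthonormal functions \<open>E k\<close>\<close>

lemma E_L2: "L2norm \<alpha> (E k) = 1"
  using ip_self[of \<alpha> "E k"] E_orth[of k k] L2norm_nonneg[of \<alpha> "E k"]
  by (simp add: power2_eq_1_iff flip: of_real_power)

lemma coeff_le: "f \<in> H \<Longrightarrow> norm (ip \<alpha> f (E k)) \<le> L2norm \<alpha> f"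
  using ip_Cauchy_Schwarz[OF H_sq H_sq[OF E_H], of f k] by (simp add: E_L2)

text \<open>An integrable majorant: the squared modulus of \<open>S c z\<close> is at most a
  constant times \<open>M q z\<close>, and the integral of \<open>M q\<close> is the sum of the
  \<open>q ^ d k\<close>.\<close>

definition M :: "real \<Rightarrow> complex ^ 'n \<Rightarrow> real" where
  "M q z = (\<Sum>k. q ^ d k * (norm (E k z))\<^sup>2)"

definition S :: "(nat \<Rightarrow> complex) \<Rightarrow> complex ^ 'n \<Rightarrow> complex" where
  "S c z = (\<Sum>k. c k * E k z)"

text \<open>The weight fits Cauchy-Schwarz after \<open>c k * E k z\<close> is split into c_k
  q^(-d/2) and q^(d/2) E_k(z), d = \<open>d k\<close>. It yields pointwise absolute convergence, the
  majorant \<open>M\<close>, and absolute summability of the coefficients.\<close>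

definition decaying :: "real \<Rightarrow> (nat \<Rightarrow> complex) \<Rightarrow> bool" where
  "decaying q c \<longleftrightarrow> 0 < q \<and> q < 1 \<and> summable (\<lambda>k. (norm (c k))\<^sup>2 / q ^ d k)"

lemma M_summable:
  assumes "0 < q" "q < 1"
  shows "summable (\<lambda>k. q ^ d k * (norm (E k z))\<^sup>2)"
  by (rule summable_comparison_test'[OF E_summable[of z]])
    (use assms in \<open>auto simp: abs_mult intro!: mult_left_le_one_le power_le_one\<close>)

lemma M_integrable:
  assumes q: "0 < q" "q < 1"
  shows "integrable (gauss \<alpha>) (M q)"
  unfolding M_def
proof (rule integrable_suminf)
  show "integrable (gauss \<alpha>) (\<lambda>z. q ^ d k * (norm (E k z))\<^sup>2)" for k
    using sq_integrable_int[OF H_sq[OF E_H]] by simp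
  show "AE z in gauss \<alpha>. summable (\<lambda>k. norm (q ^ d k * (norm (E k z))\<^sup>2))"
    using M_summable[OF q] q by (auto simp: abs_mult)
  have "(\<integral>z. norm (q ^ d k * (norm (E k z))\<^sup>2) \<partial>gauss \<alpha>) = q ^ d k" for k
    using q L2norm_sq[of \<alpha> "E k"] by (simp add: abs_mult E_L2)
  then show "summable (\<lambda>k. \<integral>z. norm (q ^ d k * (norm (E k z))\<^sup>2) \<partial>gauss \<alpha>)"
    using d_summable[OF q] by simp
qed

lemma decaying_summable:
  assumes "decaying q c"
  shows "summable (\<lambda>k. norm (c k * E k z))"
    and "(\<Sum>k. norm (c k * E k z))\<^sup>2 \<le> (\<Sum>k. (norm (c k))\<^sup>2 / q ^ d k) * M q z"
proof -
  have q: "0 < q" "q < 1" using assms by (auto simp: decaying_def)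
  let ?a = "\<lambda>k. norm (c k) / sqrt (q ^ d k)" and ?b = "\<lambda>k. sqrt (q ^ d k) * norm (E k z)"
  have a: "(?a k)\<^sup>2 = (norm (c k))\<^sup>2 / q ^ d k" for k
    using q by (simp add: power_divide)
  have b: "(?b k)\<^sup>2 = q ^ d k * (norm (E k z))\<^sup>2" for k
    using q by (simp add: power_mult_distrib)
  have ab: "?a k * ?b k = norm (c k * E k z)" for k
    using q by (simp add: norm_mult)
  note CS = series_Cauchy_Schwarz[of ?a ?b, unfolded a b ab]
  show "summable (\<lambda>k. norm (c k * E k z))"
    by (rule CS(1)) (use assms q M_summable[OF q] in \<open>auto simp: decaying_def\<close>)
  show "(\<Sum>k. norm (c k * E k z))\<^sup>2 \<le> (\<Sum>k. (norm (c k))\<^sup>2 / q ^ d k) * M q z"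
    unfolding M_def by (rule CS(2)) (use assms q M_summable[OF q] in \<open>auto simp: decaying_def\<close>)
qed

lemma decaying_abs_summable:
  assumes "decaying q c"
  shows "summable (\<lambda>k. norm (c k))"
proof -
  have q: "0 < q" "q < 1" using assms by (auto simp: decaying_def)
  have "summable (\<lambda>k. (norm (c k) / sqrt (q ^ d k)) * sqrt (q ^ d k))"
    using assms q d_summable[OF q]
    by (intro series_Cauchy_Schwarz(1)) (auto simp: decaying_def power_divide)
  then show ?thesis using q by simp
qed

lemma E_measurable[measurable]: "E k \<in> borel_measurable borel"
  using H_sq[OF E_H] by (simp add: sq_integrable_def)

text \<open>Square integrability comes from the majorant \<open>M\<close>; the analytic property of
  the sum is what \<open>closed\<close> supplies for each of the two spaces.\<close>

lemma S_H:
  assumes "decaying q c"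
  shows "S c \<in> H"
proof -
  have q: "0 < q" "q < 1" using assms by (auto simp: decaying_def)
  define A where "A = (\<Sum>k. (norm (c k))\<^sup>2 / q ^ d k)"
  have bd: "(norm (S c z))\<^sup>2 \<le> A * M q z" for z
  proof -
    have "norm (S c z) \<le> (\<Sum>k. norm (c k * E k z))"
      unfolding S_def by (rule summable_norm[OF decaying_summable(1)[OF assms]])
    then have "(norm (S c z))\<^sup>2 \<le> (\<Sum>k. norm (c k * E k z))\<^sup>2"
      by (intro power_mono) auto
    with decaying_summable(2)[OF assms] show ?thesis unfolding A_def by (rule order_trans[rotated])
  qed
  have [measurable]: "S c \<in> borel_measurable borel"
    unfolding S_def by measurable
  have "sq_integrable \<alpha> (S c)"
    unfolding sq_integrable_def
  proof
    show "integrable (gauss \<alpha>) (\<lambda>z. (norm (S c z))\<^sup>2)"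
    proof (rule Bochner_Integration.integrable_bound)
      show "integrable (gauss \<alpha>) (\<lambda>z. A * M q z)"
        using M_integrable[OF q] by simp
      show "AE z in gauss \<alpha>. norm ((norm (S c z))\<^sup>2) \<le> norm (A * M q z)"
        using bd by (auto intro: order_trans[OF _ abs_ge_self])
    qed simp
  qed simp
  then show ?thesis
    using closed[of c] decaying_summable(1)[OF assms] unfolding S_def by auto
qed

text \<open>Termwise integration is justified by the absolute summability of c, because each
  \<open>E k\<close> has norm one.\<close>

lemma ip_S_sums:
  assumes c: "decaying q c" and g: "g \<in> H"
  shows "(\<lambda>k. c k * cnj (ip \<alpha> g (E k))) sums ip \<alpha> (S c) g"
proof -
  have [measurable]: "g \<in> borel_measurable borel" using H_sq[OF g] by (simp add: sq_integrable_def)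
  have int: "integrable (gauss \<alpha>) (\<lambda>z. E k z * cnj (g z))" for k
    by (rule sq_integrable_mult[OF H_sq[OF E_H] H_sq[OF g]])
  have "(\<lambda>k. \<integral>z. c k * (E k z * cnj (g z)) \<partial>gauss \<alpha>) sums (\<integral>z. (\<Sum>k. c k * (E k z * cnj (g z))) \<partial>gauss \<alpha>)"
  proof (rule sums_integral)
    show "integrable (gauss \<alpha>) (\<lambda>z. c k * (E k z * cnj (g z)))" for k
      using int by simp
    show "AE z in gauss \<alpha>. summable (\<lambda>k. norm (c k * (E k z * cnj (g z))))"
      using summable_mult2[OF decaying_summable(1)[OF c]] by (auto simp: norm_mult mult.assoc)
    show "summable (\<lambda>k. \<integral>z. norm (c k * (E k z * cnj (g z))) \<partial>gauss \<alpha>)"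
    proof (rule summable_comparison_test')
      show "summable (\<lambda>k. norm (c k) * L2norm \<alpha> g)"
        by (intro summable_mult2 decaying_abs_summable[OF c])
      fix k
      have "(\<integral>z. norm (E k z) * norm (g z) \<partial>gauss \<alpha>) \<le> L2norm \<alpha> g"
        using integral_norm_mult_le[OF H_sq[OF E_H] H_sq[OF g], of k] by (simp add: E_L2)
      then have "norm (c k) * (\<integral>z. norm (E k z) * norm (g z) \<partial>gauss \<alpha>) \<le> norm (c k) * L2norm \<alpha> g"
        by (rule mult_left_mono) simp
      moreover have "(\<integral>z. norm (c k * (E k z * cnj (g z))) \<partial>gauss \<alpha>) = norm (c k) * (\<integral>z. norm (E k z) * norm (g z) \<partial>gauss \<alpha>)"
        by (simp add: norm_mult)
      ultimately show "norm (\<integral>z. norm (c k * (E k z * cnj (g z))) \<partial>gauss \<alpha>) \<le> norm (c k) * L2norm \<alpha> g"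
        by (simp add: integral_nonneg_AE)
    qed
  qed
  moreover have "(\<integral>z. c k * (E k z * cnj (g z)) \<partial>gauss \<alpha>) = c k * cnj (ip \<alpha> g (E k))" for k
    using ip_commute[of \<alpha> "E k" g] by (simp add: ip_def)
  moreover have "(\<Sum>k. c k * (E k z * cnj (g z))) = S c z * cnj (g z)" for z
    unfolding S_def using suminf_mult2[OF summable_norm_cancel[OF decaying_summable(1)[OF c]], of z "cnj (g z)"]
    by (simp add: mult.assoc)
  ultimately have "(\<lambda>k. c k * cnj (ip \<alpha> g (E k))) sums (\<integral>z. S c z * cnj (g z) \<partial>gauss \<alpha>)"
    by (simp only:)
  then show ?thesis unfolding ip_def[of \<alpha> "S c" g] .
qed

lemma ip_S_E:
  assumes "decaying q c"
  shows "ip \<alpha> (S c) (E k) = c k"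
proof -
  have "(\<lambda>j. c j * cnj (ip \<alpha> (E k) (E j))) = (\<lambda>j. if j = k then c j else 0)"
    by (auto simp: E_orth)
  with ip_S_sums[OF assms E_H, of k] sums_single[of k c] show ?thesis
    by (simp add: sums_iff)
qed

lemma L2norm_S_sums:
  assumes "decaying q c"
  shows "(\<lambda>k. (norm (c k))\<^sup>2) sums (L2norm \<alpha> (S c))\<^sup>2"
proof -
  have "(\<lambda>k. c k * cnj (c k)) sums ip \<alpha> (S c) (S c)"
    using ip_S_sums[OF assms S_H[OF assms]] by (simp add: ip_S_E[OF assms])
  then have "(\<lambda>k. complex_of_real ((norm (c k))\<^sup>2)) sums complex_of_real ((L2norm \<alpha> (S c))\<^sup>2)"
    by (simp only: ip_self complex_norm_square)
  then show ?thesis by (simp only: sums_of_real_iff)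
qed

lemma decaying_bounded:
  assumes "0 < q" "q < 1" "\<And>k. norm (c k) \<le> B"
  shows "decaying q (\<lambda>k. of_real q ^ d k * c k)"
  unfolding decaying_def
proof (intro conjI assms)
  show "summable (\<lambda>k. (norm (of_real q ^ d k * c k))\<^sup>2 / q ^ d k)"
  proof (rule summable_comparison_test')
    show "summable (\<lambda>k. q ^ d k * B\<^sup>2)"
      by (intro summable_mult2 d_summable assms)
    show "norm ((norm (of_real q ^ d k * c k))\<^sup>2 / q ^ d k) \<le> q ^ d k * B\<^sup>2" for k
      using assms(1) power_mono[OF assms(3)[of k], of 2]
      by (simp add: norm_mult norm_power power_mult_distrib power2_eq_square)
  qed
qed

text \<open>The reproducing kernel at the point \<open>(0, \<dots>, \<zeta>, \<dots>, 0)\<close> of the axis.\<close>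

definition K :: "complex \<Rightarrow> complex ^ 'n \<Rightarrow> complex" where
  "K \<zeta> = S (\<lambda>k. cnj (E k (axis i \<zeta>)))"

text \<open>Homogeneity absorbs the weight 2^(d k) into the point: it turns E_k(z) into E_k(sqrt 2
  z), and \<open>E_summable\<close> holds at every point.\<close>

lemma decaying_kernel: "decaying (1/2) (\<lambda>k. cnj (E k (axis i \<zeta>)))"
proof -
  have "(norm (cnj (E k z)))\<^sup>2 / (1/2) ^ d k = (norm (E k (sqrt 2 *\<^sub>R z)))\<^sup>2" for k z
    by (simp add: E_scale norm_mult norm_power power_mult_distrib power_one_over power_mult[symmetric] mult.commute[of _ 2])
      (simp add: power_mult)
  then show ?thesis using E_summable[of "sqrt 2 *\<^sub>R axis i \<zeta>"] by (simp add: decaying_def)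
qed

lemma K_H: "K \<zeta> \<in> H"
  unfolding K_def by (rule S_H[OF decaying_kernel])

text \<open>The inner product with \<open>K \<zeta>\<close> is the series of the coefficients of f
  against the values of the \<open>E k\<close>, and \<open>expand\<close> sums it to the value of
  f.\<close>

lemma ip_K:
  assumes "f \<in> H"
  shows "ip \<alpha> f (K \<zeta>) = f (axis i \<zeta>)"
proof -
  have "(\<lambda>k. cnj (cnj (E k (axis i \<zeta>)) * cnj (ip \<alpha> f (E k)))) sums cnj (ip \<alpha> (K \<zeta>) f)"
    unfolding K_def sums_cnj by (rule ip_S_sums[OF decaying_kernel assms])
  then have "(\<lambda>k. ip \<alpha> f (E k) * E k (axis i \<zeta>)) sums ip \<alpha> f (K \<zeta>)"
    by (simp add: mult.commute flip: ip_commute)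
  then show ?thesis using expand[OF assms] sums_unique2 by blast
qed

section \<open>Point masses on the axis\<close>

definition N :: "complex \<Rightarrow> real" where
  "N \<zeta> = (\<Sum>k. (norm (E k (axis i \<zeta>)))\<^sup>2)"

lemma N_eq: "N \<zeta> = (L2norm \<alpha> (K \<zeta>))\<^sup>2"
  using L2norm_S_sums[OF decaying_kernel, of \<zeta>] by (simp add: K_def N_def sums_iff)

lemma ip_K_K: "ip \<alpha> (K \<zeta>) (K \<zeta>) = of_real (N \<zeta>)"
  unfolding N_eq by (rule ip_self)

lemma K_axis: "K \<zeta> (axis i \<zeta>) = of_real (N \<zeta>)"
  using ip_K[OF K_H] ip_K_K by simp

lemma norm_eval_le: "f \<in> H \<Longrightarrow> norm (f (axis i \<zeta>)) \<le> L2norm \<alpha> f * L2norm \<alpha> (K \<zeta>)"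
  using ip_Cauchy_Schwarz[OF H_sq H_sq[OF K_H]] ip_K by metis

text \<open>Let a be the point and w the weight there. The form w f(a) conj(g(a)) is represented by
  f |-> w f(a) \<open>K \<zeta>\<close>, an operator of rank at most one whose only possible nonzero
  eigenvalue is w \<open>N \<zeta>\<close>, the weighted kernel on the diagonal.\<close>

lemma dirac_toeplitz:
  fixes \<zeta> p
  defines "\<mu> \<equiv> return borel (axis i \<zeta>)"
  shows "toeplitz_form_bounded \<alpha> H \<mu>"
    and "in_schatten \<alpha> H p (toeplitz_op \<alpha> H \<mu>)"
    and "schatten_pow \<alpha> H p (toeplitz_op \<alpha> H \<mu>) = (N \<zeta> * exp (- (norm \<zeta>)\<^sup>2 / \<alpha>)) powr p"
proof -
  define a where "a = axis i \<zeta>"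
  define w where "w = exp (- (norm \<zeta>)\<^sup>2 / \<alpha>)"
  have w: "exp (- (norm a)\<^sup>2 / \<alpha>) = w" "w > 0" by (simp_all add: a_def w_def norm_axis_complex)
  have meas: "toeplitz_integrand \<alpha> f g \<in> borel_measurable borel" if "f \<in> H" "g \<in> H" for f g
    unfolding toeplitz_integrand_def
    by (intro borel_measurable_continuous_onI continuous_intros H_cont that) (use \<alpha> in auto)
  have form: "toeplitz_form \<alpha> \<mu> f g = f a * cnj (g a) * of_real w" if "f \<in> H" "g \<in> H" for f g
    unfolding toeplitz_form_def \<mu>_def using meas[OF that]
    by (subst integral_return) (auto simp: toeplitz_integrand_def a_def w_def norm_axis_complex)
  have Ka: "norm (f a) \<le> L2norm \<alpha> f * L2norm \<alpha> (K \<zeta>)" if "f \<in> H" for f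
    unfolding a_def by (rule norm_eval_le[OF that])
  show "toeplitz_form_bounded \<alpha> H \<mu>"
    unfolding toeplitz_form_bounded_def
  proof (intro conjI ballI exI[of _ "N \<zeta> * w"])
    fix f g assume fg: "f \<in> H" "g \<in> H"
    interpret r: prob_space \<mu> unfolding \<mu>_def by (rule prob_space_return) simp
    have [measurable]: "toeplitz_integrand \<alpha> f g \<in> borel_measurable borel" by (rule meas[OF fg])
    have "integrable \<mu> (toeplitz_integrand \<alpha> f g) \<longleftrightarrow> integrable \<mu> (\<lambda>z. toeplitz_integrand \<alpha> f g a)"
      unfolding \<mu>_def a_def by (intro integrable_cong_AE) (auto simp: AE_return)
    then show "integrable \<mu> (toeplitz_integrand \<alpha> f g)" by simp
    have "norm (f a) * norm (g a) * w \<le> (L2norm \<alpha> f * L2norm \<alpha> (K \<zeta>)) * (L2norm \<alpha> g * L2norm \<alpha> (K \<zeta>)) * w"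
      using w by (intro mult_right_mono mult_mono Ka fg) auto
    then show "norm (toeplitz_form \<alpha> \<mu> f g) \<le> N \<zeta> * w * L2norm \<alpha> f * L2norm \<alpha> g"
      using w by (simp add: form[OF fg] norm_mult N_eq power2_eq_square mult_ac)
  qed
  define T where "T f = (\<lambda>z. (of_real w * f a) * K \<zeta> z)" for f :: "complex ^ 'n \<Rightarrow> complex"
  have T: "bounded_op \<alpha> H T"
    unfolding bounded_op_def
  proof (intro conjI ballI allI exI[of _ "w * N \<zeta>"])
    fix f assume f: "f \<in> H"
    show "T f \<in> H" unfolding T_def by (intro H_scale K_H)
    have "w * norm (f a) * L2norm \<alpha> (K \<zeta>) \<le> w * (L2norm \<alpha> f * L2norm \<alpha> (K \<zeta>)) * L2norm \<alpha> (K \<zeta>)"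
      using w by (intro mult_right_mono mult_left_mono Ka f) auto
    then show "L2norm \<alpha> (T f) \<le> w * N \<zeta> * L2norm \<alpha> f"
      using w unfolding T_def L2norm_scale by (simp add: norm_mult N_eq power2_eq_square mult_ac)
  next
    fix f g :: "complex ^ 'n \<Rightarrow> complex"
    show "T (f + g) = T f + T g"
      by (simp add: T_def fun_eq_iff distrib_left distrib_right)
  next
    fix c f
    show "T (\<lambda>z. c * f z) = (\<lambda>z. c * T f z)"
      by (simp only: T_def mult.assoc mult.left_commute)
  qed
  have cpt: "compact_op \<alpha> H T"
    unfolding compact_op_def
  proof (intro conjI allI impI T)
    fix f :: "nat \<Rightarrow> complex ^ 'n \<Rightarrow> complex" and B
    assume f: "\<forall>k. f k \<in> H \<and> L2norm \<alpha> (f k) \<le> B"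
    \<comment> \<open>All images are multiples of \<open>K \<zeta>\<close>, so compactness reduces
      to the Bolzano-Weierstrass theorem for these scalars.\<close>
    define c where "c k = of_real w * f k a" for k
    have "norm (c k) \<le> w * (B * L2norm \<alpha> (K \<zeta>))" for k
      using w order_trans[OF Ka[of "f k"] mult_right_mono[of "L2norm \<alpha> (f k)" B "L2norm \<alpha> (K \<zeta>)"]] f
      by (simp add: c_def norm_mult)
    then have "bounded (range c)" unfolding bounded_iff by auto
    then obtain l r where r: "strict_mono r" "(c \<circ> r) \<longlonglongrightarrow> l"
      using bounded_imp_convergent_subsequence by blast
    have "L2norm \<alpha> (T (f (r k)) - (\<lambda>z. l * K \<zeta> z)) = norm (c (r k) - l) * L2norm \<alpha> (K \<zeta>)" for k
    proof -
      have "T (f (r k)) - (\<lambda>z. l * K \<zeta> z) = (\<lambda>z. (c (r k) - l) * K \<zeta> z)"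
        by (simp add: fun_eq_iff T_def c_def left_diff_distrib)
      then show ?thesis by (simp add: L2norm_scale)
    qed
    moreover have "(\<lambda>k. norm (c (r k) - l) * L2norm \<alpha> (K \<zeta>)) \<longlonglongrightarrow> norm (l - l) * L2norm \<alpha> (K \<zeta>)"
      using r(2) by (intro tendsto_intros) (simp add: o_def)
    ultimately have "(\<lambda>k. L2norm \<alpha> (T (f (r k)) - (\<lambda>z. l * K \<zeta> z))) \<longlonglongrightarrow> 0"
      by simp
    then show "\<exists>g\<in>H. \<exists>r. strict_mono r \<and> (\<lambda>k. L2norm \<alpha> (T (f (r k)) - g)) \<longlonglongrightarrow> 0"
      using r(1) K_H H_scale by blast
  qed
  define s where "s k = (if k = 0 then N \<zeta> * w else 0)" for k :: nat
  have N0: "N \<zeta> \<ge> 0" unfolding N_eq by simp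
  have sk: "s k > 0 \<longleftrightarrow> k = 0 \<and> N \<zeta> > 0" for k using w N0 by (auto simp: s_def zero_less_mult_iff)
  define F where "F k = (\<lambda>z. of_real (1 / sqrt (N \<zeta>)) * K \<zeta> z)" for k :: nat
  \<comment> \<open>The zeros after the first entry contribute nothing because
    \<open>0 powr p\<close> is 0.\<close>
  have sums: "(\<lambda>k. s k powr p) sums ((N \<zeta> * w) powr p)"
  proof -
    have "(\<lambda>k. s k powr p) = (\<lambda>k. if k = 0 then (N \<zeta> * w) powr p else 0)"
      by (auto simp: s_def)
    then show ?thesis using sums_single[of 0 "\<lambda>_. (N \<zeta> * w) powr p"] by simp
  qed
  have *: "ip \<alpha> (T f) g = toeplitz_form \<alpha> \<mu> f g" if "f \<in> H" "g \<in> H" for f g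
    unfolding T_def ip_scale_left form[OF that] ip_commute[of \<alpha> "K \<zeta>" g] ip_K[OF that(2)] a_def by simp
  have s: "decseq s" using N0 w by (auto simp: decseq_def s_def)
  have s0: "0 \<le> s k" for k using N0 w by (simp add: s_def)
  have fin: "finite {k. s k = t}" if "t > 0" for t
  proof (rule finite_subset[of _ "{0}"])
    show "{k. s k = t} \<subseteq> {0}"
    proof
      fix k assume "k \<in> {k. s k = t}"
      then have "s k > 0" using that by simp
      then show "k \<in> {0}" unfolding sk by simp
    qed
  qed simp
  have F_H: "F k \<in> H" for k unfolding F_def by (intro H_scale K_H)
  have TF: "T (F k) = (\<lambda>z. complex_of_real (s k) * F k z)" if "s k > 0" for k
    using that unfolding sk by (auto simp: T_def F_def s_def a_def K_axis)
  have orth: "ip \<alpha> (F j) (F k) = (if j = k then 1 else 0)" if "s j > 0" "s k > 0" for j k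
    using that unfolding sk F_def ip_scale_left ip_scale_right ip_K_K
    by (auto simp: field_simps simp flip: of_real_mult)
  \<comment> \<open>If \<open>N \<zeta>\<close> is zero, \<open>s\<close> has no positive entry;
    then the kernel has norm zero, every f in H vanishes at the point, and T is zero.\<close>
  have ker: "T f = (\<lambda>z. 0)" if f: "f \<in> H" "\<And>k. s k > 0 \<Longrightarrow> ip \<alpha> f (F k) = 0" for f
  proof (cases "N \<zeta> > 0")
    case True
    then show ?thesis
      using f(2)[of 0] unfolding sk F_def ip_scale_right ip_K[OF f(1)] by (simp add: T_def a_def)
  next
    case False
    then have "L2norm \<alpha> (K \<zeta>) = 0" using N0 by (simp add: N_eq)
    then show ?thesis using Ka[OF f(1)] by (simp add: T_def)
  qed
  show "in_schatten \<alpha> H p (toeplitz_op \<alpha> H \<mu>)"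
    by (rule toeplitz_schatten(1)[of T \<mu> s F, OF cpt * s s0 fin F_H TF orth ker sums_summable[OF sums]])
  have "schatten_pow \<alpha> H p (toeplitz_op \<alpha> H \<mu>) = (\<Sum>k. s k powr p)"
    by (rule toeplitz_schatten(2)[of T \<mu> s F, OF cpt * s s0 fin F_H TF orth ker sums_summable[OF sums]])
  then show "schatten_pow \<alpha> H p (toeplitz_op \<alpha> H \<mu>) = (N \<zeta> * exp (- (norm \<zeta>)\<^sup>2 / \<alpha>)) powr p"
    using sums by (simp add: sums_iff w_def)
qed

section \<open>Dilations along the axis and Gaussian measures on it\<close>

definition D :: "real \<Rightarrow> (complex ^ 'n \<Rightarrow> complex) \<Rightarrow> complex ^ 'n \<Rightarrow> complex" where
  "D q f z = f (axis i (of_real q * z $ i))"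

context
  fixes q :: real
  assumes q: "0 < q" "q < 1"
begin

lemma decaying_D: "f \<in> H \<Longrightarrow> decaying q (\<lambda>k. of_real q ^ d k * ip \<alpha> f (E k))"
  by (rule decaying_bounded[OF q coeff_le])

text \<open>By homogeneity, the expansion of f at q \<open>z $ i\<close> is the expansion with k-th
  coefficient multiplied by \<open>q ^ d k\<close>: the dilation is diagonal in the
  \<open>E k\<close>.\<close>

lemma D_eq:
  assumes "f \<in> H"
  shows "D q f = S (\<lambda>k. of_real q ^ d k * ip \<alpha> f (E k))"
proof
  fix z :: "complex ^ 'n"
  have "axis i (of_real q * z $ i) = q *\<^sub>R axis i (z $ i)"
    by (rule axis_of_real_mult)
  then have "E k (axis i (of_real q * z $ i)) = of_real q ^ d k * E k z" for k
    by (simp only: E_scale E_axis)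
  then have "(\<lambda>k. ip \<alpha> f (E k) * (of_real q ^ d k * E k z)) sums D q f z"
    using expand[OF assms, of "of_real q * z $ i"] by (simp add: D_def)
  then show "D q f z = S (\<lambda>k. of_real q ^ d k * ip \<alpha> f (E k)) z"
    by (simp add: S_def sums_iff mult_ac)
qed

lemma D_H: "f \<in> H \<Longrightarrow> D q f \<in> H"
  using S_H[OF decaying_D] by (simp add: D_eq)

lemma ip_D_E: "f \<in> H \<Longrightarrow> ip \<alpha> (D q f) (E k) = of_real q ^ d k * ip \<alpha> f (E k)"
  by (simp add: D_eq ip_S_E[OF decaying_D])

lemma ip_D_sums: "f \<in> H \<Longrightarrow> g \<in> H \<Longrightarrow>
    (\<lambda>k. of_real q ^ d k * ip \<alpha> f (E k) * cnj (ip \<alpha> g (E k))) sums ip \<alpha> (D q f) g"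
  using ip_S_sums[OF decaying_D] by (simp add: D_eq)

lemma D_E: "D q (E k) = (\<lambda>z. of_real (q ^ d k) * E k z)"
proof
  fix z :: "complex ^ 'n"
  have "axis i (of_real q * z $ i) = q *\<^sub>R axis i (z $ i)"
    by (rule axis_of_real_mult)
  then show "D q (E k) z = of_real (q ^ d k) * E k z"
    by (simp add: D_def E_scale E_axis)
qed

text \<open>Each coefficient is at most the norm of f; the resulting constant is the Hilbert-Schmidt
  norm of \<open>D q\<close>.\<close>

lemma L2norm_D_le:
  assumes "f \<in> H"
  shows "L2norm \<alpha> (D q f) \<le> sqrt (\<Sum>k. (q\<^sup>2) ^ d k) * L2norm \<alpha> f"
proof -
  have q2: "0 < q\<^sup>2" "q\<^sup>2 < 1" using q by (auto simp: abs_square_less_1)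
  have s: "(\<lambda>k. (norm (of_real q ^ d k * ip \<alpha> f (E k)))\<^sup>2) sums (L2norm \<alpha> (D q f))\<^sup>2"
    using L2norm_S_sums[OF decaying_D[OF assms]] by (simp add: D_eq[OF assms])
  have "(L2norm \<alpha> (D q f))\<^sup>2 = (\<Sum>k. (norm (of_real q ^ d k * ip \<alpha> f (E k)))\<^sup>2)"
    using s by (simp add: sums_iff)
  also have "\<dots> \<le> (\<Sum>k. (q\<^sup>2) ^ d k * (L2norm \<alpha> f)\<^sup>2)"
  proof (intro suminf_le sums_summable[OF s] summable_mult2 d_summable[OF q2])
    fix k
    have "(norm (of_real q ^ d k * ip \<alpha> f (E k)))\<^sup>2 = (q\<^sup>2) ^ d k * (norm (ip \<alpha> f (E k)))\<^sup>2"
      using q by (simp add: norm_mult norm_power power_mult_distrib power_mult[symmetric] mult.commute)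
    also have "\<dots> \<le> (q\<^sup>2) ^ d k * (L2norm \<alpha> f)\<^sup>2"
      by (intro mult_left_mono power_mono coeff_le assms) auto
    finally show "(norm (of_real q ^ d k * ip \<alpha> f (E k)))\<^sup>2 \<le> (q\<^sup>2) ^ d k * (L2norm \<alpha> f)\<^sup>2" .
  qed
  also have "\<dots> = (\<Sum>k. (q\<^sup>2) ^ d k) * (L2norm \<alpha> f)\<^sup>2"
    by (rule suminf_mult2[symmetric, OF d_summable[OF q2]])
  also have "\<dots> = (sqrt (\<Sum>k. (q\<^sup>2) ^ d k) * L2norm \<alpha> f)\<^sup>2"
    by (simp add: power_mult_distrib suminf_nonneg d_summable[OF q2])
  finally show ?thesis
    by (rule power2_le_imp_le) (simp add: suminf_nonneg d_summable[OF q2])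
qed

lemma bounded_op_D: "bounded_op \<alpha> H (D q)"
  unfolding bounded_op_def
  by (intro conjI ballI allI exI[of _ "sqrt (\<Sum>k. (q\<^sup>2) ^ d k)"] D_H L2norm_D_le)
    (auto simp: D_def fun_eq_iff)

lemma compact_op_D: "compact_op \<alpha> H (D q)"
  unfolding compact_op_def
proof (intro conjI allI impI bounded_op_D)
  fix f :: "nat \<Rightarrow> complex ^ 'n \<Rightarrow> complex" and B
  assume f: "\<forall>k. f k \<in> H \<and> L2norm \<alpha> (f k) \<le> B"
  then have fH: "f n \<in> H" for n by simp
  define c where "c n k = ip \<alpha> (f n) (E k)" for n k
  have c: "norm (c n k) \<le> B" for n k
    unfolding c_def using coeff_le[OF fH, of n k] f by (meson order_trans)
  \<comment> \<open>A diagonal subsequence makes every coefficient converge. The factor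
    \<open>q ^ d k\<close> then turns the merely bounded limits into the coefficients of an element
    of H.\<close>
  obtain r where r: "strict_mono r" "\<And>k. \<exists>l. (\<lambda>n. c (r n) k) \<longlonglongrightarrow> l"
    using function_convergent_subsequence[of UNIV c B] c by auto
  then obtain l where l: "\<And>k. (\<lambda>n. c (r n) k) \<longlonglongrightarrow> l k" by metis
  have lB: "norm (l k) \<le> B" for k
    by (rule LIMSEQ_le_const2[OF tendsto_norm[OF l]]) (use c in auto)
  define g where "g = S (\<lambda>k. of_real q ^ d k * l k)"
  have gH: "g \<in> H" unfolding g_def by (rule S_H[OF decaying_bounded[OF q lB]])
  have q2: "0 < q\<^sup>2" "q\<^sup>2 < 1" using q by (auto simp: abs_square_less_1)
  have diff: "(L2norm \<alpha> (D q (f (r n)) - g))\<^sup>2 = (\<Sum>k. (norm (of_real q ^ d k * (c (r n) k - l k)))\<^sup>2)" for n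
  proof -
    have gd: "decaying q (\<lambda>k. of_real q ^ d k * (c (r n) k - l k))"
      by (rule decaying_bounded[OF q, of _ "B + B"])
        (rule order_trans[OF norm_triangle_ineq4 add_mono[OF c lB]])
    have "D q (f (r n)) - g = S (\<lambda>k. of_real q ^ d k * (c (r n) k - l k))"
    proof
      fix z
      have "D q (f (r n)) z - g z = (\<Sum>k. of_real q ^ d k * c (r n) k * E k z - of_real q ^ d k * l k * E k z)"
        unfolding D_eq[OF fH] g_def S_def c_def
        by (rule suminf_diff[OF summable_norm_cancel[OF decaying_summable(1)[OF decaying_D[OF fH]]]
              summable_norm_cancel[OF decaying_summable(1)[OF decaying_bounded[OF q lB]]]])
      then show "(D q (f (r n)) - g) z = S (\<lambda>k. of_real q ^ d k * (c (r n) k - l k)) z"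
        by (simp add: S_def left_diff_distrib right_diff_distrib mult.assoc)
    qed
    with L2norm_S_sums[OF gd] show ?thesis by (simp add: sums_iff)
  qed
  \<comment> \<open>Tannery's theorem, that is dominated convergence for series, upgrades
    coefficientwise convergence to convergence in norm.\<close>
  have "((\<lambda>n. \<Sum>k. (norm (of_real q ^ d k * (c (r n) k - l k)))\<^sup>2) \<longlongrightarrow> (\<Sum>k. 0)) sequentially"
  proof (rule tannerys_theorem[THEN conjunct2, THEN conjunct2])
    show "((\<lambda>n. (norm (of_real q ^ d k * (c (r n) k - l k)))\<^sup>2) \<longlongrightarrow> 0) sequentially" for k
    proof -
      have "((\<lambda>n. (norm (of_real q ^ d k * (c (r n) k - l k)))\<^sup>2) \<longlongrightarrow> (norm (of_real q ^ d k * (l k - l k)))\<^sup>2) sequentially"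
        by (intro tendsto_intros l)
      then show ?thesis by simp
    qed
    show "summable (\<lambda>k. (q\<^sup>2) ^ d k * (B + B)\<^sup>2)"
      by (intro summable_mult2 d_summable q2)
    show "\<forall>\<^sub>F (k, n) in sequentially \<times>\<^sub>F sequentially.
        norm ((norm (of_real q ^ d k * (c (r n) k - l k)))\<^sup>2) \<le> (q\<^sup>2) ^ d k * (B + B)\<^sup>2"
    proof (intro always_eventually allI, clarify)
      fix k n
      have "norm (c (r n) k - l k) \<le> B + B"
        using norm_triangle_ineq4[of "c (r n) k" "l k"] c[of "r n" k] lB[of k] by linarith
      then have "(norm (c (r n) k - l k))\<^sup>2 \<le> (B + B)\<^sup>2"
        by (rule power_mono) simp
      then have "(q\<^sup>2) ^ d k * (norm (c (r n) k - l k))\<^sup>2 \<le> (q\<^sup>2) ^ d k * (B + B)\<^sup>2"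
        by (rule mult_left_mono) simp
      then show "norm ((norm (of_real q ^ d k * (c (r n) k - l k)))\<^sup>2) \<le> (q\<^sup>2) ^ d k * (B + B)\<^sup>2"
        using q by (simp add: norm_mult norm_power power_mult_distrib power_mult[symmetric] mult.commute)
    qed
  qed simp
  then have "(\<lambda>n. (L2norm \<alpha> (D q (f (r n)) - g))\<^sup>2) \<longlonglongrightarrow> 0"
    by (simp add: diff)
  then have "(\<lambda>n. sqrt ((L2norm \<alpha> (D q (f (r n)) - g))\<^sup>2)) \<longlonglongrightarrow> sqrt 0"
    by (rule tendsto_real_sqrt)
  then have "(\<lambda>n. L2norm \<alpha> (D q (f (r n)) - g)) \<longlonglongrightarrow> 0"
    by simp
  then show "\<exists>g\<in>H. \<exists>r. strict_mono r \<and> (\<lambda>k. L2norm \<alpha> (D q (f (r k)) - g)) \<longlonglongrightarrow> 0"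
    using gH r(1) by blast
qed

end

text \<open>For q = sqrt r the form is the inner product of \<open>D q f\<close> and
  \<open>D q g\<close>. In coefficients the two factors \<open>q ^ d k\<close> multiply to
  \<open>r ^ d k\<close>, so the Toeplitz operator is \<open>D r\<close>, with singular values
  \<open>r ^ d k\<close>.\<close>

lemma axis_gauss_toeplitz:
  fixes r p :: real
  assumes r: "0 < r" "r < 1" and p: "p > 0"
  defines "\<mu> \<equiv> axis_gauss \<alpha> i (sqrt r)"
  shows "toeplitz_form_bounded \<alpha> H \<mu>"
    and "in_schatten \<alpha> H p (toeplitz_op \<alpha> H \<mu>)"
    and "schatten_pow \<alpha> H p (toeplitz_op \<alpha> H \<mu>) = (\<Sum>k. (r powr p) ^ d k)"
proof -
  define q where "q = sqrt r"
  have q: "0 < q" "q < 1" "q\<^sup>2 = r" using r by (auto simp: q_def)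
  define \<pi> where "\<pi> z = axis i (of_real q * z $ i)" for z :: "complex ^ 'n"
  have [measurable]: "\<pi> \<in> borel_measurable borel"
    unfolding \<pi>_def by (intro borel_measurable_continuous_onI continuous_intros)
  have \<mu>: "\<mu> = density (distr (gauss \<alpha>) borel \<pi>) (\<lambda>z. ennreal (exp ((norm z)\<^sup>2 / \<alpha>)))"
    unfolding \<mu>_def axis_gauss_def \<pi>_def q_def by simp
  have canc: "exp ((norm z)\<^sup>2 / \<alpha>) *\<^sub>R toeplitz_integrand \<alpha> f g z = f z * cnj (g z)" for f g and z :: "complex ^ 'n"
  proof -
    have "exp ((norm z)\<^sup>2 / \<alpha>) * exp (- (norm z)\<^sup>2 / \<alpha>) = 1" by (simp add: exp_add[symmetric])
    then have "complex_of_real (exp ((norm z)\<^sup>2 / \<alpha>)) * complex_of_real (exp (- (norm z)\<^sup>2 / \<alpha>)) = 1"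
      by (simp only: of_real_mult[symmetric] of_real_1)
    then show ?thesis
      unfolding toeplitz_integrand_def scaleR_conv_of_real
      by (metis mult.assoc mult.commute mult.right_neutral)
  qed
  have int: "integrable \<mu> (toeplitz_integrand \<alpha> f g)"
    and form: "toeplitz_form \<alpha> \<mu> f g = ip \<alpha> (D q f) (D q g)" if "f \<in> H" "g \<in> H" for f g
  proof -
    have [measurable]: "f \<in> borel_measurable borel" "g \<in> borel_measurable borel"
      using that H_sq by (auto simp: sq_integrable_def)
    have [measurable]: "toeplitz_integrand \<alpha> f g \<in> borel_measurable borel"
      unfolding toeplitz_integrand_def
      by (intro borel_measurable_continuous_onI continuous_intros H_cont that) (use \<alpha> in auto)
    have "integrable (gauss \<alpha>) (\<lambda>z. D q f z * cnj (D q g z))"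
      by (intro sq_integrable_mult H_sq D_H q that)
    then show "integrable \<mu> (toeplitz_integrand \<alpha> f g)"
      unfolding \<mu> by (simp add: integrable_density integrable_distr_eq canc D_def \<pi>_def)
    show "toeplitz_form \<alpha> \<mu> f g = ip \<alpha> (D q f) (D q g)"
      unfolding \<mu> toeplitz_form_def
      by (simp add: integral_density integral_distr canc D_def \<pi>_def ip_def)
  qed
  show "toeplitz_form_bounded \<alpha> H \<mu>"
    unfolding toeplitz_form_bounded_def
  proof (intro conjI ballI exI[of _ "(\<Sum>k. (q\<^sup>2) ^ d k)"] int)
    fix f g assume fg: "f \<in> H" "g \<in> H"
    let ?C = "\<Sum>k. (q\<^sup>2) ^ d k"
    have C: "?C \<ge> 0" using d_summable[OF r] r q by (intro suminf_nonneg) auto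
    have "norm (toeplitz_form \<alpha> \<mu> f g) \<le> L2norm \<alpha> (D q f) * L2norm \<alpha> (D q g)"
      unfolding form[OF fg] by (intro ip_Cauchy_Schwarz H_sq D_H q fg)
    also have "\<dots> \<le> (sqrt ?C * L2norm \<alpha> f) * (sqrt ?C * L2norm \<alpha> g)"
      using C by (intro mult_mono L2norm_D_le q fg) auto
    also have "\<dots> = ?C * L2norm \<alpha> f * L2norm \<alpha> g"
      using C by (simp add: mult_ac)
    finally show "norm (toeplitz_form \<alpha> \<mu> f g) \<le> ?C * L2norm \<alpha> f * L2norm \<alpha> g" .
  qed
  \<comment> \<open>One factor q^d comes from each argument; this is the reason for the square root
    in the measure.\<close>
  have form': "ip \<alpha> (D r f) g = toeplitz_form \<alpha> \<mu> f g" if fg: "f \<in> H" "g \<in> H" for f g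
  proof -
    have "(\<lambda>k. of_real q ^ d k * ip \<alpha> f (E k) * cnj (of_real q ^ d k * ip \<alpha> g (E k))) sums ip \<alpha> (D q f) (D q g)"
      using ip_D_sums[OF q(1,2) fg(1) D_H[OF q(1,2) fg(2)]] by (simp add: ip_D_E[OF q(1,2) fg(2)])
    moreover have "of_real q ^ d k * ip \<alpha> f (E k) * cnj (of_real q ^ d k * ip \<alpha> g (E k))
      = of_real r ^ d k * ip \<alpha> f (E k) * cnj (ip \<alpha> g (E k))" for k
      unfolding q(3)[symmetric] by (simp add: power2_eq_square power_mult_distrib)
    ultimately have "(\<lambda>k. of_real r ^ d k * ip \<alpha> f (E k) * cnj (ip \<alpha> g (E k))) sums ip \<alpha> (D q f) (D q g)"
      by (simp only:)
    then show ?thesis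
      unfolding form[OF fg] using ip_D_sums[OF r fg] sums_unique2 by blast
  qed
  define s where "s k = r ^ d k" for k
  have s: "decseq s"
    using r d_mono by (auto simp: s_def decseq_def mono_def intro: power_decreasing)
  have s0: "0 < s k" for k using r by (simp add: s_def)
  have fin: "finite {k. s k = t}" if "t > 0" for t
  proof -
    have "s \<longlonglongrightarrow> 0" unfolding s_def by (rule summable_LIMSEQ_zero[OF d_summable[OF r]])
    then have "eventually (\<lambda>k. s k < t) sequentially" using that by (rule order_tendstoD)
    then obtain n where "\<And>k. k \<ge> n \<Longrightarrow> s k < t" by (auto simp: eventually_sequentially)
    then have "{k. s k = t} \<subseteq> {..<n}" by (metis (mono_tags, lifting) less_irrefl lessThan_iff mem_Collect_eq not_le subsetI)
    then show ?thesis by (rule finite_subset) simp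
  qed
  have DE: "D r (E k) = (\<lambda>z. complex_of_real (s k) * E k z)" for k
    unfolding s_def by (rule D_E[OF r])
  \<comment> \<open>All \<open>s k\<close> are positive, so all coefficients of f vanish and with
    them the series for \<open>D r f\<close>.\<close>
  have ker: "D r f = (\<lambda>z. 0)" if "f \<in> H" "\<And>k. s k > 0 \<Longrightarrow> ip \<alpha> f (E k) = 0" for f
    using that s0 by (auto simp: D_eq[OF r that(1)] S_def)
  have pw: "s k powr p = (r powr p) ^ d k" for k
    using r by (simp add: s_def powr_realpow[symmetric] powr_powr mult.commute)
  have rp: "0 < r powr p" "r powr p < 1" using r p powr_less_mono2[of p r 1] by auto
  then have sums: "summable (\<lambda>k. s k powr p)"
    unfolding pw by (intro d_summable)
  note res = toeplitz_schatten[of "D r" \<mu> s E, OF compact_op_D[OF r] form' s less_imp_le[OF s0] fin E_H DE E_orth ker sums]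
  show "in_schatten \<alpha> H p (toeplitz_op \<alpha> H \<mu>)" by (rule res(1))
  show "schatten_pow \<alpha> H p (toeplitz_op \<alpha> H \<mu>) = (\<Sum>k. (r powr p) ^ d k)"
    using res(2) unfolding pw .
qed

end

section \<open>The two spaces\<close>

text \<open>The denominator is the square root of the moment found in \<open>gauss_moment\<close>,
  hence the norm of the monomial.\<close>

definition epow :: "real \<Rightarrow> 'n \<Rightarrow> nat \<Rightarrow> complex ^ 'n \<Rightarrow> complex" where
  "epow \<alpha> i k z = (z $ i) ^ k / of_real (sqrt (fact k * \<alpha> ^ k))"

lemma epow_axis: "epow \<alpha> i k (axis i (z $ i)) = epow \<alpha> i k z"
  by (simp add: epow_def)

lemma epow_scale: "epow \<alpha> i k (t *\<^sub>R z) = of_real t ^ k * epow \<alpha> i k z"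
  by (simp add: epow_def scaleR_conv_of_real[where 'a = complex] power_mult_distrib)

lemma norm_epow_sq:
  assumes "\<alpha> > 0"
  shows "(norm (epow \<alpha> i k z))\<^sup>2 = ((norm (z $ i))\<^sup>2 / \<alpha>) ^ k / fact k"
  using assms
  by (simp add: epow_def norm_divide norm_power power_divide power_mult[symmetric] mult.commute)

lemma epow_sums:
  assumes "\<alpha> > 0"
  shows "(\<lambda>k. (norm (epow \<alpha> i k z))\<^sup>2) sums exp ((norm (z $ i))\<^sup>2 / \<alpha>)"
  unfolding norm_epow_sq[OF assms]
  using exp_converges[of "(norm (z $ i))\<^sup>2 / \<alpha>"] by (simp add: divide_inverse mult.commute)

lemma continuous_on_epow: "\<alpha> > 0 \<Longrightarrow> continuous_on UNIV (epow \<alpha> i k)"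
  unfolding epow_def by (intro continuous_intros) auto

lemma sq_integrable_epow:
  fixes i :: "'n::finite"
  assumes "\<alpha> > 0"
  shows "sq_integrable \<alpha> (epow \<alpha> i k)"
  unfolding sq_integrable_def
proof
  show m[measurable]: "epow \<alpha> i k \<in> borel_measurable borel"
    by (rule borel_measurable_continuous_onI) (rule continuous_on_epow[OF assms])
  show "integrable (gauss \<alpha>) (\<lambda>z. (norm (epow \<alpha> i k z))\<^sup>2)"
  proof (rule integrable_gauss_exp_bound[OF _ assms, of _ "(fact (2 * k)) / (fact k * \<alpha> ^ k)" 1])
    fix z :: "complex ^ 'n"
    have "norm (z $ i) ^ (2 * k) \<le> fact (2 * k) * exp (norm (z $ i))"
      by (intro power_le_fact_exp) simp
    also have "\<dots> \<le> fact (2 * k) * exp (1 * norm z)"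
      using Finite_Cartesian_Product.norm_nth_le[of z i] by simp
    finally have "norm (z $ i) ^ (2 * k) / (fact k * \<alpha> ^ k) \<le> fact (2 * k) * exp (1 * norm z) / (fact k * \<alpha> ^ k)"
      using assms by (intro divide_right_mono) auto
    moreover have "(norm (epow \<alpha> i k z))\<^sup>2 = norm (z $ i) ^ (2 * k) / (fact k * \<alpha> ^ k)"
      using assms by (simp add: norm_epow_sq power_divide power_mult[symmetric])
    ultimately have "(norm (epow \<alpha> i k z))\<^sup>2 \<le> fact (2 * k) * exp (1 * norm z) / (fact k * \<alpha> ^ k)"
      by (simp only:)
    then show "norm ((norm (epow \<alpha> i k z))\<^sup>2) \<le> fact (2 * k) / (fact k * \<alpha> ^ k) * exp (1 * norm z)"
      by simp
  qed measurable
qed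

lemma sq_integrable_cnj: "sq_integrable \<alpha> f \<Longrightarrow> sq_integrable \<alpha> (\<lambda>z. cnj (f z))"
  by (auto simp: sq_integrable_def intro: borel_measurable_cnj)

lemma sqrt_mult_cancel: "x > 0 \<Longrightarrow> y * complex_of_real x / complex_of_real (sqrt x) = y * complex_of_real (sqrt x)"
  by (simp add: field_simps flip: of_real_mult)

context
  fixes \<alpha> :: real and i :: "'n::finite" and f :: "complex ^ 'n \<Rightarrow> complex" and g h :: "complex \<Rightarrow> complex"
  assumes \<alpha>: "\<alpha> > 0" and f: "line_harmonic f" "continuous_on UNIV f" "sq_integrable \<alpha> f"
    and gh: "g holomorphic_on UNIV" "h holomorphic_on UNIV" "h 0 = 0"
    and fgh: "\<And>\<zeta>. f (axis i \<zeta>) = g \<zeta> + cnj (h \<zeta>)"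
begin

text \<open>\<open>gauss_restrict_axis\<close> passes to the values on the axis, rotation isolates
  the k-th Taylor coefficient, and the moment divided by its square root remains.\<close>

lemma ip_epow: "ip \<alpha> f (epow \<alpha> i k) = (deriv ^^ k) g 0 / fact k * of_real (sqrt (fact k * \<alpha> ^ k))"
proof -
  define w where "w = fact k * \<alpha> ^ k"
  have w: "w > 0" using \<alpha> by (simp add: w_def)
  have "integrable (gauss \<alpha>) (\<lambda>z. f z * cnj (epow \<alpha> i k z) * of_real (sqrt w))"
    by (intro Bochner_Integration.integrable_mult_left sq_integrable_mult f sq_integrable_epow \<alpha>)
  moreover have e: "f z * cnj (epow \<alpha> i k z) * of_real (sqrt w) = f z * cnj (z $ i) ^ k" for z
    using w by (simp add: epow_def w_def[symmetric])
  ultimately have int: "integrable (gauss \<alpha>) (\<lambda>z. f z * cnj (z $ i) ^ k)"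
    by simp
  have cont: "continuous_on UNIV (\<lambda>w. cnj w ^ k)" by (intro continuous_intros)
  note R = gauss_restrict_axis[OF \<alpha> f(1,2) cont int, unfolded fgh]
  have "ip \<alpha> f (epow \<alpha> i k) = (\<integral>z. f z * cnj (z $ i) ^ k / of_real (sqrt w) \<partial>gauss \<alpha>)"
    unfolding ip_def by (simp add: epow_def w_def)
  also have "\<dots> = (\<integral>z. f z * cnj (z $ i) ^ k \<partial>gauss \<alpha>) / of_real (sqrt w)"
    by simp
  also have "(\<integral>z. f z * cnj (z $ i) ^ k \<partial>gauss \<alpha>) = (deriv ^^ k) g 0 / fact k * of_real w"
    unfolding R(1) gauss_rotate_cnj_power[OF \<alpha> gh R(2)] gauss_moment[OF \<alpha>] w_def ..
  finally show ?thesis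
    unfolding w_def[symmetric] sqrt_mult_cancel[OF w] .
qed

lemma ip_cnj_epow:
  assumes k: "k > 0"
  shows "ip \<alpha> f (\<lambda>z. cnj (epow \<alpha> i k z)) = cnj ((deriv ^^ k) h 0 / fact k) * of_real (sqrt (fact k * \<alpha> ^ k))"
proof -
  define w where "w = fact k * \<alpha> ^ k"
  have w: "w > 0" using \<alpha> by (simp add: w_def)
  have "integrable (gauss \<alpha>) (\<lambda>z. f z * cnj (cnj (epow \<alpha> i k z)) * of_real (sqrt w))"
    by (intro Bochner_Integration.integrable_mult_left sq_integrable_mult f sq_integrable_cnj sq_integrable_epow \<alpha>)
  moreover have e: "f z * cnj (cnj (epow \<alpha> i k z)) * of_real (sqrt w) = f z * (z $ i) ^ k" for z
    using w by (simp add: epow_def w_def[symmetric])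
  ultimately have int: "integrable (gauss \<alpha>) (\<lambda>z. f z * (z $ i) ^ k)"
    by (simp only: e)
  have cont: "continuous_on UNIV (\<lambda>w::complex. w ^ k)" by (intro continuous_intros)
  note R = gauss_restrict_axis[OF \<alpha> f(1,2) cont int, unfolded fgh]
  have "ip \<alpha> f (\<lambda>z. cnj (epow \<alpha> i k z)) = (\<integral>z. f z * (z $ i) ^ k / of_real (sqrt w) \<partial>gauss \<alpha>)"
    unfolding ip_def by (simp add: epow_def w_def)
  also have "\<dots> = (\<integral>z. f z * (z $ i) ^ k \<partial>gauss \<alpha>) / of_real (sqrt w)"
    by simp
  also have "(\<integral>z. f z * (z $ i) ^ k \<partial>gauss \<alpha>) = cnj ((deriv ^^ k) h 0 / fact k) * of_real w"
    unfolding R(1) gauss_rotate_power[OF \<alpha> gh(1,2) k R(2)] gauss_moment[OF \<alpha>] w_def ..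
  finally show ?thesis
    unfolding w_def[symmetric] sqrt_mult_cancel[OF w] .
qed

text \<open>The normalizing factors cancel and leave the Taylor series of g about 0.\<close>

lemma epow_expand: "(\<lambda>k. ip \<alpha> f (epow \<alpha> i k) * epow \<alpha> i k (axis i \<zeta>)) sums g \<zeta>"
proof -
  have "(\<lambda>k. (deriv ^^ k) g 0 / fact k * (\<zeta> - 0) ^ k) sums g \<zeta>"
    by (rule holomorphic_power_series[of g 0 "norm \<zeta> + 1"])
      (use gh in \<open>auto intro: holomorphic_on_subset\<close>)
  moreover have "ip \<alpha> f (epow \<alpha> i k) * epow \<alpha> i k (axis i \<zeta>) = (deriv ^^ k) g 0 / fact k * (\<zeta> - 0) ^ k" for k
    using \<alpha> by (simp add: ip_epow epow_def axis_def)
  ultimately show ?thesis by simp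
qed

lemma cnj_epow_expand:
  "(\<lambda>k. ip \<alpha> f (\<lambda>z. cnj (epow \<alpha> i (Suc k) z)) * cnj (epow \<alpha> i (Suc k) (axis i \<zeta>))) sums cnj (h \<zeta>)"
proof -
  have "(\<lambda>k. (deriv ^^ k) h 0 / fact k * (\<zeta> - 0) ^ k) sums h \<zeta>"
    by (rule holomorphic_power_series[of h 0 "norm \<zeta> + 1"])
      (use gh in \<open>auto intro: holomorphic_on_subset\<close>)
  \<comment> \<open>The series may start at index 1 because \<open>h 0 = 0\<close>; the constant
    term of f belongs to g.\<close>
  then have "(\<lambda>k. (deriv ^^ Suc k) h 0 / fact (Suc k) * (\<zeta> - 0) ^ Suc k) sums h \<zeta>"
    by (subst sums_Suc_iff) (simp add: gh(3))
  then have "(\<lambda>k. cnj ((deriv ^^ Suc k) h 0 / fact (Suc k) * (\<zeta> - 0) ^ Suc k)) sums cnj (h \<zeta>)"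
    by (subst sums_cnj)
  moreover have "ip \<alpha> f (\<lambda>z. cnj (epow \<alpha> i (Suc k) z)) * cnj (epow \<alpha> i (Suc k) (axis i \<zeta>))
    = cnj ((deriv ^^ Suc k) h 0 / fact (Suc k) * (\<zeta> - 0) ^ Suc k)" for k
    unfolding ip_cnj_epow[OF zero_less_Suc]
    using \<alpha> by (simp add: epow_def axis_def del: fact_Suc funpow.simps power_Suc)
  ultimately show ?thesis by (simp only:)
qed

end

text \<open>With the coefficient formula \<open>ip_epow\<close>, applied to a monomial itself, this
  gives orthonormality.\<close>

lemma taylor_coeff_monomial:
  "(deriv ^^ k) (\<lambda>w. w ^ j / c) 0 / fact k = (if j = k then 1 / (c::complex) else 0)"
proof -
  have "(deriv ^^ k) (\<lambda>w. 1 / c * w ^ j) 0 = 1 / c * (deriv ^^ k) (\<lambda>w. (w - 0) ^ j) 0"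
    by (subst higher_deriv_cmult[of _ UNIV]) (auto intro!: holomorphic_intros)
  also have "\<dots> = 1 / c * (pochhammer (of_nat (Suc j - k)) k * 0 ^ (j - k))"
    by (subst higher_deriv_power) simp
  also have "\<dots> = (if j = k then fact k / c else 0)"
    by (cases j k rule: linorder_cases) (auto simp: pochhammer_fact[symmetric] pochhammer_0_left)
  finally show ?thesis by simp
qed

section \<open>Pluriharmonic functions of one coordinate\<close>

context
  fixes i :: "'n::finite"
begin

text \<open>This class is stable under directional derivatives, see \<open>frechet_axfun\<close>, so
  both orders of smoothness reduce to the holomorphy of complex derivatives.\<close>

definition axfun :: "(complex \<Rightarrow> complex) \<Rightarrow> (complex \<Rightarrow> complex) \<Rightarrow> complex ^ 'n \<Rightarrow> complex" where
  "axfun A B z = A (z $ i) + cnj (B (z $ i))"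

lemma axfun_has_derivative:
  assumes "A holomorphic_on UNIV" "B holomorphic_on UNIV"
  shows "(axfun A B has_derivative (\<lambda>v. deriv A (z $ i) * v $ i + cnj (deriv B (z $ i) * v $ i))) (at z)"
proof -
  have comp: "((\<lambda>z. F (z $ i)) has_derivative (\<lambda>v. deriv F (z $ i) * v $ i)) (at z)"
    if "F holomorphic_on UNIV" for F :: "complex \<Rightarrow> complex"
  proof -
    have "(F has_derivative (*) (deriv F (z $ i))) (at (z $ i))"
      using holomorphic_derivI[OF that open_UNIV, of "z $ i"] by (simp add: has_field_derivative_def)
    from diff_chain_at[OF bounded_linear.has_derivative[OF bounded_linear_vec_nth has_derivative_ident] this]
    show ?thesis by (simp add: o_def)
  qed
  show ?thesis
    unfolding axfun_def[abs_def]
    by (intro has_derivative_add comp assms bounded_linear.has_derivative[OF bounded_linear_cnj])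
qed

lemma frechet_axfun:
  assumes "A holomorphic_on UNIV" "B holomorphic_on UNIV"
  shows "(\<lambda>z. frechet_derivative (axfun A B) (at z) v) = axfun (\<lambda>w. deriv A w * v $ i) (\<lambda>w. deriv B w * v $ i)"
proof
  fix z
  show "frechet_derivative (axfun A B) (at z) v = axfun (\<lambda>w. deriv A w * v $ i) (\<lambda>w. deriv B w * v $ i) z"
    unfolding frechet_derivative_at[OF axfun_has_derivative[OF assms, of z], symmetric]
    by (simp add: axfun_def)
qed

lemma continuous_on_axfun:
  assumes "A holomorphic_on UNIV" "B holomorphic_on UNIV"
  shows "continuous_on UNIV (axfun A B)"
  by (intro continuous_at_imp_continuous_on ballI has_derivative_continuous[OF axfun_has_derivative[OF assms]])

lemma holomorphic_deriv_mult:
  "A holomorphic_on UNIV \<Longrightarrow> (\<lambda>w. deriv A w * c) holomorphic_on UNIV"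
  by (intro holomorphic_intros holomorphic_deriv) auto

lemma C1_axfun:
  assumes "A holomorphic_on UNIV" "B holomorphic_on UNIV"
  shows "C1 (axfun A B)"
  unfolding C1_def
proof (intro conjI allI)
  show "axfun A B differentiable at z" for z
    using axfun_has_derivative[OF assms] differentiable_def by blast
  show "continuous_on UNIV (\<lambda>z. frechet_derivative (axfun A B) (at z) v)" for v
    unfolding frechet_axfun[OF assms] by (intro continuous_on_axfun holomorphic_deriv_mult assms)
qed

lemma pluriharmonic_axfun:
  assumes "A holomorphic_on UNIV" "B holomorphic_on UNIV"
  shows "pluriharmonic (axfun A B)"
  unfolding pluriharmonic_def C2_def
proof (intro conjI allI)
  show "C1 (axfun A B)" by (rule C1_axfun[OF assms])
  show "C1 (\<lambda>z. frechet_derivative (axfun A B) (at z) v)" for v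
    unfolding frechet_axfun[OF assms] by (intro C1_axfun holomorphic_deriv_mult assms)
  fix j k z
  note fr = fun_cong[OF frechet_axfun]
  define c :: complex where "c = (if k = i then 1 else 0)"
  \<comment> \<open>The derivative in the conjugate variable kills A and leaves the conjugate of a
    holomorphic function, which \<open>d_z\<close> then kills.\<close>
  have "d_zbar k (axfun A B) = axfun (\<lambda>w. 0) (\<lambda>w. deriv B w * c)"
    unfolding d_zbar_def fr[OF assms] by (auto simp: fun_eq_iff axfun_def axis_def c_def complex_eq_iff)
  then show "d_z j (d_zbar k (axfun A B)) z = 0"
    by (simp add: d_z_def fr holomorphic_deriv_mult assms axfun_def axis_def)
qed

lemma entire_axfun:
  assumes "A holomorphic_on UNIV"
  shows "entire (\<lambda>z. A (z $ i))"
  unfolding entire_def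
proof (intro allI exI conjI)
  fix z :: "complex ^ 'n"
  show "((\<lambda>z. A (z $ i)) has_derivative (\<lambda>v. deriv A (z $ i) * v $ i)) (at z)"
    using axfun_has_derivative[OF assms, of "\<lambda>_. 0" z] by (simp add: axfun_def[abs_def])
qed simp

end

lemma entire_series:
  assumes "\<And>w. summable (\<lambda>k. a k * (w::complex) ^ k)"
  shows "(\<lambda>w. \<Sum>k. a k * w ^ k) holomorphic_on UNIV"
proof -
  have "(\<lambda>w. \<Sum>k. a k * w ^ k) holomorphic_on ball 0 r" for r
    by (rule power_series_holomorphic[of 0 r a]) (use assms in \<open>simp add: summable_sums\<close>)
  then have "(\<lambda>w. \<Sum>k. a k * w ^ k) holomorphic_on (\<Union>r. ball 0 r)"
    by (intro holomorphic_on_UN_open) auto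
  moreover have "(\<Union>r. ball 0 r) = (UNIV :: complex set)"
    by (auto simp: gt_ex)
  ultimately show ?thesis by simp
qed

section \<open>The Fock space\<close>

lemma entire_continuous: "entire f \<Longrightarrow> continuous_on UNIV f"
  unfolding entire_def by (metis continuous_at_imp_continuous_on has_derivative_continuous)

lemma function_space_Fock:
  assumes "\<alpha> > 0"
  shows "function_space \<alpha> (Fock \<alpha> :: (complex ^ 'n \<Rightarrow> complex) set)"
proof
  show "\<alpha> > 0" by fact
next
  fix f :: "complex ^ 'n \<Rightarrow> complex" assume "f \<in> Fock \<alpha>"
  then show "continuous_on UNIV f" "sq_integrable \<alpha> f"
    by (auto simp: Fock_def entire_continuous)
next
  show "(\<lambda>z. 0) \<in> Fock \<alpha>"
    by (auto simp: Fock_def entire_def sq_integrable_def intro!: exI[of _ "\<lambda>_. 0"])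
next
  fix f :: "complex ^ 'n \<Rightarrow> complex" and c assume f: "f \<in> Fock \<alpha>"
  have "entire (\<lambda>z. c * f z)"
    unfolding entire_def
  proof
    fix z
    obtain f' where "(f has_derivative f') (at z)" "\<forall>c v. f' (c *s v) = c * f' v"
      using f unfolding Fock_def entire_def by blast
    then show "\<exists>f'. ((\<lambda>z. c * f z) has_derivative f') (at z) \<and> (\<forall>c v. f' (c *s v) = c * f' v)"
      by (intro exI[of _ "\<lambda>v. c * f' v"]) (auto intro!: has_derivative_mult_right)
  qed
  then show "(\<lambda>z. c * f z) \<in> Fock \<alpha>"
    using f by (auto simp: Fock_def sq_integrable_scale)
next
  fix f g :: "complex ^ 'n \<Rightarrow> complex" assume fg: "f \<in> Fock \<alpha>" "g \<in> Fock \<alpha>"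
  have "entire (\<lambda>z. f z + g z)"
    unfolding entire_def
  proof
    fix z
    obtain f' where "(f has_derivative f') (at z)" "\<forall>c v. f' (c *s v) = c * f' v"
      using fg unfolding Fock_def entire_def by blast
    moreover obtain g' where "(g has_derivative g') (at z)" "\<forall>c v. g' (c *s v) = c * g' v"
      using fg unfolding Fock_def entire_def by blast
    ultimately show "\<exists>f'. ((\<lambda>z. f z + g z) has_derivative f') (at z) \<and> (\<forall>c v. f' (c *s v) = c * f' v)"
      by (intro exI[of _ "\<lambda>v. f' v + g' v"]) (auto intro!: has_derivative_add simp: distrib_left)
  qed
  then show "(\<lambda>z. f z + g z) \<in> Fock \<alpha>"
    using fg by (auto simp: Fock_def sq_integrable_add)
qed

lemma epow_holomorphic: "(\<lambda>w. w ^ j / complex_of_real (sqrt (fact j * \<alpha> ^ j))) holomorphic_on UNIV"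
  unfolding divide_inverse by (intro holomorphic_intros)

lemma entire_epow: "entire (epow \<alpha> i k)"
  using entire_axfun[OF epow_holomorphic[of k \<alpha>], of i] by (simp add: epow_def[abs_def])

lemma epow_Fock:
  assumes "\<alpha> > 0"
  shows "epow \<alpha> i k \<in> Fock \<alpha>"
  using assms by (auto simp: Fock_def entire_epow sq_integrable_epow)

lemma ip_epow_epow:
  fixes i :: "'n::finite"
  assumes \<alpha>: "\<alpha> > 0"
  shows "ip \<alpha> (epow \<alpha> i j) (epow \<alpha> i k) = (if j = k then 1 else 0)"
proof -
  have "ip \<alpha> (epow \<alpha> i j) (epow \<alpha> i k) =
      (deriv ^^ k) (\<lambda>w. w ^ j / of_real (sqrt (fact j * \<alpha> ^ j))) 0 / fact k * of_real (sqrt (fact k * \<alpha> ^ k))"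
    by (rule ip_epow[OF \<alpha> entire_imp_line_harmonic[OF entire_epow] continuous_on_epow[OF \<alpha>]
          sq_integrable_epow[OF \<alpha>] epow_holomorphic, where h = "\<lambda>_. 0"])
      (auto simp: epow_def axis_def)
  also have "\<dots> = (if j = k then 1 else 0)"
    unfolding taylor_coeff_monomial using \<alpha> by auto
  finally show ?thesis .
qed

lemma ip_epow_cnj_epow:
  fixes i :: "'n::finite"
  assumes \<alpha>: "\<alpha> > 0" and k: "k > 0"
  shows "ip \<alpha> (epow \<alpha> i j) (\<lambda>z. cnj (epow \<alpha> i k z)) = 0"
proof -
  have "ip \<alpha> (epow \<alpha> i j) (\<lambda>z. cnj (epow \<alpha> i k z)) =
      cnj ((deriv ^^ k) (\<lambda>_. 0) 0 / fact k) * of_real (sqrt (fact k * \<alpha> ^ k))"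
    by (rule ip_cnj_epow[OF \<alpha> entire_imp_line_harmonic[OF entire_epow] continuous_on_epow[OF \<alpha>]
          sq_integrable_epow[OF \<alpha>] epow_holomorphic _ _ _ k, where h = "\<lambda>_. 0"])
      (auto simp: epow_def axis_def)
  then show ?thesis by simp
qed

text \<open>\<open>expand\<close> is the Taylor series of f restricted to the axis, with
  antiholomorphic part 0; \<open>closed\<close> is the holomorphy of a power series in one
  coordinate.\<close>

lemma axis_space_Fock:
  fixes i :: "'n::finite"
  assumes \<alpha>: "\<alpha> > 0"
  shows "axis_space \<alpha> (Fock \<alpha>) i (epow \<alpha> i) (\<lambda>k. k)"
proof -
  interpret function_space \<alpha> "Fock \<alpha> :: (complex ^ 'n \<Rightarrow> complex) set"
    by (rule function_space_Fock[OF \<alpha>])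
  show ?thesis
  proof
    show "epow \<alpha> i k \<in> Fock \<alpha>" for k by (rule epow_Fock[OF \<alpha>])
    show "epow \<alpha> i k (t *\<^sub>R z) = of_real t ^ k * epow \<alpha> i k z" for k t z by (rule epow_scale)
    show "epow \<alpha> i k (axis i (z $ i)) = epow \<alpha> i k z" for k z by (rule epow_axis)
    show "ip \<alpha> (epow \<alpha> i j) (epow \<alpha> i k) = (if j = k then 1 else 0)" for j k
      by (rule ip_epow_epow[OF \<alpha>])
    show "summable (\<lambda>k. (norm (epow \<alpha> i k z))\<^sup>2)" for z
      using epow_sums[OF \<alpha>] by (rule sums_summable)
    show "summable (\<lambda>k. x ^ k)" if "0 < x" "x < 1" for x :: real
      using that by (intro summable_geometric) auto
    show "mono (\<lambda>k::nat. k)" by (simp add: mono_def)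
  next
    fix f :: "complex ^ 'n \<Rightarrow> complex" and \<zeta>
    assume f: "f \<in> Fock \<alpha>"
    then have en: "entire f" by (simp add: Fock_def)
    have "(\<lambda>\<zeta>. f (0 + \<zeta> *s axis i 1)) holomorphic_on UNIV"
      by (rule entire_line_holomorphic[OF en])
    then have hol: "(\<lambda>\<zeta>. f (axis i \<zeta>)) holomorphic_on UNIV"
      by (simp add: axis_eq_smult[symmetric])
    show "(\<lambda>k. ip \<alpha> f (epow \<alpha> i k) * epow \<alpha> i k (axis i \<zeta>)) sums f (axis i \<zeta>)"
      by (rule epow_expand[OF \<alpha> entire_imp_line_harmonic[OF en] H_cont[OF f] H_sq[OF f] hol, of "\<lambda>_. 0"]) auto
  next
    fix c
    assume c: "\<And>z. summable (\<lambda>k. norm (c k * epow \<alpha> i k z))"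
      and sq: "sq_integrable \<alpha> (\<lambda>z. \<Sum>k. c k * epow \<alpha> i k z)"
    define a where "a k = c k / of_real (sqrt (fact k * \<alpha> ^ k))" for k
    have ca: "c k * epow \<alpha> i k z = a k * (z $ i) ^ k" for k z
      by (simp add: a_def epow_def)
    have "summable (\<lambda>k. a k * w ^ k)" for w
      using summable_norm_cancel[OF c[of "axis i w"]] by (simp add: ca axis_def)
    then have "(\<lambda>w. \<Sum>k. a k * w ^ k) holomorphic_on UNIV" by (rule entire_series)
    from entire_axfun[OF this, of i] have "entire (\<lambda>z. \<Sum>k. c k * epow \<alpha> i k z)"
      by (simp add: ca)
    with sq show "(\<lambda>z. \<Sum>k. c k * epow \<alpha> i k z) \<in> Fock \<alpha>"
      by (simp add: Fock_def)
  qed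
qed

section \<open>The pluriharmonic space\<close>

lemma C1_differentiable: "C1 f \<Longrightarrow> f differentiable at z"
  by (simp add: C1_def)

lemma C1_continuous: "C1 f \<Longrightarrow> continuous_on UNIV f"
  by (metis C1_differentiable continuous_at_imp_continuous_on differentiable_imp_continuous_within)

lemma frechet_derivative_add:
  "f differentiable at z \<Longrightarrow> g differentiable at z \<Longrightarrow>
    frechet_derivative (\<lambda>z. f z + g z) (at z) v = frechet_derivative f (at z) v + frechet_derivative g (at z) v"
  by (rule fun_cong[OF frechet_derivative_at[OF has_derivative_add, symmetric]])
    (simp_all add: frechet_derivative_works[symmetric])

lemma frechet_derivative_scale:
  fixes f :: "'a::real_normed_vector \<Rightarrow> complex"
  shows "f differentiable at z \<Longrightarrow>
    frechet_derivative (\<lambda>z. c * f z) (at z) v = c * frechet_derivative f (at z) v"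
  by (rule fun_cong[OF frechet_derivative_at[OF has_derivative_mult_right, symmetric]])
    (simp add: frechet_derivative_works[symmetric])

lemma C1_add: "C1 f \<Longrightarrow> C1 g \<Longrightarrow> C1 (\<lambda>z. f z + g z)"
  by (auto simp: C1_def frechet_derivative_add intro: continuous_on_add)

lemma C1_scale: "C1 f \<Longrightarrow> C1 (\<lambda>z. c * f z)"
  by (auto simp: C1_def frechet_derivative_scale intro!: continuous_intros differentiable_mult)

lemma pluriharmonic_add:
  assumes f: "pluriharmonic f" and g: "pluriharmonic g"
  shows "pluriharmonic (\<lambda>z. f z + g z)"
proof -
  have C: "C1 f" "C1 g" "\<And>v. C1 (\<lambda>z. frechet_derivative f (at z) v)" "\<And>v. C1 (\<lambda>z. frechet_derivative g (at z) v)"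
    using f g by (auto simp: pluriharmonic_def C2_def)
  note fr = frechet_derivative_add[OF C1_differentiable C1_differentiable]
  have zb: "d_zbar k (\<lambda>z. f z + g z) = (\<lambda>z. d_zbar k f z + d_zbar k g z)" for k
    by (simp add: d_zbar_def fun_eq_iff fr C add_divide_distrib distrib_left)
  have C1zb: "C1 (d_zbar k f)" "C1 (d_zbar k g)" for k
  proof -
    have e: "d_zbar k h = (\<lambda>z. 1/2 * (frechet_derivative h (at z) (axis k 1) + \<i> * frechet_derivative h (at z) (axis k \<i>)))" for h
      by (simp add: d_zbar_def fun_eq_iff)
    show "C1 (d_zbar k f)" "C1 (d_zbar k g)" unfolding e by (intro C1_scale C1_add C)+
  qed
  have "d_z j (d_zbar k (\<lambda>z. f z + g z)) z = d_z j (d_zbar k f) z + d_z j (d_zbar k g) z" for j k z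
    unfolding zb by (simp add: d_z_def fr C1zb add_divide_distrib[symmetric] distrib_left)
  then show ?thesis
    using f g by (auto simp: pluriharmonic_def C2_def fr C C1_add)
qed

lemma pluriharmonic_scale:
  assumes f: "pluriharmonic f"
  shows "pluriharmonic (\<lambda>z. c * f z)"
proof -
  have C: "C1 f" "\<And>v. C1 (\<lambda>z. frechet_derivative f (at z) v)"
    using f by (auto simp: pluriharmonic_def C2_def)
  note fr = frechet_derivative_scale[OF C1_differentiable]
  have zb: "d_zbar k (\<lambda>z. c * f z) = (\<lambda>z. c * d_zbar k f z)" for k
    by (simp add: d_zbar_def fun_eq_iff fr C distrib_left mult.left_commute)
  have C1zb: "C1 (d_zbar k f)" for k
  proof -
    have e: "d_zbar k f = (\<lambda>z. 1/2 * (frechet_derivative f (at z) (axis k 1) + \<i> * frechet_derivative f (at z) (axis k \<i>)))"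
      by (simp add: d_zbar_def fun_eq_iff)
    show ?thesis unfolding e by (intro C1_scale C1_add C)
  qed
  have "d_z j (d_zbar k (\<lambda>z. c * f z)) z = c * d_z j (d_zbar k f) z" for j k z
    unfolding zb by (simp add: d_z_def fr C1zb right_diff_distrib mult.left_commute)
  then show ?thesis
    using f by (auto simp: pluriharmonic_def C2_def fr C C1_scale)
qed

lemma function_space_PH:
  assumes "\<alpha> > 0"
  shows "function_space \<alpha> (PH \<alpha> :: (complex ^ 'n \<Rightarrow> complex) set)"
proof
  show "\<alpha> > 0" by fact
next
  fix f :: "complex ^ 'n \<Rightarrow> complex" assume "f \<in> PH \<alpha>"
  then show "continuous_on UNIV f" "sq_integrable \<alpha> f"
    by (auto simp: PH_def pluriharmonic_def C2_def C1_continuous)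
next
  have "pluriharmonic (\<lambda>z :: complex ^ 'n. 0)"
    using pluriharmonic_axfun[of "\<lambda>_. 0" "\<lambda>_. 0"] by (simp add: axfun_def[abs_def])
  then show "(\<lambda>z. 0) \<in> (PH \<alpha> :: (complex ^ 'n \<Rightarrow> complex) set)"
    by (auto simp: PH_def sq_integrable_def)
qed (auto simp: PH_def pluriharmonic_add pluriharmonic_scale sq_integrable_add sq_integrable_scale)

text \<open>Index 2k holds e_k, and index 2k - 1 with k > 0 holds its conjugate. So the constant
  occurs once, and the degrees \<open>(k + 1) div 2\<close> are nondecreasing, as the ordering of
  the singular values requires.\<close>

definition eph :: "real \<Rightarrow> 'n \<Rightarrow> nat \<Rightarrow> complex ^ 'n \<Rightarrow> complex" where
  "eph \<alpha> i k = (if even k then epow \<alpha> i (k div 2) else (\<lambda>z. cnj (epow \<alpha> i (Suc ((k - 1) div 2)) z)))"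

lemma sums_if_complex:
  fixes f g :: "nat \<Rightarrow> complex"
  assumes "g sums x" and "f sums y"
  shows "(\<lambda>n. if even n then f (n div 2) else g ((n - 1) div 2)) sums (y + x)"
  using assms unfolding sums_complex_iff
  using sums_if[of "\<lambda>n. Re (g n)" "Re x" "\<lambda>n. Re (f n)" "Re y"]
    sums_if[of "\<lambda>n. Im (g n)" "Im x" "\<lambda>n. Im (f n)" "Im y"]
  by (simp add: if_distrib[of Re] if_distrib[of Im] add.commute)

text \<open>The kernel on the diagonal: the conjugates repeat the exponential series without its
  constant term, whence the -1.\<close>

lemma eph_sums:
  assumes "\<alpha> > 0"
  shows "(\<lambda>k. (norm (eph \<alpha> i k z))\<^sup>2) sums (2 * exp ((norm (z $ i))\<^sup>2 / \<alpha>) - 1)"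
proof -
  let ?e = "exp ((norm (z $ i))\<^sup>2 / \<alpha>)"
  have 1: "(\<lambda>k. (norm (epow \<alpha> i (Suc k) z))\<^sup>2) sums (?e - 1)"
    using epow_sums[OF assms, of i z] by (subst sums_Suc_iff) (simp add: epow_def[of \<alpha> i 0])
  have "(\<lambda>k. if even k then (norm (epow \<alpha> i (k div 2) z))\<^sup>2 else (norm (epow \<alpha> i (Suc ((k - 1) div 2)) z))\<^sup>2)
      sums ((?e - 1) + ?e)"
    by (rule sums_if[OF 1 epow_sums[OF assms]])
  moreover have "(norm (eph \<alpha> i k z))\<^sup>2 = (if even k then (norm (epow \<alpha> i (k div 2) z))\<^sup>2 else (norm (epow \<alpha> i (Suc ((k - 1) div 2)) z))\<^sup>2)" for k
    by (simp add: eph_def)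
  ultimately show ?thesis by simp
qed

text \<open>Even indices contribute 1/(1 - x) and odd ones x/(1 - x): degree 0 occurs once, every
  other degree twice.\<close>

lemma zigzag_geometric_sums:
  assumes "0 < x" "x < (1::real)"
  shows "(\<lambda>k. x ^ ((k + 1) div 2)) sums ((1 + x) / (1 - x))"
proof -
  have "(\<lambda>k. x * x ^ k) sums (x * (1 / (1 - x)))"
    using assms by (intro sums_mult geometric_sums) auto
  moreover have "(\<lambda>k. x ^ k) sums (1 / (1 - x))"
    using assms by (intro geometric_sums) auto
  ultimately have "(\<lambda>k. if even k then x ^ (k div 2) else x * x ^ ((k - 1) div 2)) sums (x * (1 / (1 - x)) + 1 / (1 - x))"
    by (rule sums_if)
  moreover have "x * (1 / (1 - x)) + 1 / (1 - x) = (1 + x) / (1 - x)"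
    by (simp add: add_divide_distrib)
  moreover have "(if even k then x ^ (k div 2) else x * x ^ ((k - 1) div 2)) = x ^ ((k + 1) div 2)" for k
    by (cases k) (auto elim!: evenE oddE)
  ultimately show ?thesis by simp
qed

lemma cnj_epow_PH:
  fixes i :: "'n::finite"
  assumes "\<alpha> > 0"
  shows "(\<lambda>z. cnj (epow \<alpha> i k z)) \<in> PH \<alpha>" "epow \<alpha> i k \<in> PH \<alpha>"
proof -
  let ?m = "\<lambda>w. w ^ k / of_real (sqrt (fact k * \<alpha> ^ k))"
  have 0: "(\<lambda>w. 0) holomorphic_on (UNIV :: complex set)" by simp
  show "(\<lambda>z. cnj (epow \<alpha> i k z)) \<in> PH \<alpha>" "epow \<alpha> i k \<in> PH \<alpha>"
    using pluriharmonic_axfun[OF 0 epow_holomorphic[of k \<alpha>], of i]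
      pluriharmonic_axfun[OF epow_holomorphic[of k \<alpha>] 0, of i]
    by (simp_all add: PH_def axfun_def[abs_def] epow_def[abs_def] assms
       sq_integrable_epow[unfolded epow_def[abs_def]] sq_integrable_cnj[OF sq_integrable_epow, unfolded epow_def[abs_def], simplified])
qed

lemma axis_space_PH:
  fixes i :: "'n::finite"
  assumes \<alpha>: "\<alpha> > 0"
  shows "axis_space \<alpha> (PH \<alpha>) i (eph \<alpha> i) (\<lambda>k. (k + 1) div 2)"
proof -
  interpret function_space \<alpha> "PH \<alpha> :: (complex ^ 'n \<Rightarrow> complex) set"
    by (rule function_space_PH[OF \<alpha>])
  have odd_index: "Suc ((k - 1) div 2) = (k + 1) div 2" if "odd k" for k
    using that by (auto elim!: oddE)
  have ip_cnj_cnj: "ip \<alpha> (\<lambda>z. cnj (f z)) (\<lambda>z. cnj (g z)) = cnj (ip \<alpha> f g)" for f g :: "complex ^ 'n \<Rightarrow> complex"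
    unfolding ip_def by (subst Bochner_Integration.integral_cnj[symmetric]) (rule Bochner_Integration.integral_cong, simp_all)
  show ?thesis
  proof
    show "eph \<alpha> i k \<in> PH \<alpha>" for k
      by (simp add: eph_def cnj_epow_PH[OF \<alpha>])
    show "eph \<alpha> i k (t *\<^sub>R z) = of_real t ^ ((k + 1) div 2) * eph \<alpha> i k z" for k t z
      using odd_index[of k] by (auto simp: eph_def epow_scale simp del: power_Suc elim!: evenE)
    show "eph \<alpha> i k (axis i (z $ i)) = eph \<alpha> i k z" for k z
      by (simp add: eph_def epow_axis)
    show "ip \<alpha> (eph \<alpha> i j) (eph \<alpha> i k) = (if j = k then 1 else 0)" for j k
    proof (cases "even j"; cases "even k")
      assume "even j" "even k"
      then show ?thesis by (auto simp: eph_def ip_epow_epow[OF \<alpha>] elim!: evenE)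
    next
      assume "even j" "odd k"
      then show ?thesis by (auto simp: eph_def ip_epow_cnj_epow[OF \<alpha>])
    next
      assume "odd j" "even k"
      then show ?thesis
        by (subst ip_commute) (auto simp: eph_def ip_epow_cnj_epow[OF \<alpha>])
    next
      assume "odd j" "odd k"
      then show ?thesis by (auto simp: eph_def ip_cnj_cnj ip_epow_epow[OF \<alpha>] elim!: oddE)
    qed
    show "summable (\<lambda>k. (norm (eph \<alpha> i k z))\<^sup>2)" for z
      using eph_sums[OF \<alpha>] by (rule sums_summable)
    show "summable (\<lambda>k. x ^ ((k + 1) div 2))" if "0 < x" "x < 1" for x :: real
      using zigzag_geometric_sums[OF that] by (rule sums_summable)
    show "mono (\<lambda>k::nat. (k + 1) div 2)" by (simp add: mono_def div_le_mono)
  next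
    fix f :: "complex ^ 'n \<Rightarrow> complex" and \<zeta>
    assume f: "f \<in> PH \<alpha>"
    then have lh: "line_harmonic f" by (simp add: PH_def pluriharmonic_imp_line_harmonic)
    obtain g h where gh: "g holomorphic_on UNIV" "h holomorphic_on UNIV" "h 0 = 0"
      "\<And>\<zeta>. f (0 + \<zeta> *s axis i 1) = g \<zeta> + cnj (h \<zeta>)"
      using line_harmonic_decomp[OF lh, of 0 "axis i 1"] by metis
    have fgh: "f (axis i \<zeta>) = g \<zeta> + cnj (h \<zeta>)" for \<zeta>
      using gh(4)[of \<zeta>] by (simp add: axis_eq_smult[symmetric])
    have "(\<lambda>k. if even k then ip \<alpha> f (epow \<alpha> i (k div 2)) * epow \<alpha> i (k div 2) (axis i \<zeta>)
       else ip \<alpha> f (\<lambda>z. cnj (epow \<alpha> i (Suc ((k - 1) div 2)) z)) * cnj (epow \<alpha> i (Suc ((k - 1) div 2)) (axis i \<zeta>)))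
       sums (g \<zeta> + cnj (h \<zeta>))"
      by (rule sums_if_complex[OF cnj_epow_expand[OF \<alpha> lh H_cont[OF f] H_sq[OF f] gh(1-3) fgh]
            epow_expand[OF \<alpha> lh H_cont[OF f] H_sq[OF f] gh(1-3) fgh]])
    moreover have "(if even k then ip \<alpha> f (epow \<alpha> i (k div 2)) * epow \<alpha> i (k div 2) (axis i \<zeta>)
       else ip \<alpha> f (\<lambda>z. cnj (epow \<alpha> i (Suc ((k - 1) div 2)) z)) * cnj (epow \<alpha> i (Suc ((k - 1) div 2)) (axis i \<zeta>)))
       = ip \<alpha> f (eph \<alpha> i k) * eph \<alpha> i k (axis i \<zeta>)" for k
      by (simp add: eph_def)
    ultimately show "(\<lambda>k. ip \<alpha> f (eph \<alpha> i k) * eph \<alpha> i k (axis i \<zeta>)) sums f (axis i \<zeta>)"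
      by (simp only: fgh)
  next
    fix c
    assume c: "\<And>z. summable (\<lambda>k. norm (c k * eph \<alpha> i k z))"
      and sq: "sq_integrable \<alpha> (\<lambda>z. \<Sum>k. c k * eph \<alpha> i k z)"
    define m where "m k = complex_of_real (sqrt (fact k * \<alpha> ^ k))" for k
    define a where "a k = c (2 * k) / m k" for k
    \<comment> \<open>Coefficients of the function whose conjugate the odd terms form: index 2k - 1
      carries the conjugate of e_k, and there is no such term for k = 0.\<close>
    define b where "b k = (if k = 0 then 0 else cnj (c (2 * k - 1)) / m k)" for k
    have ca: "c (2 * k) * eph \<alpha> i (2 * k) z = a k * (z $ i) ^ k" for k z
      by (simp add: a_def epow_def eph_def m_def)
    have cb: "c (Suc (2 * k)) * eph \<alpha> i (Suc (2 * k)) z = cnj (b (Suc k) * (z $ i) ^ Suc k)" for k z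
      by (simp add: b_def epow_def eph_def m_def)
    have sa: "summable (\<lambda>k. a k * (z $ i) ^ k)" for z
    proof -
      \<comment> \<open>Absolute convergence lets the series be split into its even and odd
        parts.\<close>
      have "summable ((\<lambda>k. norm (c k * eph \<alpha> i k z)) \<circ> (\<lambda>k. 2 * k))"
        by (rule summable_reindex[OF c]) (auto simp: inj_def)
      then show ?thesis unfolding o_def ca by (rule summable_norm_cancel)
    qed
    have "summable (\<lambda>k. b (Suc k) * (z $ i) ^ Suc k)" for z
    proof -
      have "summable ((\<lambda>k. norm (c k * eph \<alpha> i k z)) \<circ> (\<lambda>k. Suc (2 * k)))"
        by (rule summable_reindex[OF c]) (auto simp: inj_def)
      then show ?thesis unfolding o_def cb complex_mod_cnj by (rule summable_norm_cancel)
    qed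
    then have sb: "summable (\<lambda>k. b k * (z $ i) ^ k)" for z
      using summable_Suc_iff[of "\<lambda>k. b k * (z $ i) ^ k"] by blast
    define A where "A w = (\<Sum>k. a k * w ^ k)" for w
    define B where "B w = (\<Sum>k. b k * w ^ k)" for w
    have AB: "A holomorphic_on UNIV" "B holomorphic_on UNIV"
      unfolding A_def B_def using sa[of "axis i _"] sb[of "axis i _"]
      by (auto intro!: entire_series simp: axis_def)
    have "(\<Sum>k. c k * eph \<alpha> i k z) = axfun i A B z" for z
    proof -
      have "(\<lambda>k. b k * (z $ i) ^ k) sums B (z $ i)"
        unfolding B_def using sb by (rule summable_sums)
      then have "(\<lambda>k. b (Suc k) * (z $ i) ^ Suc k) sums B (z $ i)"
        by (subst sums_Suc_iff) (simp add: b_def)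
      then have "(\<lambda>k. cnj (b (Suc k) * (z $ i) ^ Suc k)) sums cnj (B (z $ i))"
        by (subst sums_cnj)
      moreover have "(\<lambda>k. a k * (z $ i) ^ k) sums A (z $ i)"
        unfolding A_def using sa by (rule summable_sums)
      ultimately have "(\<lambda>k. if even k then a (k div 2) * (z $ i) ^ (k div 2) else
          cnj (b (Suc ((k - 1) div 2)) * (z $ i) ^ Suc ((k - 1) div 2))) sums (A (z $ i) + cnj (B (z $ i)))"
        by (rule sums_if_complex)
      moreover have "(if even k then a (k div 2) * (z $ i) ^ (k div 2) else
          cnj (b (Suc ((k - 1) div 2)) * (z $ i) ^ Suc ((k - 1) div 2))) = c k * eph \<alpha> i k z" for k
        unfolding ca[symmetric] cb[symmetric] by (auto elim!: oddE)
      ultimately show ?thesis by (simp add: sums_iff axfun_def)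
    qed
    with pluriharmonic_axfun[OF AB, of i] sq show "(\<lambda>z. \<Sum>k. c k * eph \<alpha> i k z) \<in> PH \<alpha>"
      by (simp add: PH_def)
  qed
qed

section \<open>The two families of measures and optimality\<close>

theorem proposition6p2:
  fixes \<alpha> p :: real
  assumes "\<alpha> > 0" and "p > 0"
  shows "(\<forall>c > 1. \<not> (\<forall>\<mu> :: (complex ^ 'n) measure. admissible \<alpha> p \<mu> \<longrightarrow>
             c * schatten_pow \<alpha> (Fock \<alpha>) p (toeplitz_op \<alpha> (Fock \<alpha>) \<mu>)
               \<le> schatten_pow \<alpha> (PH \<alpha>) p (toeplitz_op \<alpha> (PH \<alpha>) \<mu>)))
       \<and> (\<forall>C < 2 powr (max 1 p). \<not> (\<forall>\<mu> :: (complex ^ 'n) measure. admissible \<alpha> p \<mu> \<longrightarrow>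
             schatten_pow \<alpha> (PH \<alpha>) p (toeplitz_op \<alpha> (PH \<alpha>) \<mu>)
               \<le> C * schatten_pow \<alpha> (Fock \<alpha>) p (toeplitz_op \<alpha> (Fock \<alpha>) \<mu>)))"
proof -
  \<comment> \<open>Any coordinate serves; the index type is nonempty.\<close>
  define i :: 'n where "i = undefined"
  interpret F: axis_space \<alpha> "Fock \<alpha>" i "epow \<alpha> i" "\<lambda>k. k"
    by (rule axis_space_Fock[OF assms(1)])
  interpret P: axis_space \<alpha> "PH \<alpha>" i "eph \<alpha> i" "\<lambda>k. (k + 1) div 2"
    by (rule axis_space_PH[OF assms(1)])
  let ?F = "\<lambda>\<mu> :: (complex ^ 'n) measure. schatten_pow \<alpha> (Fock \<alpha>) p (toeplitz_op \<alpha> (Fock \<alpha>) \<mu>)"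
  let ?P = "\<lambda>\<mu> :: (complex ^ 'n) measure. schatten_pow \<alpha> (PH \<alpha>) p (toeplitz_op \<alpha> (PH \<alpha>) \<mu>)"
  \<comment> \<open>The parameter t is the weight exp(-|\<zeta>|^2/\<alpha>) at the point: t = 1 is
    the origin, and t near 0 is a point far away.\<close>
  have dirac: "\<exists>\<mu>. admissible \<alpha> p \<mu> \<and> ?F \<mu> = 1 \<and> ?P \<mu> = (2 - t) powr p" if t: "0 < t" "t \<le> 1" for t
  proof -
    define x where "x = - ln t"
    have x: "0 \<le> x" "exp (- x) = t" using t by (auto simp: x_def)
    define \<zeta> where "\<zeta> = complex_of_real (sqrt (\<alpha> * x))"
    have \<zeta>: "(norm \<zeta>)\<^sup>2 / \<alpha> = x" using x assms(1) by (simp add: \<zeta>_def)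
    have NF: "F.N \<zeta> = exp x"
      using epow_sums[OF assms(1), of i "axis i \<zeta>"] \<zeta> unfolding F.N_def by (simp add: sums_iff axis_def)
    have NP: "P.N \<zeta> = 2 * exp x - 1"
      using eph_sums[OF assms(1), of i "axis i \<zeta>"] \<zeta> unfolding P.N_def by (simp add: sums_iff axis_def)
    have t': "exp (- (norm \<zeta>)\<^sup>2 / \<alpha>) = t"
      using \<zeta> x(2) by simp
    have ext: "exp x * t = 1" unfolding x(2)[symmetric] by (simp add: exp_minus)
    show ?thesis
    proof (intro exI[of _ "return borel (axis i \<zeta>)"] conjI)
      show "admissible \<alpha> p (return borel (axis i \<zeta>))"
        unfolding admissible_def using F.dirac_toeplitz P.dirac_toeplitz by auto
      show "?F (return borel (axis i \<zeta>)) = 1"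
        unfolding F.dirac_toeplitz(3) NF t' ext by simp
      have "(2 * exp x - 1) * t = 2 - t" using ext by (simp add: algebra_simps)
      then show "?P (return borel (axis i \<zeta>)) = (2 - t) powr p"
        unfolding P.dirac_toeplitz(3) NP t' by simp
    qed
  qed
  have gauss: "\<exists>\<mu>. admissible \<alpha> p \<mu> \<and> ?F \<mu> = 1 / (1 - y) \<and> ?P \<mu> = (1 + y) / (1 - y)"
    if y: "0 < y" "y < 1" for y
  proof -
    \<comment> \<open>Chosen so that the p-th powers of the singular values \<open>r ^ d k\<close>
      are \<open>y ^ d k\<close>.\<close>
    define r where "r = y powr (1 / p)"
    have r: "0 < r" "r < 1" "r powr p = y"
      using y assms(2) powr_less_mono2[of "1 / p" y 1] by (auto simp: r_def powr_powr)
    note FG = F.axis_gauss_toeplitz[OF r(1,2) assms(2)] and PG = P.axis_gauss_toeplitz[OF r(1,2) assms(2)]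
    have "(\<Sum>k. y ^ k) = 1 / (1 - y)"
      using y by (intro suminf_geometric) auto
    moreover have "(\<Sum>k. y ^ ((k + 1) div 2)) = (1 + y) / (1 - y)"
      using zigzag_geometric_sums[OF y] by (simp add: sums_iff)
    moreover have "sets (axis_gauss \<alpha> i (sqrt r)) = sets borel"
      by (simp add: axis_gauss_def)
    ultimately show ?thesis
      using FG PG r(3) by (intro exI[of _ "axis_gauss \<alpha> i (sqrt r)"]) (auto simp: admissible_def)
  qed
  show ?thesis
  proof (intro conjI allI impI notI)
    fix c :: real
    assume "c > 1" and *: "\<forall>\<mu>. admissible \<alpha> p \<mu> \<longrightarrow> c * ?F \<mu> \<le> ?P \<mu>"
    \<comment> \<open>For the unit mass at the origin both sums equal 1, which would force c to be
      at most 1.\<close>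
    obtain \<mu> where "admissible \<alpha> p \<mu>" "?F \<mu> = 1" "?P \<mu> = (2 - 1) powr p"
      using dirac[of 1] by auto
    with * \<open>c > 1\<close> show False by fastforce
  next
    fix C :: real
    assume C: "C < 2 powr (max 1 p)" and *: "\<forall>\<mu>. admissible \<alpha> p \<mu> \<longrightarrow> ?P \<mu> \<le> C * ?F \<mu>"
    show False
    proof (cases "p \<ge> 1")
      case True
      \<comment> \<open>Here the maximum is p; the bound 2^p is approached as t tends to 0, so some
        t already exceeds C.\<close>
      have "((\<lambda>t. (2 - t) powr p) \<longlongrightarrow> (2 - 0) powr p) (at_right 0)"
        by (intro tendsto_intros) auto
      then have "eventually (\<lambda>t. C < (2 - t) powr p) (at_right 0)"
        using C True by (intro order_tendstoD(1)) (auto simp: max_def)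
      moreover have "eventually (\<lambda>t. t \<in> {0<..<1}) (at_right (0::real))"
        by (rule eventually_at_right_real) simp
      ultimately have "eventually (\<lambda>t. C < (2 - t) powr p \<and> t \<in> {0<..<1}) (at_right 0)"
        by (rule eventually_conj)
      then obtain t where t: "C < (2 - t) powr p" "0 < t" "t < 1"
        using eventually_happens[of _ "at_right (0::real)"] by auto
      obtain \<mu> where "admissible \<alpha> p \<mu>" "?F \<mu> = 1" "?P \<mu> = (2 - t) powr p"
        using dirac[of t] t by auto
      with * t show False by fastforce
    next
      case False
      then have "C < 2" using C by (simp add: max_def)
      \<comment> \<open>The quotient of the two sums is 1 + y, which exceeds C by this choice; the
        maximum with 0 keeps y positive.\<close>
      then obtain y where y: "max 0 (C - 1) < y" "y < 1"
        using dense[of "max 0 (C - 1)" 1] by auto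
      obtain \<mu> where "admissible \<alpha> p \<mu>" "?F \<mu> = 1 / (1 - y)" "?P \<mu> = (1 + y) / (1 - y)"
        using gauss[of y] y by auto
      then have "(1 + y) / (1 - y) \<le> C / (1 - y)" using * by fastforce
      then have "1 + y \<le> C" using y by (simp add: divide_le_cancel)
      then show False using y by simp
    qed
  qed
qed

end
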